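(* Let $\mathcal K=(K,\Gamma,\mathbf k;v,\pi)$ be a valued difference field satisfying Axiom 2 that is a Witt case with $\mathbf k$ infinite of characteristic $p$. Let $\{a_\rho\}$ be a pc-sequence in $K$ and $a_\rho\leadsto a$ with $a$ in an extension of $\mathcal K$ that is a Witt case. Let $G(x)$ be a $\sigma$-polynomial over $K$ of order $\le n$ such that (i) $G(a_\rho)\leadsto0$, and (ii) $\Lambda_{\mathbf j,m}(G(m,b_\rho))\not\leadsto0$ whenever $1\le m\le\deg G$, $\mathbf j\in\mathbb N^{n+1}$, $1\le|\mathbf j|\le mp^n$, and $\{b_\rho\}$ is a pc-sequence in $K$ equivalent to $\{a_\rho\}$. Let $\Sigma$ be a finite set of $\sigma$-polynomials over $K$. Then there is a pc-sequence $\{b_\rho\}$ in $K$, equivalent to $\{a_\rho\}$, such that $G(b_\rho)\leadsto0$ and $H(b_\rho)\leadsto H(a)$ for each nonconstant $H\in\Sigma$.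
   Context: A valued difference field is $(K,\Gamma,\mathbf k;v,\pi)$ with $K$ a field with automorphism $\sigma$, $v:K^\times\to\Gamma$ a surjective valuation, valuation ring $\mathcal O$, $\pi:\mathcal O\to\mathbf k$ the residue map; $\sigma(\mathcal O)=\mathcal O$, inducing $\bar\sigma$ on $\mathbf k$, and $v(\sigma(a))=v(a)$ for $a\in K^\times$ (Axiom 1, standing, also for extensions). Axiom 2: every $\gamma\in\Gamma$ is $v(a)$ for some $a$ with $\sigma(a)=a$. Witt case: $\operatorname{char}K=0$, $\operatorname{char}\mathbf k=p>0$, $\mathbf k$ perfect, least positive element of $\Gamma$ is $v(p)$, and $\bar\sigma(y)=y^p$ on $\mathbf k$. A $\sigma$-polynomial of order $\le n$ is $G(x)=g(x,\sigma(x),\dots,\sigma^n(x))$, $g\in K[x_0,\dots,x_n]$, and $\deg G=\deg g$ (total degree). With $g(\mathbf x+\mathbf y)=\sum_{\mathbf l}g_{(\mathbf l)}(\mathbf x)\mathbf y^{\mathbf l}$, put $G_{(\mathbf l)}(x)=g_{(\mathbf l)}(x,\dots,\sigma^n(x))$ and $G(m,x)=(G_{(\mathbf l)}(x))_{|\mathbf l|=m}$ (a tuple indexed by $\mathbf l\in\mathbb N^{n+1}$ with $|\mathbf l|=m$). Let $D(y_0,\dots,y_n)=(D_0,\dots,D_n)$ with $D_k=y_0^{p^k}+py_1^{p^{k-1}}+\dots+p^ky_k$. For $m>0$, $\mathbf j\in\mathbb N^{n+1}$, $\Lambda_{\mathbf j,m}\in\mathbb Z[(x_{\mathbf l})_{|\mathbf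 l|=m}]$ is the homogeneous linear form (depending only on $\mathbf j,m,n,p$) such that for every field $F_0$ of characteristic 0 and every homogeneous $F=\sum_{|\mathbf l|=m}a_{\mathbf l}\mathbf x^{\mathbf l}\in F_0[x_0,\dots,x_n]$, the coefficient of $\mathbf y^{\mathbf j}$ in $F(D(y_0,\dots,y_n))$ is $\Lambda_{\mathbf j,m}((a_{\mathbf l}))$. pc-sequence, pseudoconvergence $\leadsto$ (for the limit 0: $v$ of the terms eventually strictly increasing), and equivalence of pc-sequences (same pseudolimits in all valued field extensions) as usual. *)

theory Defs
  imports
    "HOL-Algebra.Algebraic_Closure_Type"
    "HOL-Algebra.Generated_Fields"
    "HOL-Algebra.Weak_Morphisms"
    "HOL-Library.Poly_Mapping"
begin

section \<open>Polynomials in countably many variables\<close>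

type_synonym 'a mpoly = "(nat \<Rightarrow>\<^sub>0 nat) \<Rightarrow>\<^sub>0 'a"

definition Const :: "'a::zero \<Rightarrow> 'a mpoly" where
  "Const c = Poly_Mapping.single 0 c"

definition Var :: "nat \<Rightarrow> 'a::zero_neq_one mpoly" where
  "Var i = Poly_Mapping.single (Poly_Mapping.single i 1) 1"

definition wt :: "(nat \<Rightarrow>\<^sub>0 nat) \<Rightarrow> nat" where
  "wt l = (\<Sum>i\<in>Poly_Mapping.keys l. Poly_Mapping.lookup l i)"

definition total_degree :: "'a::zero mpoly \<Rightarrow> nat" where
  "total_degree g = Max (insert 0 (wt ` Poly_Mapping.keys g))"

definition eval_mpoly :: "('a::zero \<Rightarrow> 'b::comm_semiring_1) \<Rightarrow> (nat \<Rightarrow> 'b) \<Rightarrow> 'a mpoly \<Rightarrow> 'b" where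
  "eval_mpoly h x g = (\<Sum>l\<in>Poly_Mapping.keys g. h (Poly_Mapping.lookup g l) * (\<Prod>i\<in>Poly_Mapping.keys l. x i ^ Poly_Mapping.lookup l i))"

text \<open>\<open>g(x + y)\<close>, as a polynomial in the variables \<open>y\<close> with coefficients in \<open>K[x]\<close>.\<close>

definition taylor :: "'a::comm_semiring_1 mpoly \<Rightarrow> 'a mpoly mpoly" where
  "taylor g = eval_mpoly (\<lambda>c. Const (Const c)) (\<lambda>i. Const (Var i) + Var i) g"

text \<open>
  A \<open>\<sigma>\<close>-polynomial is represented by the formal polynomial \<open>g\<close> with
  \<open>G(x) = g(x, \<sigma>(x), \<sigma>\<^sup>2(x), \<dots>)\<close>; its degree is \<open>total_degree g\<close>, and it is
  constant iff \<open>g\<close> is of the form \<open>Const c\<close>.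
\<close>

definition order_le :: "nat \<Rightarrow> 'a::zero mpoly \<Rightarrow> bool" where
  "order_le n g \<longleftrightarrow> (\<forall>l\<in>Poly_Mapping.keys g. Poly_Mapping.keys l \<subseteq> {..n})"

text \<open>The map \<open>h\<close> embeds the coefficients into the field in which \<open>G\<close> is evaluated.\<close>

definition sigma_eval ::
  "('a::zero \<Rightarrow> 'b::comm_semiring_1) \<Rightarrow> ('b \<Rightarrow> 'b) \<Rightarrow> 'a mpoly \<Rightarrow> 'b \<Rightarrow> 'b" where
  "sigma_eval h \<sigma> G x = eval_mpoly h (\<lambda>i. (\<sigma> ^^ i) x) G"

text \<open>
  The family \<open>(G\<^bsub>(l)\<^esub>(x))\<^sub>l\<close>; the tuple \<open>G(m, x)\<close> is its restriction to the indices
  \<open>l\<close> of weight \<open>m\<close>.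
\<close>

definition sigma_taylor ::
  "('a::comm_semiring_1 \<Rightarrow> 'a) \<Rightarrow> 'a mpoly \<Rightarrow> 'a \<Rightarrow> (nat \<Rightarrow>\<^sub>0 nat) \<Rightarrow> 'a" where
  "sigma_taylor \<sigma> G x l = sigma_eval id \<sigma> (Poly_Mapping.lookup (taylor G) l) x"


section \<open>The linear forms \<open>\<Lambda>\<^bsub>j,m\<^esub>\<close>\<close>

definition Dpoly :: "nat \<Rightarrow> nat \<Rightarrow> 'a::comm_semiring_1 mpoly" where
  "Dpoly p k = (\<Sum>i\<le>k. of_nat (p ^ i) * Var i ^ (p ^ (k - i)))"

definition multi_indices :: "nat \<Rightarrow> nat \<Rightarrow> (nat \<Rightarrow>\<^sub>0 nat) set" where
  "multi_indices n m = {l. Poly_Mapping.keys l \<subseteq> {..n} \<and> wt l = m}"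

text \<open>
  The coefficient of \<open>x\<^sub>l\<close> in \<open>\<Lambda>\<^bsub>j,m\<^esub>\<close> is the coefficient of \<open>y\<^sup>j\<close> in the image of the
  monomial \<open>x\<^sup>l\<close> under the substitution \<open>D\<close>.
\<close>

definition Lambda_coeff :: "nat \<Rightarrow> (nat \<Rightarrow>\<^sub>0 nat) \<Rightarrow> (nat \<Rightarrow>\<^sub>0 nat) \<Rightarrow> int" where
  "Lambda_coeff p j l = Poly_Mapping.lookup (\<Prod>k\<in>Poly_Mapping.keys l. Dpoly p k ^ Poly_Mapping.lookup l k) j"

definition Lambda ::
  "nat \<Rightarrow> nat \<Rightarrow> (nat \<Rightarrow>\<^sub>0 nat) \<Rightarrow> nat \<Rightarrow> ((nat \<Rightarrow>\<^sub>0 nat) \<Rightarrow> 'a::comm_ring_1) \<Rightarrow> 'a" where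
  "Lambda p n j m a = (\<Sum>l\<in>multi_indices n m. of_int (Lambda_coeff p j l) * a l)"

lemma finite_multi_indices: "finite (multi_indices n m)"
proof -
  have "Poly_Mapping.lookup ` multi_indices n m \<subseteq> {f. \<forall>i. (i \<in> {..n} \<longrightarrow> f i \<in> {..m}) \<and> (i \<notin> {..n} \<longrightarrow> f i = 0)}"
  proof (intro image_subsetI CollectI conjI allI impI)
    fix l i assume l: "l \<in> multi_indices n m"
    show "Poly_Mapping.lookup l i \<in> {..m}"
    proof (cases "i \<in> Poly_Mapping.keys l")
      case True
      then have "Poly_Mapping.lookup l i \<le> wt l"
        unfolding wt_def by (intro member_le_sum) auto
      then show ?thesis using l by (simp add: multi_indices_def)
    qed (simp add: in_keys_iff)
    assume "i \<notin> {..n}"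
    then show "Poly_Mapping.lookup l i = 0"
      using l by (auto simp: multi_indices_def in_keys_iff)
  qed
  moreover have "finite \<dots>"
    by (rule finite_set_of_finite_funs) auto
  ultimately have "finite (Poly_Mapping.lookup ` multi_indices n m)"
    by (rule finite_subset)
  then show ?thesis
    by (rule finite_imageD) (simp add: inj_on_def poly_mapping_eqI)
qed

definition of_int_mpoly :: "int mpoly \<Rightarrow> 'a::comm_ring_1 mpoly" where
  "of_int_mpoly g = Poly_Mapping.map of_int g"

lemma lookup_of_int_mpoly: "Poly_Mapping.lookup (of_int_mpoly g) l = of_int (Poly_Mapping.lookup g l)"
  by (simp add: of_int_mpoly_def Poly_Mapping.map.rep_eq when_def)

lemma of_int_mpoly_add: "of_int_mpoly (f + g) = of_int_mpoly f + of_int_mpoly g"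
  by (rule poly_mapping_eqI) (simp add: lookup_of_int_mpoly lookup_add)

lemma of_int_mpoly_zero: "of_int_mpoly 0 = 0"
  by (rule poly_mapping_eqI) (simp add: lookup_of_int_mpoly)

lemma of_int_mpoly_single:
  "of_int_mpoly (Poly_Mapping.single l c) = Poly_Mapping.single l (of_int c)"
  by (rule poly_mapping_eqI) (simp add: lookup_of_int_mpoly lookup_single when_def)

lemma of_int_mpoly_one: "of_int_mpoly 1 = 1"
  using of_int_mpoly_single[of 0 1] by (simp del: single_one add: single_one[symmetric])

lemma mpoly_expand: "g = (\<Sum>l\<in>Poly_Mapping.keys g. Poly_Mapping.single l (Poly_Mapping.lookup g l))"
proof (rule poly_mapping_eqI)
  fix k
  show "Poly_Mapping.lookup g k = Poly_Mapping.lookup (\<Sum>l\<in>Poly_Mapping.keys g. Poly_Mapping.single l (Poly_Mapping.lookup g l)) k"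
    by (cases "k \<in> Poly_Mapping.keys g")
       (auto simp: lookup_sum lookup_single when_def sum.delta in_keys_iff
             cong: if_cong)
qed

lemma of_int_mpoly_sum: "of_int_mpoly (sum f A) = (\<Sum>x\<in>A. of_int_mpoly (f x))"
  by (induction A rule: infinite_finite_induct) (auto simp: of_int_mpoly_zero of_int_mpoly_add)

lemma of_int_mpoly_mult: "of_int_mpoly (f * g) = of_int_mpoly f * of_int_mpoly g"
proof -
  have "f * g = (\<Sum>k\<in>Poly_Mapping.keys f. Poly_Mapping.single k (Poly_Mapping.lookup f k)) *
      (\<Sum>l\<in>Poly_Mapping.keys g. Poly_Mapping.single l (Poly_Mapping.lookup g l))"
    by (simp only: mpoly_expand[symmetric])
  then have "of_int_mpoly (f * g) =
      (\<Sum>k\<in>Poly_Mapping.keys f. of_int_mpoly (Poly_Mapping.single k (Poly_Mapping.lookup f k))) *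
      (\<Sum>l\<in>Poly_Mapping.keys g. of_int_mpoly (Poly_Mapping.single l (Poly_Mapping.lookup g l)))"
    by (simp add: of_int_mpoly_sum of_int_mpoly_single sum_product mult_single)
  then show ?thesis
    by (simp only: of_int_mpoly_sum[symmetric] mpoly_expand[symmetric])
qed

lemma of_int_mpoly_power: "of_int_mpoly (f ^ k) = of_int_mpoly f ^ k"
  by (induction k) (auto simp: of_int_mpoly_one of_int_mpoly_mult)

lemma of_int_mpoly_prod: "of_int_mpoly (prod f A) = (\<Prod>x\<in>A. of_int_mpoly (f x))"
  by (induction A rule: infinite_finite_induct) (auto simp: of_int_mpoly_one of_int_mpoly_mult)

lemma of_int_mpoly_of_nat: "of_int_mpoly (of_nat k) = of_nat k"
  by (induction k) (auto simp: of_int_mpoly_zero of_int_mpoly_add of_int_mpoly_one)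

lemma of_int_mpoly_Dpoly: "of_int_mpoly (Dpoly p k) = (Dpoly p k :: 'a::comm_ring_1 mpoly)"
proof -
  have "of_int_mpoly (Var i) = (Var i :: 'a mpoly)" for i
    by (simp add: Var_def of_int_mpoly_single)
  then show ?thesis
    by (simp add: Dpoly_def of_int_mpoly_sum of_int_mpoly_mult of_int_mpoly_power of_int_mpoly_of_nat
             del: of_nat_power)
qed

text \<open>The defining property of the forms \<open>\<Lambda>\<^bsub>j,m\<^esub>\<close>.\<close>

lemma Lambda_eq_coeff:
  fixes a :: "(nat \<Rightarrow>\<^sub>0 nat) \<Rightarrow> 'a::comm_ring_1"
  shows "Poly_Mapping.lookup (eval_mpoly Const (Dpoly p)
           (\<Sum>l\<in>multi_indices n m. Poly_Mapping.single l (a l))) j = Lambda p n j m a"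
proof -
  define F where "F = (\<Sum>l\<in>multi_indices n m. Poly_Mapping.single l (a l))"
  have lF: "Poly_Mapping.lookup F k = (if k \<in> multi_indices n m then a k else 0)" for k
    by (simp add: F_def lookup_sum lookup_single when_def finite_multi_indices)
  have kF: "Poly_Mapping.keys F \<subseteq> multi_indices n m"
    by (auto simp: in_keys_iff lF split: if_splits)
  have c: "Poly_Mapping.lookup (Const c * P) j = c * Poly_Mapping.lookup P j" for c :: 'a and P
    unfolding Const_def
    by (simp add: mult_map_scale_conv_mult[symmetric] Poly_Mapping.map.rep_eq when_def)
  have L: "Poly_Mapping.lookup (\<Prod>k\<in>Poly_Mapping.keys l. Dpoly p k ^ Poly_Mapping.lookup l k :: 'a mpoly) j = of_int (Lambda_coeff p j l)" for l
  proof -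
    have "(\<Prod>k\<in>Poly_Mapping.keys l. Dpoly p k ^ Poly_Mapping.lookup l k) =
          (of_int_mpoly (\<Prod>k\<in>Poly_Mapping.keys l. Dpoly p k ^ Poly_Mapping.lookup l k) :: 'a mpoly)"
      by (simp add: of_int_mpoly_prod of_int_mpoly_power of_int_mpoly_Dpoly)
    then show ?thesis
      by (simp only: lookup_of_int_mpoly Lambda_coeff_def)
  qed
  have "Poly_Mapping.lookup (eval_mpoly Const (Dpoly p) F) j =
        (\<Sum>l\<in>Poly_Mapping.keys F. Poly_Mapping.lookup F l * of_int (Lambda_coeff p j l))"
    by (simp add: eval_mpoly_def lookup_sum c L)
  also have "\<dots> = (\<Sum>l\<in>multi_indices n m. Poly_Mapping.lookup F l * of_int (Lambda_coeff p j l))"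
    by (rule sum.mono_neutral_left) (use kF in \<open>auto simp: finite_multi_indices in_keys_iff\<close>)
  also have "\<dots> = Lambda p n j m a"
    by (simp add: Lambda_def lF mult.commute)
  finally show ?thesis by (simp add: F_def)
qed


section \<open>Valued difference fields\<close>

text \<open>
  In all of the following, the value of \<open>v\<close> at \<open>0\<close> and the values of \<open>\<pi>\<close> outside the
  valuation ring are irrelevant.
\<close>

locale valuation =
  fixes v :: "'a::field \<Rightarrow> 'g::linordered_ab_group_add"
  assumes v_mult: "x \<noteq> 0 \<Longrightarrow> y \<noteq> 0 \<Longrightarrow> v (x * y) = v x + v y"
    and v_add: "x \<noteq> 0 \<Longrightarrow> y \<noteq> 0 \<Longrightarrow> x + y \<noteq> 0 \<Longrightarrow> min (v x) (v y) \<le> v (x + y)"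
    and v_surj: "v ` (- {0}) = UNIV"

definition val_ring :: "('a::field \<Rightarrow> 'g::linordered_ab_group_add) \<Rightarrow> 'a set" where
  "val_ring v = {x. x = 0 \<or> 0 \<le> v x}"

definition val_ideal :: "('a::field \<Rightarrow> 'g::linordered_ab_group_add) \<Rightarrow> 'a set" where
  "val_ideal v = {x. x = 0 \<or> 0 < v x}"

locale valued_field = valuation v
  for v :: "'a::field \<Rightarrow> 'g::linordered_ab_group_add" +
  fixes \<pi> :: "'a \<Rightarrow> 'k::field"
  assumes pi_one: "\<pi> 1 = 1"
    and pi_add: "x \<in> val_ring v \<Longrightarrow> y \<in> val_ring v \<Longrightarrow> \<pi> (x + y) = \<pi> x + \<pi> y"
    and pi_mult: "x \<in> val_ring v \<Longrightarrow> y \<in> val_ring v \<Longrightarrow> \<pi> (x * y) = \<pi> x * \<pi> y"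
    and pi_surj: "\<pi> ` val_ring v = UNIV"
    and pi_kernel: "{x \<in> val_ring v. \<pi> x = 0} = val_ideal v"

locale valued_difference_field = valued_field v \<pi>
  for v :: "'a::field \<Rightarrow> 'g::linordered_ab_group_add" and \<pi> :: "'a \<Rightarrow> 'k::field" +
  fixes \<sigma> :: "'a \<Rightarrow> 'a"
  assumes sigma_bij: "bij \<sigma>"
    and sigma_add: "\<sigma> (x + y) = \<sigma> x + \<sigma> y"
    and sigma_mult: "\<sigma> (x * y) = \<sigma> x * \<sigma> y"
    and sigma_val_ring: "\<sigma> ` val_ring v = val_ring v"
    and axiom1: "x \<noteq> 0 \<Longrightarrow> v (\<sigma> x) = v x"
begin

text \<open>The automorphism of the residue field induced by \<open>\<sigma>\<close>.\<close>

definition sigma_bar :: "'k \<Rightarrow> 'k" where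
  "sigma_bar y = \<pi> (\<sigma> (inv_into (val_ring v) \<pi> y))"

end

locale valued_difference_field_axiom2 = valued_difference_field v \<pi> \<sigma>
  for v :: "'a::field \<Rightarrow> 'g::linordered_ab_group_add" and \<pi> :: "'a \<Rightarrow> 'k::field"
    and \<sigma> :: "'a \<Rightarrow> 'a" +
  assumes axiom2: "\<exists>x. x \<noteq> 0 \<and> \<sigma> x = x \<and> v x = \<gamma>"

locale witt_case = valued_difference_field v \<pi> \<sigma>
  for v :: "'a::field \<Rightarrow> 'g::linordered_ab_group_add" and \<pi> :: "'a \<Rightarrow> 'k::field"
    and \<sigma> :: "'a \<Rightarrow> 'a" +
  fixes p :: nat
  assumes char_0: "CHAR('a) = 0"
    and prime_p: "prime p"
    and residue_char: "CHAR('k) = p"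
    and residue_perfect: "surj (\<lambda>y::'k. y ^ p)"
    and v_p_pos: "0 < v (of_nat p)"
    and v_p_least: "0 < \<gamma> \<Longrightarrow> v (of_nat p) \<le> \<gamma>"
    and sigma_bar_frob: "sigma_bar y = y ^ p"

text \<open>
  The valued difference field \<open>(v', \<pi>', \<sigma>')\<close> extends \<open>(v, \<pi>, \<sigma>)\<close> via the embeddings
  \<open>\<iota>\<close>, \<open>\<epsilon>\<close> and \<open>\<eta>\<close> of the fields, of the value groups and of the residue fields.
\<close>

locale valued_difference_field_extension =
  base: valued_difference_field v \<pi> \<sigma> + ext: valued_difference_field v' \<pi>' \<sigma>'
  for v :: "'a::field \<Rightarrow> 'g::linordered_ab_group_add" and \<pi> :: "'a \<Rightarrow> 'k::field"
    and \<sigma> :: "'a \<Rightarrow> 'a"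
    and v' :: "'b::field \<Rightarrow> 'h::linordered_ab_group_add" and \<pi>' :: "'b \<Rightarrow> 'l::field"
    and \<sigma>' :: "'b \<Rightarrow> 'b" +
  fixes \<iota> :: "'a \<Rightarrow> 'b" and \<epsilon> :: "'g \<Rightarrow> 'h" and \<eta> :: "'k \<Rightarrow> 'l"
  assumes iota_one: "\<iota> 1 = 1"
    and iota_add: "\<iota> (x + y) = \<iota> x + \<iota> y"
    and iota_mult: "\<iota> (x * y) = \<iota> x * \<iota> y"
    and iota_sigma: "\<iota> (\<sigma> x) = \<sigma>' (\<iota> x)"
    and epsilon_add: "\<epsilon> (\<gamma> + \<delta>) = \<epsilon> \<gamma> + \<epsilon> \<delta>"
    and epsilon_mono: "strict_mono \<epsilon>"
    and epsilon_v: "x \<noteq> 0 \<Longrightarrow> v' (\<iota> x) = \<epsilon> (v x)"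
    and eta_one: "\<eta> 1 = 1"
    and eta_add: "\<eta> (\<alpha> + \<beta>) = \<eta> \<alpha> + \<eta> \<beta>"
    and eta_mult: "\<eta> (\<alpha> * \<beta>) = \<eta> \<alpha> * \<eta> \<beta>"
    and eta_pi: "x \<in> val_ring v \<Longrightarrow> \<pi>' (\<iota> x) = \<eta> (\<pi> x)"

context valuation
begin

lemma v_one: "v 1 = 0"
  using v_mult[of 1 1] by simp

lemma v_minus: assumes "x \<noteq> 0" shows "v (- x) = v x"
proof -
  have "v (-1) + v (-1) = 0"
    using v_mult[of "-1" "-1"] by (simp add: v_one)
  then have "v (-1) = 0"
    by simp
  then show ?thesis
    using v_mult[of "-1" x] assms by simp
qed

lemma val_ring_diff:
  assumes "x \<in> val_ring v" "y \<in> val_ring v"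
  shows "x - y \<in> val_ring v"
proof (cases "x = 0 \<or> y = 0 \<or> x - y = 0")
  case True
  then show ?thesis
    using assms v_minus[of y] by (cases "y = 0") (auto simp: val_ring_def)
next
  case False
  then have "min (v x) (v y) \<le> v (x - y)"
    using v_add[of x "- y"] v_minus[of y] by auto
  moreover have "0 \<le> min (v x) (v y)"
    using False assms by (auto simp: val_ring_def)
  ultimately have "0 \<le> v (x - y)"
    by (rule order_trans[rotated])
  then show ?thesis
    by (simp add: val_ring_def)
qed

end

text \<open>\<open>sigma_bar\<close> does not depend on the choice of representatives.\<close>

lemma (in valued_difference_field) sigma_bar_pi:
  assumes x: "x \<in> val_ring v"
  shows "sigma_bar (\<pi> x) = \<pi> (\<sigma> x)"
proof -
  define z where "z = inv_into (val_ring v) \<pi> (\<pi> x)"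
  have z: "z \<in> val_ring v" "\<pi> z = \<pi> x"
    using x unfolding z_def by (auto intro: inv_into_into f_inv_into_f)
  have d: "z - x \<in> val_ring v"
    using z x by (intro val_ring_diff)
  have "\<pi> (z - x) = 0"
    using pi_add[OF d x] z by simp
  then have id: "z - x \<in> val_ideal v"
    using pi_kernel d by auto
  have s0: "\<sigma> 0 = 0"
    using sigma_add[of 0 0] by (metis add_cancel_right_right add_0)
  have "\<sigma> (z - x) \<in> val_ideal v"
    using id s0 axiom1[of "z - x"] by (cases "z = x") (auto simp: val_ideal_def)
  then have "\<pi> (\<sigma> (z - x)) = 0" "\<sigma> (z - x) \<in> val_ring v"
    using pi_kernel by auto
  moreover have "\<sigma> z = \<sigma> (z - x) + \<sigma> x"
    using sigma_add[of "z - x" x] by simp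
  moreover have "\<sigma> x \<in> val_ring v"
    using x sigma_val_ring by auto
  ultimately show ?thesis
    using pi_add by (simp add: sigma_bar_def z_def)
qed


section \<open>Pseudoconvergence\<close>

text \<open>
  Well-indexed sequences are functions on a well-ordered type without largest element.
\<close>

definition pc_seq ::
  "('a::field \<Rightarrow> 'g::linordered_ab_group_add) \<Rightarrow> ('i::{wellorder,no_top} \<Rightarrow> 'a) \<Rightarrow> bool" where
  "pc_seq v a \<longleftrightarrow> (\<exists>\<rho>\<^sub>0. \<forall>\<rho> \<rho>' \<rho>''. \<rho>\<^sub>0 \<le> \<rho> \<longrightarrow> \<rho> < \<rho>' \<longrightarrow> \<rho>' < \<rho>'' \<longrightarrow>
     a \<rho>' \<noteq> a \<rho> \<and> a \<rho>'' \<noteq> a \<rho>' \<and> v (a \<rho>' - a \<rho>) < v (a \<rho>'' - a \<rho>'))"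

definition pc_lim ::
  "('a::field \<Rightarrow> 'g::linordered_ab_group_add) \<Rightarrow> ('i::{wellorder,no_top} \<Rightarrow> 'a) \<Rightarrow> 'a \<Rightarrow> bool" where
  "pc_lim v a x \<longleftrightarrow> (\<exists>\<rho>\<^sub>0. (\<forall>\<rho>\<ge>\<rho>\<^sub>0. a \<rho> \<noteq> x) \<and> strict_mono_on {\<rho>\<^sub>0..} (\<lambda>\<rho>. v (x - a \<rho>)))"

text \<open>
  Equivalence of pc-sequences refers to all valued field extensions, so that these have to be
  objects of the logic: their fields and value groups are structures on subsets of a type.
\<close>

record 'w ordered_group = "'w monoid" +
  gle :: "'w \<Rightarrow> 'w \<Rightarrow> bool" (infixl \<open>\<preceq>\<index>\<close> 50)

locale linordered_comm_group = comm_group \<Delta>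
  for \<Delta> :: "'w ordered_group" (structure) +
  assumes gle_refl: "x \<in> carrier \<Delta> \<Longrightarrow> x \<preceq> x"
    and gle_antisym: "x \<in> carrier \<Delta> \<Longrightarrow> y \<in> carrier \<Delta> \<Longrightarrow> x \<preceq> y \<Longrightarrow> y \<preceq> x \<Longrightarrow> x = y"
    and gle_trans: "x \<in> carrier \<Delta> \<Longrightarrow> y \<in> carrier \<Delta> \<Longrightarrow> z \<in> carrier \<Delta> \<Longrightarrow>
      x \<preceq> y \<Longrightarrow> y \<preceq> z \<Longrightarrow> x \<preceq> z"
    and gle_linear: "x \<in> carrier \<Delta> \<Longrightarrow> y \<in> carrier \<Delta> \<Longrightarrow> x \<preceq> y \<or> y \<preceq> x"
    and gle_mult: "x \<in> carrier \<Delta> \<Longrightarrow> y \<in> carrier \<Delta> \<Longrightarrow> z \<in> carrier \<Delta> \<Longrightarrow>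
      x \<preceq> y \<Longrightarrow> z \<otimes> x \<preceq> z \<otimes> y"

locale valued_field_extension =
  valuation v + L: field L + D: linordered_comm_group \<Delta>
  for v :: "'a::field \<Rightarrow> 'g::linordered_ab_group_add"
    and L :: "'u ring" (structure) and \<Delta> :: "'w ordered_group" (structure) +
  fixes w :: "'u \<Rightarrow> 'w" and \<iota> :: "'a \<Rightarrow> 'u" and \<epsilon> :: "'g \<Rightarrow> 'w"
  assumes w_surj: "w ` (carrier L - {\<zero>\<^bsub>L\<^esub>}) = carrier \<Delta>"
    and w_mult: "x \<in> carrier L - {\<zero>\<^bsub>L\<^esub>} \<Longrightarrow> y \<in> carrier L - {\<zero>\<^bsub>L\<^esub>} \<Longrightarrow>
      w (x \<otimes>\<^bsub>L\<^esub> y) = w x \<otimes>\<^bsub>\<Delta>\<^esub> w y"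
    and w_add: "x \<in> carrier L - {\<zero>\<^bsub>L\<^esub>} \<Longrightarrow> y \<in> carrier L - {\<zero>\<^bsub>L\<^esub>} \<Longrightarrow>
      x \<oplus>\<^bsub>L\<^esub> y \<noteq> \<zero>\<^bsub>L\<^esub> \<Longrightarrow> w x \<preceq>\<^bsub>\<Delta>\<^esub> w (x \<oplus>\<^bsub>L\<^esub> y) \<or> w y \<preceq>\<^bsub>\<Delta>\<^esub> w (x \<oplus>\<^bsub>L\<^esub> y)"
    and iota_hom: "\<iota> \<in> ring_hom ring_of_type_algebra L"
    and epsilon_closed: "\<epsilon> \<gamma> \<in> carrier \<Delta>"
    and epsilon_add: "\<epsilon> (\<gamma> + \<delta>) = \<epsilon> \<gamma> \<otimes>\<^bsub>\<Delta>\<^esub> \<epsilon> \<delta>"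
    and epsilon_le: "\<epsilon> \<gamma> \<preceq>\<^bsub>\<Delta>\<^esub> \<epsilon> \<delta> \<longleftrightarrow> \<gamma> \<le> \<delta>"
    and epsilon_w: "k \<noteq> 0 \<Longrightarrow> w (\<iota> k) = \<epsilon> (v k)"

definition pc_lim_in ::
  "'u ring \<Rightarrow> 'w ordered_group \<Rightarrow> ('u \<Rightarrow> 'w) \<Rightarrow> ('i::{wellorder,no_top} \<Rightarrow> 'u) \<Rightarrow> 'u \<Rightarrow> bool" where
  "pc_lim_in L \<Delta> w a x \<longleftrightarrow> (\<exists>\<rho>\<^sub>0. (\<forall>\<rho>\<ge>\<rho>\<^sub>0. a \<rho> \<noteq> x) \<and>
     (\<forall>\<rho>\<ge>\<rho>\<^sub>0. \<forall>\<rho>'>\<rho>. w (x \<ominus>\<^bsub>L\<^esub> a \<rho>) \<preceq>\<^bsub>\<Delta>\<^esub> w (x \<ominus>\<^bsub>L\<^esub> a \<rho>') \<and>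
        w (x \<ominus>\<^bsub>L\<^esub> a \<rho>) \<noteq> w (x \<ominus>\<^bsub>L\<^esub> a \<rho>')))"

text \<open>
  A pseudolimit \<open>x\<close> in an extension of \<open>K\<close> already lies in the extension \<open>K(x)\<close>, whose elements
  can be coded by pairs of lists over \<open>K\<close> (the coefficients of numerator and denominator); hence
  so can the values. It is therefore enough to let the extensions range over structures on the
  type of such pairs; the lemma \<open>pc_equivD\<close> below confirms that this covers the
  extensions on arbitrary types.
\<close>

definition pc_equiv ::
  "('a::field \<Rightarrow> 'g::linordered_ab_group_add) \<Rightarrow>
   ('i::{wellorder,no_top} \<Rightarrow> 'a) \<Rightarrow> ('i \<Rightarrow> 'a) \<Rightarrow> bool" where
  "pc_equiv v a b \<longleftrightarrow>
    (\<forall>(L :: ('a list \<times> 'a list) ring) (\<Delta> :: ('a list \<times> 'a list) ordered_group) w \<iota> \<epsilon>.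
       valued_field_extension v L \<Delta> w \<iota> \<epsilon> \<longrightarrow>
       (\<forall>x\<in>carrier L. pc_lim_in L \<Delta> w (\<iota> \<circ> a) x \<longleftrightarrow> pc_lim_in L \<Delta> w (\<iota> \<circ> b) x))"

text \<open>
  The remainder shows that \<open>pc_equiv\<close> transfers to valued field extensions on arbitrary types.
\<close>

lemma (in abelian_group) add_eq_iff_eq_minus:
  assumes "r \<in> carrier G" "s \<in> carrier G" "t \<in> carrier G"
  shows "t \<oplus> s = r \<longleftrightarrow> t = r \<ominus> s"
proof
  assume "t \<oplus> s = r"
  then have "r \<ominus> s = t \<oplus> (s \<oplus> \<ominus> s)"
    using assms by (auto simp: a_minus_def a_assoc)
  then show "t = r \<ominus> s"
    using assms by (simp add: r_neg)
next
  assume "t = r \<ominus> s"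
  then have "t \<oplus> s = r \<oplus> (\<ominus> s \<oplus> s)"
    using assms by (simp add: a_minus_def a_assoc)
  then show "t \<oplus> s = r"
    using assms by (simp add: l_neg)
qed

lemma (in field) generate_field_fractions:
  assumes P: "subring P R" and H: "H \<subseteq> P" and z: "z \<in> generate_field R H"
  shows "\<exists>r\<in>P. \<exists>s\<in>P. s \<noteq> \<zero> \<and> z = r \<otimes> inv s"
proof -
  have Pc: "P \<subseteq> carrier R" using subringE(1)[OF P] .
  have inv_c: "inv s \<in> carrier R" if "s \<in> P" "s \<noteq> \<zero>" for s
    using that Pc by (intro Units_inv_closed) (auto simp: field_Units)
  have cancel: "s \<otimes> inv s = \<one>" if "s \<in> P" "s \<noteq> \<zero>" for s
    using that Pc by (intro Units_r_inv) (auto simp: field_Units)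
  have nz: "inv s \<noteq> \<zero>" if "s \<in> P" "s \<noteq> \<zero>" for s
    using cancel[OF that] that Pc by (metis r_null subsetD zero_not_one)
  have frac: "\<exists>r'\<in>P. \<exists>s'\<in>P. s' \<noteq> \<zero> \<and> y = r' \<otimes> inv s'"
    if "r \<in> P" "s \<in> P" "s \<noteq> \<zero>" "y \<otimes> s = r" "y \<in> carrier R" for r s y
  proof -
    have "r \<otimes> inv s = y \<otimes> (s \<otimes> inv s)"
      using that inv_c Pc by (auto simp: m_assoc)
    then show ?thesis
      using that cancel[of s] by auto
  qed
  have frac_mult: "r \<otimes> inv s \<otimes> s = r" if "r \<in> P" "s \<in> P" "s \<noteq> \<zero>" for r s
  proof -
    have c: "r \<in> carrier R" "s \<in> carrier R" "inv s \<in> carrier R"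
      using that inv_c Pc by auto
    have "r \<otimes> inv s \<otimes> s = r \<otimes> (s \<otimes> inv s)"
      using m_assoc[OF c(1,3,2)] m_comm[OF c(3,2)] by simp
    then show ?thesis using that cancel Pc by auto
  qed
  show ?thesis using z
  proof (induction rule: generate_field.induct)
    case one
    show ?case using subringE(3)[OF P] by (intro frac[of "\<one>" "\<one>"]) auto
  next
    case (incl h)
    then show ?case using subringE(3)[OF P] H Pc by (intro frac[of h "\<one>"]) auto
  next
    case (a_inv h)
    then obtain r s where rs: "r \<in> P" "s \<in> P" "s \<noteq> \<zero>" "h = r \<otimes> inv s" by blast
    have "\<ominus> h \<otimes> s = \<ominus> r"
      using rs frac_mult[of r s] inv_c Pc by (metis (no_types, lifting) l_minus m_closed subsetD)
    then show ?case
      using rs inv_c Pc subringE(5)[OF P] by (intro frac[of "\<ominus> r" s]) auto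
  next
    case (m_inv h)
    then obtain r s where rs: "r \<in> P" "s \<in> P" "s \<noteq> \<zero>" "h = r \<otimes> inv s" by blast
    have hc: "h \<in> carrier R" using rs inv_c Pc by auto
    have r0: "r \<noteq> \<zero>" using rs m_inv inv_c by auto
    have hu: "h \<in> Units R" using hc m_inv by (simp add: field_Units)
    have "h \<otimes> s = r" using rs frac_mult by auto
    then have "inv h \<otimes> r = inv h \<otimes> h \<otimes> s"
      using hu hc rs Pc by (metis Units_inv_closed m_assoc subsetD)
    then have "inv h \<otimes> r = s"
      using hu rs Pc by auto
    then show ?case
      using rs r0 hu by (intro frac[of s r]) auto
  next
    case (eng_add h1 h2)
    then obtain r s r' s' where rs: "r \<in> P" "s \<in> P" "s \<noteq> \<zero>" "h1 = r \<otimes> inv s"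
      "r' \<in> P" "s' \<in> P" "s' \<noteq> \<zero>" "h2 = r' \<otimes> inv s'" by blast
    have c: "h1 \<in> carrier R" "h2 \<in> carrier R" "s \<in> carrier R" "s' \<in> carrier R"
      "r \<in> carrier R" "r' \<in> carrier R" using rs inv_c Pc by auto
    have e: "h1 \<otimes> s = r" "h2 \<otimes> s' = r'" using rs frac_mult by auto
    have "(h1 \<oplus> h2) \<otimes> (s \<otimes> s') = (h1 \<otimes> s) \<otimes> s' \<oplus> (h2 \<otimes> s') \<otimes> s"
      using c by (simp add: l_distr r_distr m_ac)
    then show ?case
      using rs c e subringE(6,7)[OF P] integral[of s s'] by (intro frac[of "r \<otimes> s' \<oplus> r' \<otimes> s" "s \<otimes> s'"]) auto
  next
    case (eng_mult h1 h2)
    then obtain r s r' s' where rs: "r \<in> P" "s \<in> P" "s \<noteq> \<zero>" "h1 = r \<otimes> inv s"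
      "r' \<in> P" "s' \<in> P" "s' \<noteq> \<zero>" "h2 = r' \<otimes> inv s'" by blast
    have c: "h1 \<in> carrier R" "h2 \<in> carrier R" "s \<in> carrier R" "s' \<in> carrier R"
      "r \<in> carrier R" "r' \<in> carrier R" using rs inv_c Pc by auto
    have e: "h1 \<otimes> s = r" "h2 \<otimes> s' = r'" using rs frac_mult by auto
    have "(h1 \<otimes> h2) \<otimes> (s \<otimes> s') = (h1 \<otimes> s) \<otimes> (h2 \<otimes> s')"
      using c by (simp add: m_ac)
    then show ?case
      using rs c e subringE(6,7)[OF P] integral[of s s'] by (intro frac[of "r \<otimes> r'" "s \<otimes> s'"]) auto
  qed
qed

context valued_field_extension
begin

definition gen_sub :: "'u \<Rightarrow> 'u set" where
  "gen_sub x = generate_field L (insert x (range \<iota>))"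

lemma iota_closed: "\<iota> z \<in> carrier L"
  using ring_hom_memE(1)[OF iota_hom, of z] by (simp add: ring_of_type_algebra_def)

lemma gen_sub_subfield:
  assumes "x \<in> carrier L"
  shows "subfield (gen_sub x) L"
  unfolding gen_sub_def
  using assms iota_closed by (intro L.generate_field_is_subfield) auto

lemma iota_nonzero:
  assumes "k \<noteq> 0" shows "\<iota> k \<noteq> \<zero>\<^bsub>L\<^esub>"
proof
  assume "\<iota> k = \<zero>\<^bsub>L\<^esub>"
  moreover have "\<iota> (k * inverse k) = \<iota> k \<otimes>\<^bsub>L\<^esub> \<iota> (inverse k)"
    using ring_hom_mult[OF iota_hom, of k "inverse k"] by (simp add: ring_of_type_algebra_def)
  moreover have "\<iota> 1 = \<one>\<^bsub>L\<^esub>"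
    using ring_hom_one[OF iota_hom] by (simp add: ring_of_type_algebra_def)
  ultimately show False
    using assms iota_closed by simp
qed

lemma range_iota_subring: "subring (range \<iota>) L"
proof -
  interpret A: ring "ring_of_type_algebra :: 'a ring" by auto
  have "subring (\<iota> ` carrier ring_of_type_algebra) L"
    using A.hom_imp_img_subring[OF iota_hom A.carrier_is_subring]  ring_hom_ring.img_is_subring[OF _ A.carrier_is_subring]
      A.ring_axioms L.ring_axioms iota_hom ring_hom_ringI2 by blast
  then show ?thesis by (simp add: ring_of_type_algebra_def)
qed

lemma gen_sub_code:
  assumes x: "x \<in> carrier L"
  shows "\<exists>c :: 'u \<Rightarrow> 'a list \<times> 'a list. inj_on c (gen_sub x)"
proof -
  define pl where "pl = (\<lambda>cs. foldr (\<lambda>k y. (y \<otimes>\<^bsub>L\<^esub> x) \<oplus>\<^bsub>L\<^esub> \<iota> k) cs \<zero>\<^bsub>L\<^esub>)"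
  define P where "P = ring.simple_extension L (range \<iota>) x"
  have P: "subring P L"
    unfolding P_def by (rule L.simple_extension_is_subring[OF range_iota_subring x])
  have PH: "insert x (range \<iota>) \<subseteq> P"
    unfolding P_def using L.simple_extension_mem[OF range_iota_subring x]
      L.simple_extension_incl[of "range \<iota>" x] x iota_closed by auto
  have pl: "\<exists>cs. z = pl cs" if "z \<in> P" for z
    using that unfolding P_def
  proof (induction rule: L.simple_extension.induct)
    case zero
    show ?case by (rule exI[of _ "[]"]) (simp add: pl_def)
  next
    case (lin k1 k2)
    then obtain cs k where "k1 = pl cs" "k2 = \<iota> k" by auto
    then show ?case by (intro exI[of _ "k # cs"]) (simp add: pl_def)
  qed
  define d where "d = (\<lambda>(cs, ds). pl cs \<otimes>\<^bsub>L\<^esub> inv\<^bsub>L\<^esub> (pl ds))"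
  have "gen_sub x \<subseteq> range d"
  proof
    fix z assume "z \<in> gen_sub x"
    then obtain r s where "r \<in> P" "s \<in> P" "z = r \<otimes>\<^bsub>L\<^esub> inv\<^bsub>L\<^esub> s"
      using L.generate_field_fractions[OF P PH] unfolding gen_sub_def by blast
    then obtain cs ds where "z = d (cs, ds)" using pl[of r] pl[of s] by (auto simp: d_def)
    then show "z \<in> range d" by auto
  qed
  then show ?thesis
    by (meson inj_on_inv_into inj_on_subset)
qed

end

lemma pc_equivD:
  fixes L :: "'u ring" and \<Delta> :: "'w ordered_group"
    and v :: "'a::field \<Rightarrow> 'g::linordered_ab_group_add"
    and a b :: "'i::{wellorder,no_top} \<Rightarrow> 'a"
  assumes equiv: "pc_equiv v a b"
    and ext: "valued_field_extension v L \<Delta> w \<iota> \<epsilon>"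
    and x: "x \<in> carrier L"
  shows "pc_lim_in L \<Delta> w (\<iota> \<circ> a) x \<longleftrightarrow> pc_lim_in L \<Delta> w (\<iota> \<circ> b) x"
proof -
  interpret valued_field_extension v L \<Delta> w \<iota> \<epsilon> by (rule ext)
  define S where "S = gen_sub x"
  have sf: "subfield S L" unfolding S_def by (rule gen_sub_subfield[OF x])
  have sr: "subring S L" using subfieldE(1)[OF sf] .
  have Sc: "S \<subseteq> carrier L" using subfieldE(3)[OF sf] .
  have S_inv: "inv\<^bsub>L\<^esub> s \<in> S - {\<zero>\<^bsub>L\<^esub>}" "s \<otimes>\<^bsub>L\<^esub> inv\<^bsub>L\<^esub> s = \<one>\<^bsub>L\<^esub>" if "s \<in> S - {\<zero>\<^bsub>L\<^esub>}" for s
    using L.subfield_m_inv[OF sf that] by auto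
  have iS: "\<iota> k \<in> S" for k
    unfolding S_def gen_sub_def by (auto intro: generate_field.incl)
  have xS: "x \<in> S"
    unfolding S_def gen_sub_def by (auto intro: generate_field.incl)
  obtain c :: "'u \<Rightarrow> 'a list \<times> 'a list" where c: "inj_on c S"
    using gen_sub_code[OF x] unfolding S_def by blast
  define W where "W = w ` (S - {\<zero>\<^bsub>L\<^esub>})"
  define d where "d = (\<lambda>\<delta>. c (inv_into (S - {\<zero>\<^bsub>L\<^esub>}) w \<delta>))"
  have d: "inj_on d W"
  proof (rule inj_onI)
    fix \<gamma> \<delta> assume *: "\<gamma> \<in> W" "\<delta> \<in> W" "d \<gamma> = d \<delta>"
    then have "inv_into (S - {\<zero>\<^bsub>L\<^esub>}) w \<gamma> = inv_into (S - {\<zero>\<^bsub>L\<^esub>}) w \<delta>"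
      using inj_onD[OF c] inv_into_into[of \<gamma> w "S - {\<zero>\<^bsub>L\<^esub>}"] inv_into_into[of \<delta> w "S - {\<zero>\<^bsub>L\<^esub>}"]
      unfolding d_def W_def by blast
    then show "\<gamma> = \<delta>"
      using * unfolding W_def by (metis f_inv_into_f)
  qed
  have Wc: "W \<subseteq> carrier \<Delta>"
    unfolding W_def using w_surj Sc by auto
  have W_mult: "\<gamma> \<otimes>\<^bsub>\<Delta>\<^esub> \<delta> \<in> W" if "\<gamma> \<in> W" "\<delta> \<in> W" for \<gamma> \<delta>
  proof -
    from that obtain s t where st: "s \<in> S - {\<zero>\<^bsub>L\<^esub>}" "t \<in> S - {\<zero>\<^bsub>L\<^esub>}" "\<gamma> = w s" "\<delta> = w t"
      unfolding W_def by blast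
    then have "s \<otimes>\<^bsub>L\<^esub> t \<in> S - {\<zero>\<^bsub>L\<^esub>}"
      using subringE(6)[OF sr] L.integral Sc by blast
    moreover have "w (s \<otimes>\<^bsub>L\<^esub> t) = \<gamma> \<otimes>\<^bsub>\<Delta>\<^esub> \<delta>"
      using st Sc by (subst w_mult) auto
    ultimately show ?thesis unfolding W_def by (metis imageI)
  qed
  have one_S: "\<one>\<^bsub>L\<^esub> \<in> S - {\<zero>\<^bsub>L\<^esub>}"
    using subringE(3)[OF sr] L.one_not_zero by simp
  have w_one: "w \<one>\<^bsub>L\<^esub> = \<one>\<^bsub>\<Delta>\<^esub>"
  proof -
    have "w \<one>\<^bsub>L\<^esub> \<in> carrier \<Delta>" using one_S Wc W_def by auto
    moreover have "w \<one>\<^bsub>L\<^esub> \<otimes>\<^bsub>\<Delta>\<^esub> w \<one>\<^bsub>L\<^esub> = w \<one>\<^bsub>L\<^esub>"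
      using w_mult[of "\<one>\<^bsub>L\<^esub>" "\<one>\<^bsub>L\<^esub>"] by simp
    ultimately show ?thesis using D.l_cancel_one' by metis
  qed
  have W_one: "\<one>\<^bsub>\<Delta>\<^esub> \<in> W"
    unfolding W_def using one_S w_one by (metis imageI)
  have W_inv: "\<exists>\<delta>\<in>W. \<delta> \<otimes>\<^bsub>\<Delta>\<^esub> \<gamma> = \<one>\<^bsub>\<Delta>\<^esub>" if "\<gamma> \<in> W" for \<gamma>
  proof -
    from that obtain s where s: "s \<in> S - {\<zero>\<^bsub>L\<^esub>}" "\<gamma> = w s"
      unfolding W_def by blast
    have c: "s \<in> carrier L" "inv\<^bsub>L\<^esub> s \<in> carrier L"
      using s(1) S_inv(1)[OF s(1)] Sc by auto
    have "w (inv\<^bsub>L\<^esub> s) \<otimes>\<^bsub>\<Delta>\<^esub> \<gamma> = w (inv\<^bsub>L\<^esub> s \<otimes>\<^bsub>L\<^esub> s)"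
      using w_mult[of "inv\<^bsub>L\<^esub> s" s] s S_inv(1)[OF s(1)] c by simp
    also have "\<dots> = \<one>\<^bsub>\<Delta>\<^esub>"
      using L.m_comm[OF c] S_inv(2)[OF s(1)] w_one by simp
    finally have "w (inv\<^bsub>L\<^esub> s) \<otimes>\<^bsub>\<Delta>\<^esub> \<gamma> = \<one>\<^bsub>\<Delta>\<^esub>" .
    moreover have "w (inv\<^bsub>L\<^esub> s) \<in> W"
      unfolding W_def using S_inv(1)[OF s(1)] by (rule imageI)
    ultimately show ?thesis by blast
  qed
  define L' where "L' = image_ring c (L\<lparr>carrier := S\<rparr>)"
  interpret LS: field "L\<lparr>carrier := S\<rparr>"
    by (rule L.subfield_iff(2)[OF sf])
  have fL': "field L'"
    unfolding L'_def by (rule LS.inj_imp_image_ring_is_field) (simp add: c)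
  interpret L': field L' by (rule fL')
  have c_iso: "c \<in> ring_iso (L\<lparr>carrier := S\<rparr>) L'"
    unfolding L'_def by (rule inj_imp_image_ring_iso) (simp add: c)
  have c_hom: "c \<in> ring_hom (L\<lparr>carrier := S\<rparr>) L'"
    using c_iso by (simp add: ring_iso_def)
  have cL': "carrier L' = c ` S"
    by (simp add: L'_def image_ring_carrier)
  have c_add: "c (s \<oplus>\<^bsub>L\<^esub> t) = c s \<oplus>\<^bsub>L'\<^esub> c t" if "s \<in> S" "t \<in> S" for s t
    using ring_hom_add[OF c_hom] that by simp
  have c_mult: "c (s \<otimes>\<^bsub>L\<^esub> t) = c s \<otimes>\<^bsub>L'\<^esub> c t" if "s \<in> S" "t \<in> S" for s t
    using ring_hom_mult[OF c_hom] that by simp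
  have c_one: "c \<one>\<^bsub>L\<^esub> = \<one>\<^bsub>L'\<^esub>"
    using ring_hom_one[OF c_hom] by simp
  have c_zero: "c \<zero>\<^bsub>L\<^esub> = \<zero>\<^bsub>L'\<^esub>"
    using image_ring_zero[of c "L\<lparr>carrier := S\<rparr>"] by (simp add: L'_def)
  have zero_S: "\<zero>\<^bsub>L\<^esub> \<in> S" using subringE(2)[OF sr] .
  have c_eq: "c s = c t \<longleftrightarrow> s = t" if "s \<in> S" "t \<in> S" for s t
    using inj_onD[OF c _ that] by auto
  have S_minus: "s \<ominus>\<^bsub>L\<^esub> t \<in> S" if "s \<in> S" "t \<in> S" for s t
    using that subringE(5,7)[OF sr] by (simp add: a_minus_def)
  have c_minus: "c (s \<ominus>\<^bsub>L\<^esub> t) = c s \<ominus>\<^bsub>L'\<^esub> c t" if st: "s \<in> S" "t \<in> S" for s t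
  proof -
    have "(s \<ominus>\<^bsub>L\<^esub> t) \<oplus>\<^bsub>L\<^esub> t = s"
      using st Sc S_minus[OF st] by (subst L.add_eq_iff_eq_minus) auto
    then have "c (s \<ominus>\<^bsub>L\<^esub> t) \<oplus>\<^bsub>L'\<^esub> c t = c s"
      using c_add[OF S_minus[OF st] st(2)] by simp
    moreover have "c s \<in> carrier L'" "c t \<in> carrier L'" "c (s \<ominus>\<^bsub>L\<^esub> t) \<in> carrier L'"
      using st S_minus by (auto simp: cL')
    ultimately show ?thesis
      using L'.add_eq_iff_eq_minus by blast
  qed
  define g where "g = inv_into W d"
  have g: "g (d \<gamma>) = \<gamma>" if "\<gamma> \<in> W" for \<gamma>
    using that d by (simp add: g_def)
  define \<Delta>' where "\<Delta>' = \<lparr>carrier = d ` W, monoid.mult = (\<lambda>p q. d (g p \<otimes>\<^bsub>\<Delta>\<^esub> g q)),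
    one = d \<one>\<^bsub>\<Delta>\<^esub>, gle = (\<lambda>p q. g p \<preceq>\<^bsub>\<Delta>\<^esub> g q)\<rparr>"
  have D': "carrier \<Delta>' = d ` W" "\<one>\<^bsub>\<Delta>'\<^esub> = d \<one>\<^bsub>\<Delta>\<^esub>"
    by (auto simp: \<Delta>'_def)
  have d_mult: "d \<gamma> \<otimes>\<^bsub>\<Delta>'\<^esub> d \<delta> = d (\<gamma> \<otimes>\<^bsub>\<Delta>\<^esub> \<delta>)" if "\<gamma> \<in> W" "\<delta> \<in> W" for \<gamma> \<delta>
    using that by (simp add: \<Delta>'_def g)
  have d_le: "d \<gamma> \<preceq>\<^bsub>\<Delta>'\<^esub> d \<delta> \<longleftrightarrow> \<gamma> \<preceq>\<^bsub>\<Delta>\<^esub> \<delta>" if "\<gamma> \<in> W" "\<delta> \<in> W" for \<gamma> \<delta>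
    using that by (simp add: \<Delta>'_def g)
  have d_eq: "d \<gamma> = d \<delta> \<longleftrightarrow> \<gamma> = \<delta>" if "\<gamma> \<in> W" "\<delta> \<in> W" for \<gamma> \<delta>
    using inj_onD[OF d _ that] by auto
  note WD = Wc[THEN subsetD]
  have gD': "comm_group \<Delta>'"
  proof (rule comm_groupI)
    fix p assume "p \<in> carrier \<Delta>'"
    then obtain \<gamma> where \<gamma>: "\<gamma> \<in> W" "p = d \<gamma>" by (auto simp: D')
    show "\<exists>q\<in>carrier \<Delta>'. q \<otimes>\<^bsub>\<Delta>'\<^esub> p = \<one>\<^bsub>\<Delta>'\<^esub>"
      using W_inv[OF \<gamma>(1)] \<gamma> by (metis D' d_mult imageI)
  qed (auto simp: D' d_mult W_mult W_one D.m_ac WD)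
  have "linordered_comm_group \<Delta>'"
    using gD'
  proof (rule linordered_comm_group.intro, intro linordered_comm_group_axioms.intro)
    fix q1 q2 assume "q1 \<in> carrier \<Delta>'" "q2 \<in> carrier \<Delta>'"
    then obtain \<gamma>1 \<gamma>2 where \<gamma>: "\<gamma>1 \<in> W" "\<gamma>2 \<in> W" "q1 = d \<gamma>1" "q2 = d \<gamma>2"
      unfolding D' by blast
    show "q1 \<preceq>\<^bsub>\<Delta>'\<^esub> q1"
      using \<gamma> by (simp add: d_le D.gle_refl WD)
    show "q1 \<preceq>\<^bsub>\<Delta>'\<^esub> q2 \<or> q2 \<preceq>\<^bsub>\<Delta>'\<^esub> q1"
      using \<gamma> D.gle_linear[OF WD WD] by (simp add: d_le)
    show "q1 = q2" if "q1 \<preceq>\<^bsub>\<Delta>'\<^esub> q2" "q2 \<preceq>\<^bsub>\<Delta>'\<^esub> q1"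
      using \<gamma> that D.gle_antisym[OF WD WD, of \<gamma>1 \<gamma>2] by (simp add: d_le)
    fix q3 assume "q3 \<in> carrier \<Delta>'"
    then obtain \<gamma>3 where \<gamma>3: "\<gamma>3 \<in> W" "q3 = d \<gamma>3"
      unfolding D' by blast
    show "q1 \<preceq>\<^bsub>\<Delta>'\<^esub> q3" if "q1 \<preceq>\<^bsub>\<Delta>'\<^esub> q2" "q2 \<preceq>\<^bsub>\<Delta>'\<^esub> q3"
      using \<gamma> \<gamma>3 that D.gle_trans[OF WD WD WD, of \<gamma>1 \<gamma>2 \<gamma>3] by (simp add: d_le)
    show "q3 \<otimes>\<^bsub>\<Delta>'\<^esub> q1 \<preceq>\<^bsub>\<Delta>'\<^esub> q3 \<otimes>\<^bsub>\<Delta>'\<^esub> q2" if "q1 \<preceq>\<^bsub>\<Delta>'\<^esub> q2"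
      using \<gamma> \<gamma>3 that by (simp add: d_le d_mult W_mult D.gle_mult WD)
  qed
  define w' where "w' = (\<lambda>q. d (w (inv_into S c q)))"
  have w': "w' (c s) = d (w s)" if "s \<in> S" for s
    using that c by (simp add: w'_def)
  have wW: "w s \<in> W" if "s \<in> S" "s \<noteq> \<zero>\<^bsub>L\<^esub>" for s
    using that by (auto simp: W_def)
  have L'0: "carrier L' - {\<zero>\<^bsub>L'\<^esub>} = c ` (S - {\<zero>\<^bsub>L\<^esub>})"
    unfolding cL' c_zero[symmetric] using c_eq zero_S by blast
  have eW: "\<epsilon> \<gamma> \<in> W" for \<gamma>
  proof -
    obtain k where k: "k \<noteq> 0" "v k = \<gamma>" using v_surj by (metis ComplD UNIV_I imageE insertI1)
    have "\<iota> k \<noteq> \<zero>\<^bsub>L\<^esub>" using iota_nonzero[OF k(1)] .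
    then show ?thesis using wW[OF iS, of k] epsilon_w[OF k(1)] k(2) by simp
  qed
  have ext': "valued_field_extension v L' \<Delta>' w' (c \<circ> \<iota>) (d \<circ> \<epsilon>)"
  proof (intro valued_field_extension.intro valued_field_extension_axioms.intro)
    show "valuation v" by (rule valuation_axioms)
    show "field L'" by (rule fL')
    show "linordered_comm_group \<Delta>'" by fact
    show "w' ` (carrier L' - {\<zero>\<^bsub>L'\<^esub>}) = carrier \<Delta>'"
      unfolding L'0 D' W_def by (auto simp: w' image_image intro!: image_eqI)
  next
    fix q r assume "q \<in> carrier L' - {\<zero>\<^bsub>L'\<^esub>}" "r \<in> carrier L' - {\<zero>\<^bsub>L'\<^esub>}"
    then obtain s t where st: "s \<in> S - {\<zero>\<^bsub>L\<^esub>}" "t \<in> S - {\<zero>\<^bsub>L\<^esub>}" "q = c s" "r = c t"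
      unfolding L'0 by blast
    have w_st: "w (s \<otimes>\<^bsub>L\<^esub> t) = w s \<otimes>\<^bsub>\<Delta>\<^esub> w t"
      using st Sc by (intro w_mult) auto
    show "w' (q \<otimes>\<^bsub>L'\<^esub> r) = w' q \<otimes>\<^bsub>\<Delta>'\<^esub> w' r"
      using st subringE(6)[OF sr, of s t] by (simp add: c_mult[symmetric] w' w_st d_mult wW)
    assume nz: "q \<oplus>\<^bsub>L'\<^esub> r \<noteq> \<zero>\<^bsub>L'\<^esub>"
    have sum: "s \<oplus>\<^bsub>L\<^esub> t \<in> S" using st subringE(7)[OF sr, of s t] by simp
    have nz': "s \<oplus>\<^bsub>L\<^esub> t \<noteq> \<zero>\<^bsub>L\<^esub>"
      using nz st by (auto simp: c_add[symmetric] c_zero[symmetric])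
    have "w s \<preceq>\<^bsub>\<Delta>\<^esub> w (s \<oplus>\<^bsub>L\<^esub> t) \<or> w t \<preceq>\<^bsub>\<Delta>\<^esub> w (s \<oplus>\<^bsub>L\<^esub> t)"
      using st Sc nz' by (intro w_add) auto
    then show "w' q \<preceq>\<^bsub>\<Delta>'\<^esub> w' (q \<oplus>\<^bsub>L'\<^esub> r) \<or> w' r \<preceq>\<^bsub>\<Delta>'\<^esub> w' (q \<oplus>\<^bsub>L'\<^esub> r)"
      using st sum nz' by (simp add: c_add[symmetric] w' d_le wW)
  next
    show "c \<circ> \<iota> \<in> ring_hom ring_of_type_algebra L'"
      using ring_hom_memE[OF iota_hom]
      by (intro ring_hom_memI)
         (auto simp: ring_of_type_algebra_def cL' iS c_add c_mult c_one)
  next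
    fix \<gamma> \<delta>
    show "(d \<circ> \<epsilon>) \<gamma> \<in> carrier \<Delta>'" by (simp add: D' eW)
    show "(d \<circ> \<epsilon>) (\<gamma> + \<delta>) = (d \<circ> \<epsilon>) \<gamma> \<otimes>\<^bsub>\<Delta>'\<^esub> (d \<circ> \<epsilon>) \<delta>"
      by (simp add: d_mult eW epsilon_add)
    show "(d \<circ> \<epsilon>) \<gamma> \<preceq>\<^bsub>\<Delta>'\<^esub> (d \<circ> \<epsilon>) \<delta> \<longleftrightarrow> \<gamma> \<le> \<delta>"
      by (simp add: d_le eW epsilon_le)
  next
    fix k :: 'a assume "k \<noteq> 0"
    then show "w' ((c \<circ> \<iota>) k) = (d \<circ> \<epsilon>) (v k)"
      by (simp add: w' iS epsilon_w)
  qed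
  have lim: "pc_lim_in L' \<Delta>' w' ((c \<circ> \<iota>) \<circ> e) (c x) \<longleftrightarrow> pc_lim_in L \<Delta> w (\<iota> \<circ> e) x"
    for e :: "'i \<Rightarrow> 'a"
  proof -
    have nz: "x \<ominus>\<^bsub>L\<^esub> \<iota> k \<noteq> \<zero>\<^bsub>L\<^esub>" if "\<iota> k \<noteq> x" for k
      using that x iota_closed by (metis L.r_right_minus_eq)
    have A: "w' (c x \<ominus>\<^bsub>L'\<^esub> c (\<iota> k)) = d (w (x \<ominus>\<^bsub>L\<^esub> \<iota> k))" for k
      by (simp add: c_minus[symmetric] xS iS S_minus w')
    have B: "w (x \<ominus>\<^bsub>L\<^esub> \<iota> k) \<in> W" if "\<iota> k \<noteq> x" for k
      using nz[OF that] by (intro wW S_minus xS iS)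
    have "(\<forall>\<rho>\<ge>\<rho>\<^sub>0. c (\<iota> (e \<rho>)) \<noteq> c x) \<longleftrightarrow> (\<forall>\<rho>\<ge>\<rho>\<^sub>0. \<iota> (e \<rho>) \<noteq> x)" for \<rho>\<^sub>0
      using c_eq iS xS by auto
    then show ?thesis
      unfolding pc_lim_in_def comp_apply A
      by (intro ex_cong1 conj_cong) (auto simp: d_le d_eq B)
  qed
  have "c x \<in> carrier L'" using xS by (simp add: cL')
  then show ?thesis
    using equiv ext' unfolding pc_equiv_def lim[symmetric] by blast
qed

end

theory Submission
  imports Defs
begin

text \<open>
  Choose \<open>\<theta>\<^sub>\<rho>\<close> fixed by \<open>\<sigma>\<close> with the value \<open>\<gamma>\<^sub>\<rho>\<close> of \<open>x - a\<^sub>\<rho>\<close>, and put \<open>b\<^sub>\<rho> = a\<^sub>\<rho> + \<theta>\<^sub>\<rho> \<mu>\<^sub>\<rho> = x + \<theta>\<^sub>\<rho> z\<^sub>\<rho>\<close> with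
  \<open>\<mu>\<^sub>\<rho>\<close> in the valuation ring. Since \<open>\<sigma>\<close> lifts the Frobenius, the system \<open>\<sigma>\<^sup>k(z) = D\<^sub>k(y)\<close> has an
  integral solution \<open>y\<close> for every integral \<open>z\<close> (Dwork's lemma), whence
  \<open>H(b\<^sub>\<rho>) - H(x) = \<Sum>\<^sub>m \<theta>\<^sub>\<rho>\<^sup>m Q\<^sub>m(y)\<close> with ordinary polynomials \<open>Q\<^sub>m\<close>, not all zero because \<open>D\<close> is
  invertible in characteristic \<open>0\<close>. The residues of \<open>y\<close> can be chosen one after the other in infinite
  sets, so \<open>\<mu>\<^sub>\<rho>\<close> can be chosen such that \<open>Q\<^sub>m(y)\<close> has the least value \<open>N\<^sub>m\<close> of the coefficients of
  \<open>Q\<^sub>m\<close>. Eventually \<open>N\<^sub>m + m \<gamma>\<^sub>\<rho>\<close> attains its minimum at a single \<open>m\<close>, so this minimum is the value of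
  \<open>H(b\<^sub>\<rho>) - H(x)\<close> and is strictly increasing. The value of \<open>G(a\<^sub>\<rho>) - G(x)\<close> is at least as large as that
  of \<open>G(b\<^sub>\<rho>) - G(x)\<close>, which forces \<open>G(b\<^sub>\<rho>)\<close> to pseudoconverge to \<open>0\<close> along with \<open>G(a\<^sub>\<rho>)\<close>.
\<close>

section \<open>Evaluation of polynomials\<close>

abbreviation monomial :: "(nat \<Rightarrow> 'b::comm_semiring_1) \<Rightarrow> (nat \<Rightarrow>\<^sub>0 nat) \<Rightarrow> 'b" where
  "monomial x l \<equiv> (\<Prod>i\<in>Poly_Mapping.keys l. x i ^ Poly_Mapping.lookup l i)"

lemma monomial_superset:
  assumes "finite A" "Poly_Mapping.keys l \<subseteq> A"
  shows "monomial x l = (\<Prod>i\<in>A. x i ^ Poly_Mapping.lookup l i)"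
  by (rule prod.mono_neutral_left) (use assms in \<open>auto simp: in_keys_iff\<close>)

lemma monomial_add: "monomial x (l + k) = monomial x l * monomial x k"
proof -
  let ?A = "Poly_Mapping.keys l \<union> Poly_Mapping.keys k"
  have "monomial x (l + k) = (\<Prod>i\<in>?A. x i ^ Poly_Mapping.lookup (l + k) i)"
    by (rule monomial_superset) (auto simp: in_keys_iff lookup_add)
  moreover have "monomial x l = (\<Prod>i\<in>?A. x i ^ Poly_Mapping.lookup l i)"
    by (rule monomial_superset) auto
  moreover have "monomial x k = (\<Prod>i\<in>?A. x i ^ Poly_Mapping.lookup k i)"
    by (rule monomial_superset) auto
  ultimately show ?thesis
    by (simp add: lookup_add power_add prod.distrib)
qed

lemma eval_mpoly_superset:
  assumes "finite A" "Poly_Mapping.keys g \<subseteq> A" "h 0 = 0"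
  shows "eval_mpoly h x g = (\<Sum>l\<in>A. h (Poly_Mapping.lookup g l) * monomial x l)"
  unfolding eval_mpoly_def
  by (rule sum.mono_neutral_left) (use assms in \<open>auto simp: in_keys_iff\<close>)

lemma eval_mpoly_single:
  assumes "h 0 = 0"
  shows "eval_mpoly h x (Poly_Mapping.single l c) = h c * monomial x l"
  using assms by (simp add: eval_mpoly_def)

lemma eval_mpoly_Const: "h 0 = 0 \<Longrightarrow> eval_mpoly h x (Const c) = h c"
  by (simp add: Const_def eval_mpoly_single)

lemma eval_mpoly_Var: "h 0 = 0 \<Longrightarrow> h 1 = 1 \<Longrightarrow> eval_mpoly h x (Var i) = x i"
  by (simp add: Var_def eval_mpoly_single)

lemma eval_mpoly_zero: "eval_mpoly h x 0 = 0"
  by (simp add: eval_mpoly_def)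

lemma eval_mpoly_at_zero:
  fixes h :: "'a::zero \<Rightarrow> 'b::comm_semiring_1"
  assumes "h 0 = 0"
  shows "eval_mpoly h (\<lambda>_. 0) g = h (Poly_Mapping.lookup g 0)"
proof -
  have m: "monomial (\<lambda>_. 0 :: 'b) l = (if l = 0 then 1 else 0)" for l :: "nat \<Rightarrow>\<^sub>0 nat"
  proof (cases "l = 0")
    case False
    then obtain i where "i \<in> Poly_Mapping.keys l" using keys_eq_empty[of l] by blast
    then have "monomial (\<lambda>_. 0 :: 'b) l = 0"
      by (intro prod_zero bexI[of _ i]) (auto simp: in_keys_iff zero_power)
    with False show ?thesis by simp
  qed simp
  show ?thesis
    using assms by (simp add: eval_mpoly_def m if_distrib sum.delta in_keys_iff cong: if_cong)
qed

lemma eval_mpoly_add: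
  assumes "h 0 = 0" "\<And>a b. h (a + b) = h a + h b"
  shows "eval_mpoly h x (f + g) = eval_mpoly h x f + eval_mpoly h x g"
proof -
  let ?A = "Poly_Mapping.keys f \<union> Poly_Mapping.keys g"
  have "eval_mpoly h x (f + g) = (\<Sum>l\<in>?A. h (Poly_Mapping.lookup (f + g) l) * monomial x l)"
    by (rule eval_mpoly_superset) (use assms keys_add[of f g] in auto)
  moreover have "eval_mpoly h x f = (\<Sum>l\<in>?A. h (Poly_Mapping.lookup f l) * monomial x l)"
    by (rule eval_mpoly_superset) (use assms in auto)
  moreover have "eval_mpoly h x g = (\<Sum>l\<in>?A. h (Poly_Mapping.lookup g l) * monomial x l)"
    by (rule eval_mpoly_superset) (use assms in auto)
  ultimately show ?thesis
    by (simp add: lookup_add assms distrib_right sum.distrib)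
qed

lemma eval_mpoly_sum:
  assumes "h 0 = 0" "\<And>a b. h (a + b) = h a + h b"
  shows "eval_mpoly h x (sum f A) = (\<Sum>a\<in>A. eval_mpoly h x (f a))"
  by (induction A rule: infinite_finite_induct)
     (auto simp: eval_mpoly_zero eval_mpoly_add[OF assms])

lemma eval_mpoly_mult:
  assumes h: "h 0 = 0" "\<And>a b. h (a + b) = h a + h b" "\<And>a b. h (a * b) = h a * h b"
  shows "eval_mpoly h x (f * g) = eval_mpoly h x f * eval_mpoly h x g"
proof -
  have "eval_mpoly h x (f * g) = eval_mpoly h x
     ((\<Sum>k\<in>Poly_Mapping.keys f. Poly_Mapping.single k (Poly_Mapping.lookup f k)) *
      (\<Sum>l\<in>Poly_Mapping.keys g. Poly_Mapping.single l (Poly_Mapping.lookup g l)))"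
    by (simp only: mpoly_expand[symmetric])
  also have "\<dots> = (\<Sum>k\<in>Poly_Mapping.keys f. \<Sum>l\<in>Poly_Mapping.keys g.
     (h (Poly_Mapping.lookup f k) * monomial x k) * (h (Poly_Mapping.lookup g l) * monomial x l))"
    by (simp add: sum_product mult_single eval_mpoly_sum[OF h(1,2)] eval_mpoly_single[of h, OF h(1)]
        h(3) monomial_add mult_ac)
  also have "\<dots> = eval_mpoly h x f * eval_mpoly h x g"
    by (simp only: eval_mpoly_def sum_product)
  finally show ?thesis .
qed

lemma eval_mpoly_diff:
  fixes h :: "'a::ab_group_add \<Rightarrow> 'b::comm_ring_1"
  assumes "h 0 = 0" "\<And>a b. h (a + b) = h a + h b"
  shows "eval_mpoly h x (f - g) = eval_mpoly h x f - eval_mpoly h x g"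
  using eval_mpoly_add[OF assms, of x "f - g" g] by simp

lemma hom_eval_mpoly:
  assumes "\<phi> 0 = 0" "\<phi> 1 = 1" "\<And>a b. \<phi> (a + b) = \<phi> a + \<phi> b" "\<And>a b. \<phi> (a * b) = \<phi> a * \<phi> b"
  shows "\<phi> (eval_mpoly h x g) = eval_mpoly (\<lambda>c. \<phi> (h c)) (\<lambda>i. \<phi> (x i)) g"
proof -
  have s: "\<phi> (sum f A) = (\<Sum>a\<in>A. \<phi> (f a))" for f and A :: "(nat \<Rightarrow>\<^sub>0 nat) set"
    by (induction A rule: infinite_finite_induct) (auto simp: assms)
  have w: "\<phi> (a ^ k) = \<phi> a ^ k" for a and k :: nat
    by (induction k) (auto simp: assms)
  have m: "\<phi> (prod f A) = (\<Prod>a\<in>A. \<phi> (f a))" for f and A :: "nat set"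
    by (induction A rule: infinite_finite_induct) (auto simp: assms)
  show ?thesis
    by (simp add: eval_mpoly_def s m w assms)
qed

abbreviation eval_id :: "(nat \<Rightarrow> 'b::comm_semiring_1) \<Rightarrow> 'b mpoly \<Rightarrow> 'b" where
  "eval_id \<equiv> eval_mpoly (\<lambda>c. c)"

lemma eval_id_simps:
  "eval_id y 0 = 0" "eval_id y 1 = 1" "eval_id y (f + g) = eval_id y f + eval_id y g"
  "eval_id y (f * g) = eval_id y f * eval_id y g" "eval_id y (f ^ k) = eval_id y f ^ k"
  "eval_id y (of_nat k) = of_nat k" "eval_id y (sum F A) = (\<Sum>a\<in>A. eval_id y (F a))"
  "eval_id y (Const c) = c" "eval_id y (Var i) = y i"
proof -
  show one: "eval_id y 1 = 1"
    using eval_mpoly_single[of "\<lambda>c. c" y 0 1] by simp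
  show mult: "eval_id y (f * g) = eval_id y f * eval_id y g" for f g
    by (rule eval_mpoly_mult) auto
  show add: "eval_id y (f + g) = eval_id y f + eval_id y g" for f g
    by (rule eval_mpoly_add) auto
  show "eval_id y (f ^ k) = eval_id y f ^ k"
    by (induction k) (auto simp: one mult)
  show "eval_id y (of_nat k) = of_nat k"
    by (induction k) (auto simp: one add eval_mpoly_zero)
  show "eval_id y (sum F A) = (\<Sum>a\<in>A. eval_id y (F a))"
    by (rule eval_mpoly_sum) auto
qed (auto simp: eval_mpoly_zero eval_mpoly_Const eval_mpoly_Var)

text \<open>Meant for \<open>\<phi> = eval_id y\<close> in \<open>ghost_expansion\<close>: a
  polynomial in one parameter whose coefficients are polynomials in \<open>y\<close> is evaluated
  first at \<open>y\<close> and then at \<open>t\<close>, and this must respect sums and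
  products.\<close>

lemma poly_map_poly_hom:
  fixes \<phi> :: "'a::comm_semiring_1 \<Rightarrow> 'b::comm_semiring_1"
  assumes \<phi>: "\<phi> 0 = 0" "\<And>a b. \<phi> (a + b) = \<phi> a + \<phi> b" "\<And>a b. \<phi> (a * b) = \<phi> a * \<phi> b"
  shows "poly (map_poly \<phi> (f + g)) t = poly (map_poly \<phi> f) t + poly (map_poly \<phi> g) t" (is ?add)
    and "poly (map_poly \<phi> (f * g)) t = poly (map_poly \<phi> f) t * poly (map_poly \<phi> g) t" (is ?mult)
proof -
  have add: "poly (map_poly \<phi> (f + g)) t = poly (map_poly \<phi> f) t + poly (map_poly \<phi> g) t" for f g
  proof (induction f g rule: poly_induct2)
    case (pCons a p b q)
    then show ?case
      by (simp add: map_poly_pCons[of \<phi>, OF \<phi>(1)] \<phi>(2) algebra_simps)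
  qed simp
  then show ?add .
  have smult: "poly (map_poly \<phi> (Polynomial.smult a g)) t = \<phi> a * poly (map_poly \<phi> g) t" for a g
    by (induction g) (auto simp: map_poly_pCons[of \<phi>, OF \<phi>(1)] \<phi>(3) algebra_simps)
  show ?mult
    by (induction f) (auto simp: map_poly_pCons[of \<phi>, OF \<phi>(1)] \<phi>(1) add smult mult_pCons_left algebra_simps)
qed

text \<open>The summation is bounded by the degree of \<open>f\<close> and not of its image, so the
  range does not change with \<open>\<phi>\<close>.\<close>

lemma poly_map_poly_altdef:
  fixes \<phi> :: "'a::zero \<Rightarrow> 'b::comm_semiring_1"
  assumes "\<phi> 0 = 0"
  shows "poly (map_poly \<phi> f) t = (\<Sum>m\<le>Polynomial.degree f. \<phi> (Polynomial.coeff f m) * t ^ m)"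
proof -
  have "\<phi> (Polynomial.coeff f m) = 0" if "Polynomial.degree (map_poly \<phi> f) < m" for m
    using coeff_eq_0[OF that] by (simp add: coeff_map_poly assms)
  then show ?thesis
    unfolding poly_altdef using map_poly_degree_leq[of \<phi> f]
    by (intro sum.mono_neutral_cong_left) (auto simp: coeff_map_poly assms)
qed

section \<open>Avoiding zeros of polynomials\<close>

text \<open>
  The coordinates of \<open>s\<close> are chosen one after the other; at each stage only finitely many values
  annihilate all the coefficients of one of the remaining polynomials.
\<close>

lemma avoid_zeros:
  fixes S :: "(nat \<Rightarrow> 'f::idom) set" and F :: "(('c::zero \<Rightarrow> 'f) \<times> 'c mpoly) set"
  assumes S: "S \<noteq> {}" "\<And>s k. s \<in> S \<Longrightarrow> infinite {s' k | s'. s' \<in> S \<and> (\<forall>i<k. s' i = s i)}"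
    and F: "finite F" "\<And>h P. (h, P) \<in> F \<Longrightarrow> \<exists>l\<in>Poly_Mapping.keys P. h (Poly_Mapping.lookup P l) \<noteq> 0"
  shows "\<exists>s\<in>S. \<forall>(h, P)\<in>F. eval_mpoly h s P \<noteq> 0"
proof -
  \<comment> \<open>After substitution of \<open>s 0, ..., s (k - 1)\<close>, the coefficient of the
    monomial in the remaining variables that agrees with \<open>j\<close> is the sum of
    \<open>c h P s k l\<close> over \<open>l\<close> in \<open>A k P j\<close>.
    \<open>E s k h P\<close> says that one of these coefficients is nonzero.\<close>
  define A where "A k P j = {l \<in> Poly_Mapping.keys P. \<forall>i\<ge>k. Poly_Mapping.lookup l i = Poly_Mapping.lookup j i}"
    for k and P :: "'c mpoly" and j :: "nat \<Rightarrow>\<^sub>0 nat"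
  define c where "c h P s k l = h (Poly_Mapping.lookup P l) * (\<Prod>i<k. s i ^ Poly_Mapping.lookup l i)"
    for h and P :: "'c mpoly" and s :: "nat \<Rightarrow> 'f" and k and l :: "nat \<Rightarrow>\<^sub>0 nat"
  define E where "E s k h P \<longleftrightarrow> (\<exists>j\<in>Poly_Mapping.keys P. (\<Sum>l\<in>A k P j. c h P s k l) \<noteq> 0)"
    for s k h and P :: "'c mpoly"
  have finA: "finite (A k P j)" for k P j
    by (simp add: A_def)
  have "\<exists>s\<in>S. \<forall>(h, P)\<in>F. E s k h P" for k
  proof (induction k)
    case 0
    obtain s where s: "s \<in> S" using S(1) by blast
    have "E s 0 h P" if "(h, P) \<in> F" for h P
    proof -
      obtain j where j: "j \<in> Poly_Mapping.keys P" "h (Poly_Mapping.lookup P j) \<noteq> 0"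
        using F(2) \<open>(h, P) \<in> F\<close> by blast
      have "A 0 P j = {j}"
        using j(1) by (auto simp: A_def intro!: poly_mapping_eqI)
      then show ?thesis
        using j by (auto simp: E_def c_def intro!: bexI[of _ j])
    qed
    then show ?case using s by blast
  next
    case (Suc k)
    then obtain s where s: "s \<in> S" "\<And>h P. (h, P) \<in> F \<Longrightarrow> E s k h P" by blast
    have "\<exists>j\<in>Poly_Mapping.keys P. (\<Sum>l\<in>A k P j. c h P s k l) \<noteq> 0" if "(h, P) \<in> F" for h P
      using s(2)[OF that] by (simp add: E_def)
    then obtain j where j: "\<And>h P. (h, P) \<in> F \<Longrightarrow> j h P \<in> Poly_Mapping.keys P"
        "\<And>h P. (h, P) \<in> F \<Longrightarrow> (\<Sum>l\<in>A k P (j h P). c h P s k l) \<noteq> 0"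
      by metis
    \<comment> \<open>With the exponents beyond \<open>k\<close> fixed as in \<open>j h P\<close>,
      this is a polynomial in the next coordinate. Its coefficient at the \<open>k\<close>-th
      exponent of \<open>j h P\<close> is the sum that is nonzero by the choice of
      \<open>j\<close>.\<close>
    define q where "q h P = (\<Sum>l\<in>A (Suc k) P (j h P).
      Polynomial.monom (c h P s k l) (Poly_Mapping.lookup l k))" for h P
    have q0: "q h P \<noteq> 0" if "(h, P) \<in> F" for h P
    proof
      assume q: "q h P = 0"
      have "{l \<in> A (Suc k) P (j h P). Poly_Mapping.lookup l k = Poly_Mapping.lookup (j h P) k}
          = A k P (j h P)"
        by (auto simp: A_def Suc_le_eq) (metis le_neq_implies_less)
      moreover have "Polynomial.coeff (q h P) (Poly_Mapping.lookup (j h P) k) =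
          (\<Sum>l\<in>{l \<in> A (Suc k) P (j h P). Poly_Mapping.lookup l k = Poly_Mapping.lookup (j h P) k}. c h P s k l)"
        unfolding q_def by (simp add: Polynomial.coeff_sum sum.inter_filter finA)
      ultimately show False
        using q j(2)[OF that] by simp
    qed
    let ?X = "{s' k | s'. s' \<in> S \<and> (\<forall>i<k. s' i = s i)}"
    have "finite (\<Union>(h, P)\<in>F. {t. poly (q h P) t = 0})"
      using F(1) q0 by (auto intro!: poly_roots_finite)
    then have "\<not> ?X \<subseteq> (\<Union>(h, P)\<in>F. {t. poly (q h P) t = 0})"
      using S(2)[OF s(1), of k] finite_subset by blast
    then obtain s' where s': "s' \<in> S" "\<And>i. i < k \<Longrightarrow> s' i = s i"
        "\<And>h P. (h, P) \<in> F \<Longrightarrow> poly (q h P) (s' k) \<noteq> 0"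
      by blast
    have "E s' (Suc k) h P" if "(h, P) \<in> F" for h P
    proof -
      have "c h P s' (Suc k) l = c h P s k l * s' k ^ Poly_Mapping.lookup l k" for l
        using s'(2) by (simp add: c_def mult.assoc)
      then have "(\<Sum>l\<in>A (Suc k) P (j h P). c h P s' (Suc k) l) = poly (q h P) (s' k)"
        by (simp add: q_def poly_sum poly_monom)
      then show ?thesis
        using s'(3)[OF that] j(1)[OF that] unfolding E_def by (metis (no_types, lifting))
    qed
    then show ?case using s'(1) by blast
  qed
  note E = this
  \<comment> \<open>No variable from \<open>N\<close> on occurs, so at stage \<open>N\<close> all
    monomials agree in the remaining exponents and the only coefficient is the value of the
    polynomial.\<close>
  have "finite (\<Union>(h, P)\<in>F. \<Union>l\<in>Poly_Mapping.keys P. Poly_Mapping.keys l)"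
    using F(1) by auto
  then obtain N where N: "(\<Union>(h, P)\<in>F. \<Union>l\<in>Poly_Mapping.keys P. Poly_Mapping.keys l) \<subseteq> {..<N}"
    using finite_nat_bounded by blast
  obtain s where s: "s \<in> S" "\<And>h P. (h, P) \<in> F \<Longrightarrow> E s N h P"
    using E[of N] by blast
  have "eval_mpoly h s P \<noteq> 0" if "(h, P) \<in> F" for h P
  proof -
    have kl: "Poly_Mapping.keys l \<subseteq> {..<N}" if "l \<in> Poly_Mapping.keys P" for l
      using N \<open>(h, P) \<in> F\<close> that by blast
    have zero: "Poly_Mapping.lookup l i = 0" if "l \<in> Poly_Mapping.keys P" "N \<le> i" for l i
      using kl[OF that(1)] that(2) by (metis in_keys_iff lessThan_iff not_le subsetD)
    have "A N P j = Poly_Mapping.keys P" if "j \<in> Poly_Mapping.keys P" for j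
      using zero that by (auto simp: A_def)
    moreover have "c h P s N l = h (Poly_Mapping.lookup P l) * monomial s l"
      if "l \<in> Poly_Mapping.keys P" for l
      using monomial_superset[OF finite_lessThan kl[OF that], of s] by (simp add: c_def)
    ultimately show ?thesis
      using s(2)[OF that] by (auto simp: E_def eval_mpoly_def)
  qed
  then show ?thesis using s(1) by blast
qed

text \<open>Every coordinate may be changed freely here, so \<open>avoid_zeros\<close> applies with
  the whole space as \<open>S\<close>.\<close>

lemma mpoly_nonvanishing_point:
  fixes h :: "'a::zero \<Rightarrow> 'f::idom"
  assumes inf: "infinite (UNIV :: 'f set)" and "\<And>c. c \<noteq> 0 \<Longrightarrow> h c \<noteq> 0" "g \<noteq> 0"
  shows "\<exists>s. eval_mpoly h s g \<noteq> 0"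
proof -
  have "\<exists>s\<in>UNIV. \<forall>(h, P)\<in>{(h, g)}. eval_mpoly h s P \<noteq> 0"
  proof (rule avoid_zeros)
    fix s :: "nat \<Rightarrow> 'f" and k
    have "t \<in> {s' k | s'. s' \<in> UNIV \<and> (\<forall>i<k. s' i = s i)}" for t
      by (auto intro!: exI[of _ "s(k := t)"])
    then have "{s' k | s'. s' \<in> UNIV \<and> (\<forall>i<k. s' i = s i)} = UNIV"
      by blast
    then show "infinite {s' k | s'. s' \<in> UNIV \<and> (\<forall>i<k. s' i = s i)}"
      using inf by simp
  next
    obtain l where "l \<in> Poly_Mapping.keys g" using \<open>g \<noteq> 0\<close> keys_eq_empty[of g] by blast
    then show "\<exists>l\<in>Poly_Mapping.keys P. h' (Poly_Mapping.lookup P l) \<noteq> 0"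
      if "(h', P) \<in> {(h, g)}" for h' P
      using that assms(2) by (auto simp: in_keys_iff)
  qed auto
  then show ?thesis by simp
qed

section \<open>The substitution \<open>D\<close>\<close>

text \<open>The Witt polynomials: \<open>y\<close> plays the role of Witt coordinates and
  \<open>ghost p y k\<close> is the \<open>k\<close>-th ghost component.\<close>

definition ghost :: "nat \<Rightarrow> (nat \<Rightarrow> 'b::comm_semiring_1) \<Rightarrow> nat \<Rightarrow> 'b" where
  "ghost p y k = (\<Sum>i\<le>k. of_nat p ^ i * y i ^ (p ^ (k - i)))"

text \<open>The system \<open>ghost p y k = s k\<close> is triangular with diagonal coefficients
  \<open>p ^ k\<close> and is solved for one coordinate after the other.\<close>

fun ghost_inv :: "nat \<Rightarrow> (nat \<Rightarrow> 'b::field) \<Rightarrow> nat \<Rightarrow> 'b" where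
  "ghost_inv p s k = (s k - (\<Sum>i<k. of_nat p ^ i * ghost_inv p s i ^ (p ^ (k - i)))) / of_nat p ^ k"

declare ghost_inv.simps [simp del]

lemma ghost_split: "ghost p y k = (\<Sum>i<k. of_nat p ^ i * y i ^ (p ^ (k - i))) + of_nat p ^ k * y k"
  by (simp add: ghost_def lessThan_Suc_atMost[symmetric])

lemma ghost_ghost_inv:
  fixes s :: "nat \<Rightarrow> 'b::field"
  assumes "of_nat p \<noteq> (0 :: 'b)"
  shows "ghost p (ghost_inv p s) k = s k"
  using assms by (simp add: ghost_split ghost_inv.simps[of p s k])

lemma eval_Dpoly: "eval_id y (Dpoly p k) = ghost p y k"
  by (simp add: Dpoly_def ghost_def eval_id_simps)

text \<open>\<open>Q m\<close> is the coefficient of \<open>t ^ m\<close> when \<open>H\<close> is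
  expanded along \<open>x + t D(y)\<close>. Some \<open>Q m\<close> with positive \<open>m\<close>
  survives because, with \<open>p\<close> invertible, \<open>D\<close> reaches every point, and a
  nonconstant polynomial is not a constant function on an infinite field.\<close>

lemma ghost_expansion:
  fixes h :: "'a::comm_ring_1 \<Rightarrow> 'b::field" and H :: "'a mpoly"
  assumes h: "h 0 = 0" "\<And>a b. h (a + b) = h a + h b" "\<And>c. c \<noteq> 0 \<Longrightarrow> h c \<noteq> 0"
    and inf: "infinite (UNIV :: 'b set)" and p: "of_nat p \<noteq> (0 :: 'b)"
    and H: "\<nexists>c. H = Const c"
  shows "\<exists>M Q. finite M \<and> M \<noteq> {} \<and> 0 \<notin> M \<and> (\<forall>m\<in>M. Q m \<noteq> 0) \<and>
    (\<forall>t y. eval_mpoly h (\<lambda>i. x i + t * ghost p y i) H =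
       eval_mpoly h x H + (\<Sum>m\<in>M. t ^ m * eval_id y (Q m)))"
proof -
  \<comment> \<open>A polynomial in the parameter with coefficients in \<open>'b mpoly\<close>: the
    \<open>i\<close>-th variable of \<open>H\<close> becomes \<open>x i\<close> plus the parameter
    times the formal \<open>Dpoly p i\<close>.\<close>
  define W where "W = eval_mpoly (\<lambda>c. [:Const (h c):]) (\<lambda>i. [:Const (x i), Dpoly p i:]) H"
  define M where "M = {m \<in> {1..Polynomial.degree W}. Polynomial.coeff W m \<noteq> 0}"
  have expand: "eval_mpoly h (\<lambda>i. x i + t * ghost p y i) H =
      eval_id y (Polynomial.coeff W 0) + (\<Sum>m\<in>M. t ^ m * eval_id y (Polynomial.coeff W m))" for t y
  proof -
    define \<phi> where "\<phi> = (\<lambda>f. poly (map_poly (eval_id y) f) t)"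
    have e: "eval_id y 0 = 0" by (simp add: eval_id_simps)
    have "\<phi> W = eval_mpoly (\<lambda>c. \<phi> [:Const (h c):]) (\<lambda>i. \<phi> [:Const (x i), Dpoly p i:]) H"
      unfolding W_def
    proof (rule hom_eval_mpoly)
      show "\<phi> (f + g) = \<phi> f + \<phi> g" for f g
        unfolding \<phi>_def by (rule poly_map_poly_hom) (simp_all add: eval_id_simps)
      show "\<phi> (f * g) = \<phi> f * \<phi> g" for f g
        unfolding \<phi>_def by (rule poly_map_poly_hom) (simp_all add: eval_id_simps)
      show "\<phi> 1 = 1"
        by (simp add: \<phi>_def one_pCons map_poly_pCons[of "eval_id y", OF e] eval_id_simps)
    qed (simp add: \<phi>_def)
    also have "\<dots> = eval_mpoly h (\<lambda>i. x i + t * ghost p y i) H"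
      by (simp add: \<phi>_def map_poly_pCons[of "eval_id y", OF e] eval_id_simps eval_Dpoly)
    finally have "eval_mpoly h (\<lambda>i. x i + t * ghost p y i) H =
        (\<Sum>m\<le>Polynomial.degree W. eval_id y (Polynomial.coeff W m) * t ^ m)"
      by (simp add: \<phi>_def poly_map_poly_altdef e)
    also have "\<dots> = eval_id y (Polynomial.coeff W 0) +
        (\<Sum>m\<in>{1..Polynomial.degree W}. eval_id y (Polynomial.coeff W m) * t ^ m)"
      by (simp add: atMost_atLeast0 sum.atLeast_Suc_atMost)
    also have "(\<Sum>m\<in>{1..Polynomial.degree W}. eval_id y (Polynomial.coeff W m) * t ^ m) =
        (\<Sum>m\<in>M. eval_id y (Polynomial.coeff W m) * t ^ m)"
      by (rule sum.mono_neutral_right) (auto simp: M_def eval_id_simps)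
    finally show ?thesis by (simp add: mult.commute)
  qed
  \<comment> \<open>Put \<open>t = 0\<close>: the terms with \<open>m\<close> in \<open>M\<close>
    vanish because all these \<open>m\<close> are positive.\<close>
  have 0: "eval_id y (Polynomial.coeff W 0) = eval_mpoly h x H" for y
  proof -
    have "(\<Sum>m\<in>M. 0 ^ m * eval_id y (Polynomial.coeff W m)) = 0"
      by (rule sum.neutral) (auto simp: M_def)
    then show ?thesis
      using expand[of 0 y] by simp
  qed
  \<comment> \<open>Were \<open>M\<close> empty, \<open>t = 1\<close> and the solution
    \<open>y\<close> of \<open>D(y) = s - x\<close> would show that \<open>H\<close> takes the same
    value at every point \<open>s\<close>. The value at the origin comes from the constant term
    \<open>c\<close>, so \<open>H - Const c\<close> would vanish identically.\<close>
  have "M \<noteq> {}"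
  proof
    assume M: "M = {}"
    have const: "eval_mpoly h s H = eval_mpoly h x H" for s
      using expand[of 1 "ghost_inv p (\<lambda>i. s i - x i)"] by (simp add: M 0 ghost_ghost_inv[OF p])
    define c where "c = Poly_Mapping.lookup H 0"
    have "H - Const c \<noteq> 0" using H by auto
    then obtain s where "eval_mpoly h s (H - Const c) \<noteq> 0"
      using mpoly_nonvanishing_point[of h "H - Const c", OF inf h(3)] by blast
    then have "eval_mpoly h s H \<noteq> h c"
      by (simp add: eval_mpoly_diff[of h, OF h(1,2)] eval_mpoly_Const h(1))
    moreover have "eval_mpoly h (\<lambda>_. 0) H = h c"
      unfolding c_def using h(1) by (rule eval_mpoly_at_zero)
    ultimately show False using const by metis
  qed
  then show ?thesis
    using expand 0
    by (intro exI[of _ M] exI[of _ "Polynomial.coeff W"]) (auto simp: M_def)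
qed

section \<open>Valuations\<close>

context valuation
begin

text \<open>\<open>v 0\<close> is unspecified; \<open>vge\<close> and \<open>vgt\<close> treat
  \<open>0\<close> as an element of infinite value, which spares case distinctions in sums.\<close>

definition vge :: "'g \<Rightarrow> 'a \<Rightarrow> bool" where "vge \<gamma> x \<longleftrightarrow> x = 0 \<or> \<gamma> \<le> v x"

definition vgt :: "'g \<Rightarrow> 'a \<Rightarrow> bool" where "vgt \<gamma> x \<longleftrightarrow> x = 0 \<or> \<gamma> < v x"

lemma vge_mono: "vge \<gamma> x \<Longrightarrow> \<delta> \<le> \<gamma> \<Longrightarrow> vge \<delta> x"
  by (auto simp: vge_def)

lemma vgt_if_vge: "vge \<gamma> x \<Longrightarrow> \<delta> < \<gamma> \<Longrightarrow> vgt \<delta> x"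
  by (auto simp: vge_def vgt_def)

lemma vge_add:
  assumes "vge \<gamma> x" "vge \<gamma> y"
  shows "vge \<gamma> (x + y)"
proof (cases "x = 0 \<or> y = 0 \<or> x + y = 0")
  case False
  then have "\<gamma> \<le> min (v x) (v y)" using assms by (simp add: vge_def)
  also have "\<dots> \<le> v (x + y)" using False by (intro v_add) auto
  finally show ?thesis by (simp add: vge_def)
qed (use assms in \<open>auto simp: vge_def\<close>)

lemma vgt_add:
  assumes "vgt \<gamma> x" "vgt \<gamma> y"
  shows "vgt \<gamma> (x + y)"
proof (cases "x = 0 \<or> y = 0 \<or> x + y = 0")
  case False
  then have "\<gamma> < min (v x) (v y)" using assms by (simp add: vgt_def)
  also have "\<dots> \<le> v (x + y)" using False by (intro v_add) auto
  finally show ?thesis by (simp add: vgt_def)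
qed (use assms in \<open>auto simp: vgt_def\<close>)

lemma vge_sum:
  assumes "\<And>a. a \<in> A \<Longrightarrow> vge \<gamma> (f a)"
  shows "vge \<gamma> (sum f A)"
proof -
  have "vge \<gamma> 0" by (simp add: vge_def)
  with assms show ?thesis
    by (induction A rule: infinite_finite_induct) (simp_all add: vge_add)
qed

lemma vgt_sum:
  assumes "\<And>a. a \<in> A \<Longrightarrow> vgt \<gamma> (f a)"
  shows "vgt \<gamma> (sum f A)"
proof -
  have "vgt \<gamma> 0" by (simp add: vgt_def)
  with assms show ?thesis
    by (induction A rule: infinite_finite_induct) (simp_all add: vgt_add)
qed

lemma v_diff_commute: "v (x - y) = v (y - x)"
  using v_minus[of "x - y"] by (cases "x = y") simp_all

text \<open>If \<open>x + y\<close> had larger value than \<open>y\<close>, then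
  \<open>y = (x + y) - x\<close> would be a sum of two terms of value greater than its own.\<close>

lemma v_add_eq:
  assumes "y \<noteq> 0" "vgt (v y) x"
  shows "x + y \<noteq> 0 \<and> v (x + y) = v y"
proof (cases "x = 0")
  case False
  then have x: "v y < v x" using assms(2) by (simp add: vgt_def)
  have nz: "x + y \<noteq> 0"
  proof
    assume "x + y = 0"
    then have "x = - y" by (simp add: eq_neg_iff_add_eq_0)
    then show False using x v_minus[OF assms(1)] by simp
  qed
  have "v y \<le> v (x + y)"
    using v_add[OF False assms(1) nz] x by (simp add: min_def split: if_splits)
  moreover have "\<not> v y < v (x + y)"
  proof
    assume *: "v y < v (x + y)"
    then have "min (v (x + y)) (v (- x)) \<le> v (x + y + - x)"
      using v_add[OF nz, of "- x"] False assms(1) by simp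
    then show False
      using * x v_minus[OF False] by (simp add: min_def split: if_splits)
  qed
  ultimately show ?thesis using nz by simp
qed (use assms in auto)

text \<open>In the ordered group the multiple \<open>m \<gamma>\<close> is written as the sum of
  \<open>m\<close> copies of \<open>\<gamma>\<close>, here and in all later estimates.\<close>

lemma v_power: "x \<noteq> 0 \<Longrightarrow> v (x ^ m) = (\<Sum>i<m. v x)"
  by (induction m) (simp_all add: v_one v_mult add.commute)

lemma v_inverse: "x \<noteq> 0 \<Longrightarrow> v (inverse x) = - v x"
  using v_mult[of x "inverse x"] by (simp add: v_one minus_unique)

lemma v_divide: "x \<noteq> 0 \<Longrightarrow> y \<noteq> 0 \<Longrightarrow> v (x / y) = v x - v y"
  by (simp add: divide_inverse v_mult v_inverse)

lemma val_ring_iff_vge: "x \<in> val_ring v \<longleftrightarrow> vge 0 x"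
  by (simp add: val_ring_def vge_def)

lemma val_ring_0: "0 \<in> val_ring v" and val_ring_1: "1 \<in> val_ring v"
  by (simp_all add: val_ring_def v_one)

lemma val_ring_add: "x \<in> val_ring v \<Longrightarrow> y \<in> val_ring v \<Longrightarrow> x + y \<in> val_ring v"
  by (simp add: val_ring_iff_vge vge_add)

lemma val_ring_sum: "(\<And>a. a \<in> A \<Longrightarrow> f a \<in> val_ring v) \<Longrightarrow> sum f A \<in> val_ring v"
  by (simp add: val_ring_iff_vge vge_sum)

lemma val_ring_mult: "x \<in> val_ring v \<Longrightarrow> y \<in> val_ring v \<Longrightarrow> x * y \<in> val_ring v"
  by (cases "x = 0 \<or> y = 0") (auto simp: val_ring_def v_mult)

lemma val_ring_power: "x \<in> val_ring v \<Longrightarrow> x ^ k \<in> val_ring v"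
  by (induction k) (auto simp: val_ring_1 val_ring_mult)

lemma val_ring_prod: "(\<And>a. a \<in> A \<Longrightarrow> f a \<in> val_ring v) \<Longrightarrow> prod f A \<in> val_ring v"
  by (induction A rule: infinite_finite_induct) (auto simp: val_ring_1 val_ring_mult)

lemma val_ring_of_nat: "of_nat k \<in> val_ring v"
  by (induction k) (auto simp: val_ring_0 val_ring_1 val_ring_add)

lemmas val_ring_closed = val_ring_0 val_ring_1 val_ring_add val_ring_diff val_ring_mult val_ring_power
  val_ring_sum val_ring_prod val_ring_of_nat

lemma val_ring_divide: "y \<noteq> 0 \<Longrightarrow> vge (v y) x \<Longrightarrow> x / y \<in> val_ring v"
  by (cases "x = 0") (auto simp: vge_def val_ring_def v_divide)

end

section \<open>Residues and reduction of polynomials\<close>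

context valued_field
begin

lemma pi_zero: "\<pi> 0 = 0"
  using pi_add[OF val_ring_0 val_ring_0] by (metis add.right_neutral add_cancel_left_right)

lemma pi_diff: "x \<in> val_ring v \<Longrightarrow> y \<in> val_ring v \<Longrightarrow> \<pi> (x - y) = \<pi> x - \<pi> y"
  using pi_add[of "x - y" y] by (simp add: val_ring_diff)

lemma pi_sum: "(\<And>a. a \<in> A \<Longrightarrow> f a \<in> val_ring v) \<Longrightarrow> \<pi> (sum f A) = (\<Sum>a\<in>A. \<pi> (f a))"
  by (induction A rule: infinite_finite_induct) (auto simp: pi_zero pi_add val_ring_sum)

lemma pi_power: "x \<in> val_ring v \<Longrightarrow> \<pi> (x ^ k) = \<pi> x ^ k"
  by (induction k) (auto simp: pi_one pi_mult val_ring_power)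

lemma pi_prod: "(\<And>a. a \<in> A \<Longrightarrow> f a \<in> val_ring v) \<Longrightarrow> \<pi> (prod f A) = (\<Prod>a\<in>A. \<pi> (f a))"
  by (induction A rule: infinite_finite_induct) (auto simp: pi_one pi_mult val_ring_prod)

lemma pi_eq_0_iff:
  assumes "x \<in> val_ring v"
  shows "\<pi> x = 0 \<longleftrightarrow> x = 0 \<or> 0 < v x"
proof -
  have "\<pi> x = 0 \<longleftrightarrow> x \<in> {x \<in> val_ring v. \<pi> x = 0}"
    using assms by simp
  also have "\<dots> \<longleftrightarrow> x \<in> val_ideal v"
    by (simp only: pi_kernel)
  finally show ?thesis by (simp add: val_ideal_def)
qed

lemma pi_nonzero:
  assumes "x \<in> val_ring v" "\<pi> x \<noteq> 0"
  shows "x \<noteq> 0 \<and> v x = 0"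
  using assms pi_eq_0_iff[OF assms(1)] by (auto simp: val_ring_def)

text \<open>Dividing by a coefficient \<open>u\<close> of least value makes all coefficients
  integral and one of them \<open>1\<close>. So \<open>Q(y)\<close> has value at least
  \<open>v u\<close> for integral \<open>y\<close>, with equality when the reduced polynomial does
  not vanish at the residues. The reduction is expressed by a coefficient map instead of a new
  polynomial; hence the pairs \<open>(h, P)\<close> in \<open>avoid_zeros\<close>.\<close>

lemma eval_mpoly_normalize:
  assumes "Q \<noteq> 0"
  shows "\<exists>u. u \<noteq> 0 \<and> (\<exists>l\<in>Poly_Mapping.keys Q. \<pi> (Poly_Mapping.lookup Q l / u) \<noteq> 0) \<and>
    (\<forall>y. (\<forall>i. y i \<in> val_ring v) \<longrightarrow> eval_id y Q / u \<in> val_ring v \<and>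
       \<pi> (eval_id y Q / u) = eval_mpoly (\<lambda>c. \<pi> (c / u)) (\<lambda>i. \<pi> (y i)) Q)"
proof -
  let ?K = "Poly_Mapping.keys Q" and ?c = "Poly_Mapping.lookup Q"
  have K: "finite ?K" "?K \<noteq> {}"
    using assms by (simp_all add: keys_eq_empty)
  define l where "l = arg_min_on (\<lambda>l. v (?c l)) ?K"
  have l: "l \<in> ?K" "v (?c l) \<le> v (?c k)" if "k \<in> ?K" for k
    using arg_min_if_finite[OF K, of "\<lambda>l. v (?c l)"] that by (auto simp: l_def not_less)
  obtain k where "k \<in> ?K" using K by blast
  then have lK: "l \<in> ?K" using l by blast
  define u where "u = ?c l"
  have u: "u \<noteq> 0" using lK by (simp add: u_def in_keys_iff)
  have c: "?c k / u \<in> val_ring v" if "k \<in> ?K" for k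
    using l(2)[OF that] u by (intro val_ring_divide) (auto simp: vge_def u_def)
  have "eval_id y Q / u \<in> val_ring v \<and>
       \<pi> (eval_id y Q / u) = eval_mpoly (\<lambda>c. \<pi> (c / u)) (\<lambda>i. \<pi> (y i)) Q"
    if y: "\<forall>i. y i \<in> val_ring v" for y
  proof -
    have m: "monomial y k \<in> val_ring v" "\<pi> (monomial y k) = monomial (\<lambda>i. \<pi> (y i)) k" for k
      using y by (auto simp: pi_prod pi_power val_ring_power intro!: val_ring_prod)
    have e: "eval_id y Q / u = (\<Sum>k\<in>?K. ?c k / u * monomial y k)"
      by (simp add: eval_mpoly_def sum_divide_distrib)
    show ?thesis
      unfolding e using c m
      by (simp add: eval_mpoly_def pi_sum pi_mult val_ring_mult val_ring_sum del: times_divide_eq_left)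
  qed
  moreover have "\<pi> (?c l / u) \<noteq> 0"
    using u by (simp add: u_def pi_one)
  ultimately show ?thesis
    using u lK by blast
qed

end

section \<open>Dwork coordinates\<close>

context valued_difference_field
begin

lemma sigma_zero: "\<sigma> 0 = 0"
  using sigma_add[of 0 0] by (metis add.right_neutral add_cancel_left_right)

lemma sigma_one: "\<sigma> 1 = 1"
proof -
  have "\<sigma> 1 \<noteq> 0"
    using bij_is_inj[OF sigma_bij] by (metis injD sigma_zero zero_neq_one)
  then show ?thesis
    using sigma_mult[of 1 1] by simp
qed

lemma sigma_sum: "\<sigma> (sum f A) = (\<Sum>a\<in>A. \<sigma> (f a))"
  by (induction A rule: infinite_finite_induct) (auto simp: sigma_zero sigma_add)

lemma sigma_power: "\<sigma> (x ^ k) = \<sigma> x ^ k"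
  by (induction k) (auto simp: sigma_one sigma_mult)

lemma sigma_of_nat: "\<sigma> (of_nat k) = of_nat k"
  by (induction k) (auto simp: sigma_zero sigma_one sigma_add)

lemma sigma_closed: "x \<in> val_ring v \<Longrightarrow> \<sigma> x \<in> val_ring v"
  using sigma_val_ring by blast

lemma sigma_pow_add: "(\<sigma> ^^ i) (x + y) = (\<sigma> ^^ i) x + (\<sigma> ^^ i) y"
  by (induction i) (auto simp: sigma_add)

lemma sigma_pow_mult: "(\<sigma> ^^ i) (x * y) = (\<sigma> ^^ i) x * (\<sigma> ^^ i) y"
  by (induction i) (auto simp: sigma_mult)

lemma sigma_pow_fixed: "\<sigma> t = t \<Longrightarrow> (\<sigma> ^^ i) t = t"
  by (induction i) auto

lemma sigma_pow_closed: "x \<in> val_ring v \<Longrightarrow> (\<sigma> ^^ i) x \<in> val_ring v"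
  by (induction i) (auto simp: sigma_closed)

end

section \<open>The p-adic filtration and Dwork's lemma\<close>

context witt_case
begin

abbreviation P :: 'a where "P \<equiv> of_nat p"

lemma P_nonzero: "P \<noteq> 0"
  using char_0 prime_gt_0_nat[OF prime_p] by (simp add: CHAR_eq0_iff)

text \<open>The ideal generated by \<open>p ^ s\<close>; congruence modulo \<open>p ^ s\<close> is
  membership of the difference.\<close>

definition pideal :: "nat \<Rightarrow> 'a set" where
  "pideal s = (\<lambda>c. P ^ s * c) ` val_ring v"

lemma pidealI: "c \<in> val_ring v \<Longrightarrow> x = P ^ s * c \<Longrightarrow> x \<in> pideal s"
  by (auto simp: pideal_def)

lemma pideal_add: "x \<in> pideal s \<Longrightarrow> y \<in> pideal s \<Longrightarrow> x + y \<in> pideal s"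
  by (auto simp: pideal_def distrib_left[symmetric] val_ring_add)

lemma pideal_diff: "x \<in> pideal s \<Longrightarrow> y \<in> pideal s \<Longrightarrow> x - y \<in> pideal s"
  by (auto simp: pideal_def right_diff_distrib[symmetric] val_ring_diff)

lemma pideal_sum: "(\<And>a. a \<in> A \<Longrightarrow> f a \<in> pideal s) \<Longrightarrow> sum f A \<in> pideal s"
  by (induction A rule: infinite_finite_induct)
     (auto simp: pideal_add intro: pidealI[OF val_ring_0])

lemma pideal_mult: "x \<in> pideal s \<Longrightarrow> y \<in> pideal r \<Longrightarrow> x * y \<in> pideal (s + r)"
proof -
  assume "x \<in> pideal s" "y \<in> pideal r"
  then obtain c d where "x = P ^ s * c" "y = P ^ r * d" "c \<in> val_ring v" "d \<in> val_ring v"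
    by (auto simp: pideal_def)
  then show "x * y \<in> pideal (s + r)"
    by (intro pidealI[of "c * d"]) (auto simp: power_add val_ring_mult)
qed

lemma pideal_0: "pideal 0 = val_ring v"
  by (simp add: pideal_def)

lemma pideal_scale: "x \<in> val_ring v \<Longrightarrow> y \<in> pideal s \<Longrightarrow> x * y \<in> pideal s"
  using pideal_mult[of x 0 y s] by (simp add: pideal_0)

lemma pideal_power: "P ^ s \<in> pideal s"
  by (rule pidealI[OF val_ring_1]) simp

lemma pideal_mono: "s \<le> r \<Longrightarrow> x \<in> pideal r \<Longrightarrow> x \<in> pideal s"
proof -
  assume *: "s \<le> r" "x \<in> pideal r"
  then obtain c where c: "x = P ^ r * c" "c \<in> val_ring v"
    by (auto simp: pideal_def)
  have "P ^ r = P ^ s * P ^ (r - s)"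
    using *(1) by (simp add: power_add[symmetric])
  then show "x \<in> pideal s"
    using c by (intro pidealI[of "P ^ (r - s) * c"]) (auto intro!: val_ring_closed)
qed

lemma pideal_cancel: "P ^ j * x \<in> pideal (j + s) \<Longrightarrow> x \<in> pideal s"
  using P_nonzero by (auto simp: pideal_def power_add mult.assoc)

lemma pi_pideal_Suc: "x \<in> pideal (Suc s) \<Longrightarrow> \<pi> x = 0"
proof -
  assume "x \<in> pideal (Suc s)"
  then obtain c where c: "x = P * c" "c \<in> val_ring v"
    using pideal_mono[of 1 "Suc s" x] by (auto simp: pideal_def)
  have "\<pi> P = 0"
    using pi_eq_0_iff[OF val_ring_of_nat] v_p_pos by blast
  then show "\<pi> x = 0"
    using c by (simp add: pi_mult val_ring_of_nat)
qed

text \<open>As \<open>v(p)\<close> is the least positive value, \<open>p\<close> generates the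
  maximal ideal.\<close>

lemma pideal_1I: "x \<in> val_ring v \<Longrightarrow> \<pi> x = 0 \<Longrightarrow> x \<in> pideal 1"
proof -
  assume "x \<in> val_ring v" "\<pi> x = 0"
  then have "x = 0 \<or> 0 < v x"
    by (simp add: pi_eq_0_iff)
  then have "x / P \<in> val_ring v"
    using v_p_least P_nonzero by (intro val_ring_divide) (auto simp: vge_def)
  then show "x \<in> pideal 1"
    by (rule pidealI) (simp add: P_nonzero)
qed

text \<open>Both terms have residue \<open>\<pi> z ^ p\<close> because the induced automorphism is
  the Frobenius.\<close>

lemma sigma_frobenius: "z \<in> val_ring v \<Longrightarrow> \<sigma> z - z ^ p \<in> pideal 1"
  by (intro pideal_1I)
     (simp_all add: val_ring_closed sigma_closed pi_diff pi_power sigma_bar_pi[symmetric] sigma_bar_frob)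

text \<open>The linear term carries the factor \<open>k\<close>, which gains a power of
  \<open>p\<close> when \<open>k = p\<close>; the integrality of \<open>c\<close> controls the
  rest.\<close>

lemma power_taylor:
  assumes "b \<in> val_ring v" "d \<in> val_ring v"
  shows "\<exists>c\<in>val_ring v. (b + d) ^ k = b ^ k + of_nat k * b ^ (k - 1) * d + d\<^sup>2 * c"
proof (induction k)
  case 0
  show ?case by (auto intro: bexI[of _ 0] val_ring_0)
next
  case (Suc k)
  then obtain c where c: "c \<in> val_ring v" "(b + d) ^ k = b ^ k + of_nat k * b ^ (k - 1) * d + d\<^sup>2 * c"
    by blast
  have "(b + d) ^ Suc k =
      b ^ Suc k + of_nat (Suc k) * b ^ (Suc k - 1) * d + d\<^sup>2 * (of_nat k * b ^ (k - 1) + (b + d) * c)"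
  \<comment> \<open>\<open>k - 1\<close> is truncated at \<open>k = 0\<close>; there the hypothesis
    reads \<open>1 = 1 + d\<^sup>2 * c\<close>, so the remainder vanishes.\<close>
  proof (cases k)
    case 0
    then have "d\<^sup>2 * c = 0" using c(2) by simp
    then have "d\<^sup>2 * ((b + d) * c) = 0" by auto
    with 0 show ?thesis by simp
  next
    case Suc
    then show ?thesis using c(2) by (simp add: algebra_simps power2_eq_square)
  qed
  then show ?case
    using c(1) assms by (intro bexI[of _ "of_nat k * b ^ (k - 1) + (b + d) * c"]) (auto intro!: val_ring_closed)
qed

text \<open>Raising to the power \<open>p\<close> improves a congruence by one power of
  \<open>p\<close>: the linear term of \<open>power_taylor\<close> gains the factor
  \<open>p\<close>, and the quadratic term has at least twice the old exponent, which is positive.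
  Hence the form \<open>Suc s\<close>.\<close>

lemma pideal_frobenius:
  assumes "a \<in> val_ring v" "b \<in> val_ring v" "a - b \<in> pideal (Suc s)"
  shows "a ^ (p ^ r) - b ^ (p ^ r) \<in> pideal (Suc s + r)"
proof (induction r)
  case (Suc r)
  define a' b' where ab': "a' = a ^ (p ^ r)" "b' = b ^ (p ^ r)"
  have m: "a' \<in> val_ring v" "b' \<in> val_ring v" "a' - b' \<in> val_ring v" "a' - b' \<in> pideal (Suc s + r)"
    using assms Suc by (simp_all add: ab' val_ring_closed)
  obtain c where c: "c \<in> val_ring v"
    "a' ^ p = b' ^ p + P * b' ^ (p - 1) * (a' - b') + (a' - b')\<^sup>2 * c"
    using power_taylor[OF m(2,3), of p] by auto
  have "P * (a' - b') \<in> pideal (1 + (Suc s + r))"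
    using pideal_mult[OF pideal_power[of 1] m(4)] by simp
  then have "b' ^ (p - 1) * (P * (a' - b')) \<in> pideal (Suc s + Suc r)"
    using pideal_scale m(2) val_ring_power by simp
  moreover have "(a' - b') * (a' - b') \<in> pideal (Suc s + Suc r)"
    using pideal_mult[OF m(4,4)] by (rule pideal_mono[rotated]) simp
  then have "c * (a' - b')\<^sup>2 \<in> pideal (Suc s + Suc r)"
    using c(1) by (simp add: power2_eq_square pideal_scale)
  ultimately have "a' ^ p - b' ^ p \<in> pideal (Suc s + Suc r)"
    using pideal_add c(2) by (simp add: mult_ac)
  then show ?case
    by (simp add: ab' power_mult[symmetric] mult.commute)
qed (use assms in simp)

text \<open>The Witt coordinates belonging to the ghost components
  \<open>z, \<sigma> z, \<sigma> (\<sigma> z), ...\<close>.\<close>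

definition dwork :: "'a \<Rightarrow> nat \<Rightarrow> 'a" where
  "dwork z = ghost_inv p (\<lambda>k. (\<sigma> ^^ k) z)"

lemma ghost_dwork: "ghost p (dwork z) k = (\<sigma> ^^ k) z"
  using P_nonzero by (simp add: dwork_def ghost_ghost_inv)

lemma dwork_0: "dwork z 0 = z"
  using ghost_dwork[of z 0] by (simp add: ghost_def)

lemma dwork_eq: "P ^ k * dwork z k = (\<sigma> ^^ k) z - (\<Sum>i<k. P ^ i * dwork z i ^ (p ^ (k - i)))"
  using ghost_dwork[of z k] by (simp add: ghost_split algebra_simps)

text \<open>Dwork's lemma. Applying \<open>\<sigma>\<close> to the equation of index
  \<open>k - 1\<close> and comparing with that of index \<open>k\<close> gives
  \<open>p^k y_k\<close> as the sum of \<open>p^i (\<sigma>(y_i)^q - (y_i^p)^q)\<close> with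
  \<open>q = p^(k-1-i)\<close>. As \<open>\<sigma>(y_i)\<close> and \<open>y_i^p\<close> agree
  modulo \<open>p\<close>, their \<open>q\<close>-th powers agree modulo \<open>p^(k-i)\<close>, so
  every term is divisible by \<open>p^k\<close>.\<close>

lemma dwork_closed:
  assumes z: "z \<in> val_ring v"
  shows "dwork z k \<in> val_ring v"
proof (induction k rule: less_induct)
  case (less k)
  show ?case
  proof (cases k)
    case 0
    then show ?thesis using z by (simp add: dwork_0)
  next
    case (Suc k')
    let ?y = "dwork z"
    have "\<sigma> (ghost p ?y k') = (\<sigma> ^^ k) z"
      by (simp add: Suc ghost_dwork)
    moreover have "\<sigma> (ghost p ?y k') = (\<Sum>i<k. P ^ i * \<sigma> (?y i) ^ (p ^ (k' - i)))"
      by (simp add: ghost_def sigma_sum sigma_mult sigma_power sigma_of_nat Suc lessThan_Suc_atMost)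
    moreover have "(\<Sum>i<k. P ^ i * ?y i ^ (p ^ (k - i))) = (\<Sum>i<k. P ^ i * (?y i ^ p) ^ (p ^ (k' - i)))"
      by (intro sum.cong) (auto simp: Suc power_mult[symmetric] Suc_diff_le)
    ultimately have "P ^ k * ?y k =
        (\<Sum>i<k. P ^ i * (\<sigma> (?y i) ^ (p ^ (k' - i)) - (?y i ^ p) ^ (p ^ (k' - i))))"
      by (simp only: dwork_eq right_diff_distrib sum_subtractf)
    also have "\<dots> \<in> pideal k"
    proof (rule pideal_sum)
      fix i assume i: "i \<in> {..<k}"
      then have y: "?y i \<in> val_ring v" using less by simp
      have "\<sigma> (?y i) ^ (p ^ (k' - i)) - (?y i ^ p) ^ (p ^ (k' - i)) \<in> pideal (Suc 0 + (k' - i))"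
        using sigma_frobenius[OF y] y by (intro pideal_frobenius) (simp_all add: sigma_closed val_ring_power)
      moreover have "i + (Suc 0 + (k' - i)) = k" using i Suc by simp
      ultimately show "P ^ i * (\<sigma> (?y i) ^ (p ^ (k' - i)) - (?y i ^ p) ^ (p ^ (k' - i))) \<in> pideal k"
        using pideal_mult[OF pideal_power] by metis
    qed
    finally show ?thesis
      using pideal_cancel[of k "?y k" 0] by (simp add: pideal_0)
  qed
qed

text \<open>By induction the coordinates of index \<open>i < j\<close> change by multiples of
  \<open>p^(k-i)\<close>, so their powers with exponent \<open>p^(j-i)\<close> change by multiples
  of \<open>p^(k-i+j-i)\<close>. After multiplication by \<open>p^i\<close> at least
  \<open>p^(k+1)\<close> is left, so modulo that power only the shift of the ghost component
  counts.\<close>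

lemma dwork_perturb:
  assumes z: "z \<in> val_ring v" and e: "e \<in> val_ring v" and "j \<le> k"
  shows "dwork (z + P ^ k * e) j - dwork z j - P ^ (k - j) * (\<sigma> ^^ j) e \<in> pideal (Suc (k - j))"
  using \<open>j \<le> k\<close>
proof (induction j rule: less_induct)
  case (less j)
  define z' where "z' = z + P ^ k * e"
  have z': "z' \<in> val_ring v"
    unfolding z'_def by (intro val_ring_closed z e)
  have split: "P ^ j * P ^ (k - j) = P ^ k"
    using less.prems by (simp add: power_add[symmetric])
  have "P ^ j * (dwork z' j - dwork z j - P ^ (k - j) * (\<sigma> ^^ j) e) =
      P ^ j * dwork z' j - P ^ j * dwork z j - P ^ k * (\<sigma> ^^ j) e"
    by (simp add: right_diff_distrib mult.assoc[symmetric] split)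
  also have "\<dots> = - (\<Sum>i<j. P ^ i * (dwork z' i ^ (p ^ (j - i)) - dwork z i ^ (p ^ (j - i))))"
  proof -
    have "(\<sigma> ^^ j) (P ^ k) = P ^ k"
      by (rule sigma_pow_fixed) (simp add: sigma_power sigma_of_nat)
    then have "(\<sigma> ^^ j) z' = (\<sigma> ^^ j) z + P ^ k * (\<sigma> ^^ j) e"
      by (simp add: z'_def sigma_pow_add sigma_pow_mult)
    then show ?thesis
      by (simp add: dwork_eq sum_subtractf right_diff_distrib)
  qed
  also have "\<dots> = (\<Sum>i<j. P ^ i * (dwork z' i ^ (p ^ (j - i)) - dwork z i ^ (p ^ (j - i)))) * (- 1)"
    by simp
  also have "\<dots> \<in> pideal (Suc k)"
  proof -
    have "(\<Sum>i<j. P ^ i * (dwork z' i ^ (p ^ (j - i)) - dwork z i ^ (p ^ (j - i)))) \<in> pideal (Suc k)"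
    proof (rule pideal_sum)
      fix i assume "i \<in> {..<j}"
      then have i: "i < j" "i \<le> k" "i < k" using less.prems by auto
      have "P ^ (k - i) * (\<sigma> ^^ i) e \<in> pideal (k - i)"
        by (rule pidealI[OF sigma_pow_closed[OF e, of i]]) simp
      moreover have "dwork z' i - dwork z i - P ^ (k - i) * (\<sigma> ^^ i) e \<in> pideal (k - i)"
        unfolding z'_def using less.IH[OF i(1,2)] by (rule pideal_mono[rotated]) simp
      ultimately have "dwork z' i - dwork z i - P ^ (k - i) * (\<sigma> ^^ i) e + P ^ (k - i) * (\<sigma> ^^ i) e \<in> pideal (k - i)"
        by (rule pideal_add[rotated])
      \<comment> \<open>The exponent \<open>k - i\<close> is positive, as
        \<open>pideal_frobenius\<close> requires.\<close>
      moreover have "k - i = Suc (k - i - 1)" using i by simp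
      ultimately have "dwork z' i - dwork z i \<in> pideal (Suc (k - i - 1))"
        by (metis diff_add_cancel)
      then have "dwork z' i ^ (p ^ (j - i)) - dwork z i ^ (p ^ (j - i)) \<in> pideal (Suc (k - i - 1) + (j - i))"
        by (intro pideal_frobenius) (simp_all add: dwork_closed z z')
      then have "P ^ i * (dwork z' i ^ (p ^ (j - i)) - dwork z i ^ (p ^ (j - i)))
          \<in> pideal (i + (Suc (k - i - 1) + (j - i)))"
        by (intro pideal_mult pideal_power)
      then show "P ^ i * (dwork z' i ^ (p ^ (j - i)) - dwork z i ^ (p ^ (j - i))) \<in> pideal (Suc k)"
        by (rule pideal_mono[rotated]) (use i in simp)
    qed
    then show ?thesis
      using pideal_diff[of 0 "Suc k"] pidealI[OF val_ring_0, of 0 "Suc k"] by simp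
  qed
  finally show ?case
    using pideal_cancel[of j _ "Suc (k - j)"] less.prems by (simp add: z'_def)
qed

text \<open>On residues the correction \<open>p^(k-j) \<sigma>^j(e)\<close> is invisible for
  \<open>j < k\<close> and becomes the residue of \<open>\<sigma>^k(e)\<close> for
  \<open>j = k\<close>. Thus the residue of coordinate \<open>k\<close> can be adjusted without
  disturbing the earlier ones.\<close>

lemma pi_dwork_perturb:
  assumes z: "z \<in> val_ring v" and e: "e \<in> val_ring v"
  shows "j < k \<Longrightarrow> \<pi> (dwork (z + P ^ k * e) j) = \<pi> (dwork z j)" (is "_ \<Longrightarrow> ?lt")
    and "\<pi> (dwork (z + P ^ k * e) k) = \<pi> (dwork z k) + \<pi> ((\<sigma> ^^ k) e)" (is ?eq)
proof -
  have z': "z + P ^ k * e \<in> val_ring v"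
    by (intro val_ring_closed z e)
  note cl = dwork_closed[OF z] dwork_closed[OF z'] sigma_pow_closed[OF e]
  have main: "\<pi> (dwork (z + P ^ k * e) j) = \<pi> (dwork z j) + \<pi> (P ^ (k - j) * (\<sigma> ^^ j) e)" if "j \<le> k" for j
  proof -
    have c: "P ^ (k - j) * (\<sigma> ^^ j) e \<in> val_ring v"
      by (intro val_ring_closed cl)
    have "\<pi> (dwork (z + P ^ k * e) j - dwork z j - P ^ (k - j) * (\<sigma> ^^ j) e) = 0"
      using dwork_perturb[OF z e that] by (rule pi_pideal_Suc)
    then have "\<pi> (dwork (z + P ^ k * e) j) - \<pi> (dwork z j) - \<pi> (P ^ (k - j) * (\<sigma> ^^ j) e) = 0"
      using c cl by (simp add: pi_diff val_ring_diff)
    then show ?thesis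
      unfolding diff_diff_eq by (simp only: right_minus_eq)
  qed
  show ?eq using main[of k] by simp
  assume j: "j < k"
  have "P ^ (k - j) * (\<sigma> ^^ j) e \<in> pideal (Suc (k - j - 1))"
    using j by (intro pidealI[OF cl(3)[of j]]) (simp add: power_Suc[symmetric] Suc_diff_Suc del: power_Suc)
  then have "\<pi> (P ^ (k - j) * (\<sigma> ^^ j) e) = 0"
    by (rule pi_pideal_Suc)
  then show ?lt using main[of j] j by simp
qed

end

section \<open>Values of differences\<close>

text \<open>Infinitude is asked of the residue field of the base: translations by elements of
  \<open>K\<close> shift residues only by elements of the range of \<open>\<eta>\<close>.\<close>

locale witt_extension = valued_difference_field_extension v \<pi> \<sigma> v' \<pi>' \<sigma>' \<iota> \<epsilon> \<eta>
    + base: witt_case v \<pi> \<sigma> p + ext: witt_case v' \<pi>' \<sigma>' p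
  for v :: "'a::field \<Rightarrow> 'g::linordered_ab_group_add" and \<pi> :: "'a \<Rightarrow> 'k::field"
    and \<sigma> :: "'a \<Rightarrow> 'a"
    and v' :: "'b::field \<Rightarrow> 'h::linordered_ab_group_add" and \<pi>' :: "'b \<Rightarrow> 'l::field"
    and \<sigma>' :: "'b \<Rightarrow> 'b"
    and \<iota> :: "'a \<Rightarrow> 'b" and \<epsilon> :: "'g \<Rightarrow> 'h" and \<eta> :: "'k \<Rightarrow> 'l" and p :: nat +
  assumes infinite_residue_field: "infinite (UNIV :: 'k set)"
begin

lemma iota_zero: "\<iota> 0 = 0"
  using iota_add[of 0 0] by (metis add.right_neutral add_cancel_left_right)

lemma iota_nonzero: assumes "c \<noteq> 0" shows "\<iota> c \<noteq> 0"
proof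
  assume "\<iota> c = 0"
  then have "\<iota> (c * inverse c) = 0" by (simp only: iota_mult mult_zero_left)
  then show False using assms iota_one by simp
qed

lemma iota_diff: "\<iota> (x - y) = \<iota> x - \<iota> y"
  using iota_add[of "x - y" y] by simp

lemma iota_of_nat: "\<iota> (of_nat k) = of_nat k"
  by (induction k) (simp_all add: iota_zero iota_one iota_add)

lemma iota_power: "\<iota> (x ^ k) = \<iota> x ^ k"
  by (induction k) (simp_all add: iota_one iota_mult)

lemma iota_sigma_pow: "\<iota> ((\<sigma> ^^ i) x) = (\<sigma>' ^^ i) (\<iota> x)"
  by (induction i) (simp_all add: iota_sigma)

lemma iota_sigma_eval: "\<iota> (sigma_eval id \<sigma> H x) = sigma_eval \<iota> \<sigma>' H (\<iota> x)"
  unfolding sigma_eval_def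
  using hom_eval_mpoly[of \<iota> id "\<lambda>i. (\<sigma> ^^ i) x" H]
  by (simp add: iota_zero iota_one iota_add iota_mult iota_sigma_pow)

lemma epsilon_zero: "\<epsilon> 0 = 0"
  using epsilon_add[of 0 0] by (metis add.right_neutral add_cancel_left_right)

lemma iota_closed: "x \<in> val_ring v \<Longrightarrow> \<iota> x \<in> val_ring v'"
proof (cases "x = 0")
  case False
  assume "x \<in> val_ring v"
  then have "0 \<le> v x" using False by (simp add: val_ring_def)
  then have "\<epsilon> 0 \<le> \<epsilon> (v x)" using epsilon_mono by (simp add: strict_mono_less_eq)
  then show ?thesis using False by (simp add: val_ring_def epsilon_v epsilon_zero)
qed (simp add: iota_zero val_ring_def)

lemma eta_inj: "inj \<eta>"
proof -
  have z: "\<eta> 0 = 0"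
    using eta_add[of 0 0] by (metis add.right_neutral add_cancel_left_right)
  have nz: "c = 0" if "\<eta> c = 0" for c
  proof (rule ccontr)
    assume "c \<noteq> 0"
    then have "\<eta> c * \<eta> (inverse c) = 1" by (simp add: eta_mult[symmetric] eta_one)
    then show False using that by simp
  qed
  show ?thesis
  proof (rule injI)
    fix x y assume "\<eta> x = \<eta> y"
    then have "\<eta> (x - y) = 0" using eta_add[of "x - y" y] by simp
    then show "x = y" using nz by fastforce
  qed
qed

text \<open>
  Adding \<open>p\<^sup>k e\<close> to \<open>\<mu>\<close> preserves the residues of the first \<open>k\<close> Dwork coordinates and shifts the
  next one by \<open>\<eta> (\<pi> (\<sigma>\<^sup>k e))\<close>, which can be any element of the range of \<open>\<eta>\<close>.
\<close>

lemma generic_translate: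
  assumes d: "d \<in> val_ring v'" and F: "finite F"
    "\<And>h Q. (h, Q) \<in> F \<Longrightarrow> \<exists>l\<in>Poly_Mapping.keys Q. h (Poly_Mapping.lookup Q l) \<noteq> 0"
  shows "\<exists>\<mu>\<in>val_ring v. \<forall>(h, Q)\<in>F. eval_mpoly h (\<lambda>k. \<pi>' (ext.dwork (\<iota> \<mu> - d) k)) Q \<noteq> 0"
proof -
  define s where "s \<mu> = (\<lambda>k. \<pi>' (ext.dwork (\<iota> \<mu> - d) k))" for \<mu>
  have "\<exists>f\<in>s ` val_ring v. \<forall>(h, Q)\<in>F. eval_mpoly h f Q \<noteq> 0"
  proof (rule avoid_zeros)
    show "s ` val_ring v \<noteq> {}" using base.val_ring_0 by blast
  next
    fix f k assume "f \<in> s ` val_ring v"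
    then obtain \<mu> where \<mu>: "\<mu> \<in> val_ring v" "f = s \<mu>" by blast
    have "f k + \<eta> y \<in> {f' k | f'. f' \<in> s ` val_ring v \<and> (\<forall>i<k. f' i = f i)}" for y
    proof -
      \<comment> \<open>\<open>z\<close> lifts the desired shift \<open>y\<close>, and
        \<open>e\<close> is its preimage under \<open>\<sigma>^k\<close>, integral because
        \<open>\<sigma>\<close> maps the valuation ring onto itself.\<close>
      obtain z where z: "z \<in> val_ring v" "\<pi> z = y" using base.pi_surj by (metis UNIV_I imageE)
      obtain e where e: "e \<in> val_ring v" "z = (\<sigma> ^^ k) e"
      proof -
        have "(\<sigma> ^^ k) ` val_ring v = val_ring v"
        proof (induction k)
          case (Suc k)
          have "(\<sigma> ^^ Suc k) ` val_ring v = \<sigma> ` ((\<sigma> ^^ k) ` val_ring v)"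
            by (simp add: image_comp)
          with Suc show ?case by (simp add: base.sigma_val_ring)
        qed simp
        then show ?thesis using z(1) that by blast
      qed
      define \<mu>' where "\<mu>' = \<mu> + of_nat p ^ k * e"
      have \<mu>'c: "\<mu>' \<in> val_ring v"
        unfolding \<mu>'_def by (intro base.val_ring_closed \<mu> e)
      have eq: "\<iota> \<mu>' - d = (\<iota> \<mu> - d) + of_nat p ^ k * \<iota> e"
        by (simp add: \<mu>'_def iota_add iota_mult iota_power iota_of_nat)
      have c: "\<iota> \<mu> - d \<in> val_ring v'" "\<iota> e \<in> val_ring v'"
        using \<mu> e d by (auto intro: ext.val_ring_diff iota_closed)
      have "s \<mu>' i = f i" if "i < k" for i
        using ext.pi_dwork_perturb(1)[OF c that] by (simp add: s_def \<mu> eq)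
      moreover have "s \<mu>' k = f k + \<eta> y"
        using ext.pi_dwork_perturb(2)[OF c, of k] eta_pi[OF z(1)] z(2) e(2)
        by (simp add: s_def \<mu> eq iota_sigma_pow)
      ultimately show ?thesis using \<mu>'c by (auto intro!: exI[of _ "s \<mu>'"])
    qed
    then have "range (\<lambda>y. f k + \<eta> y) \<subseteq> {f' k | f'. f' \<in> s ` val_ring v \<and> (\<forall>i<k. f' i = f i)}"
      by blast
    moreover have "inj (\<lambda>y. f k + \<eta> y)"
      using eta_inj by (simp add: inj_def)
    then have "infinite (range (\<lambda>y. f k + \<eta> y))"
      using infinite_residue_field finite_imageD by blast
    ultimately show "infinite {f' k | f'. f' \<in> s ` val_ring v \<and> (\<forall>i<k. f' i = f i)}"
      using finite_subset by blast
  qed (use F in auto)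
  then show ?thesis by (auto simp: s_def)
qed

text \<open>\<open>F\<close>, \<open>M\<close>, \<open>N\<close> are chosen before \<open>t\<close>
  and \<open>z\<close>, so they serve a whole sequence. \<open>N m\<close> is the least value of a
  coefficient of \<open>Q m\<close> from \<open>ghost_expansion\<close>, and \<open>F\<close>
  collects the reductions of the \<open>Q m\<close>. The lower bound holds for all integral
  \<open>z\<close>; the exact value needs that no reduction vanishes and that one term has strictly
  smallest bound.\<close>

lemma value_of_difference:
  assumes H: "\<nexists>c. H = Const c"
  shows "\<exists>(F :: (('b \<Rightarrow> 'l) \<times> 'b mpoly) set) (M :: nat set) N. finite F \<and> finite M \<and> M \<noteq> {} \<and> 0 \<notin> M \<and>
    (\<forall>(h, Q)\<in>F. \<exists>l\<in>Poly_Mapping.keys Q. h (Poly_Mapping.lookup Q l) \<noteq> 0) \<and>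
    (\<forall>t z. t \<noteq> 0 \<and> \<sigma>' t = t \<and> z \<in> val_ring v' \<longrightarrow>
      (\<forall>\<delta>. (\<forall>m\<in>M. \<delta> \<le> N m + (\<Sum>i<m. v' t)) \<longrightarrow>
        ext.vge \<delta> (sigma_eval \<iota> \<sigma>' H (x + t * z) - sigma_eval \<iota> \<sigma>' H x)) \<and>
      ((\<forall>(h, Q)\<in>F. eval_mpoly h (\<lambda>k. \<pi>' (ext.dwork z k)) Q \<noteq> 0) \<longrightarrow>
        (\<forall>m\<in>M. (\<forall>k\<in>M. k \<noteq> m \<longrightarrow> N m + (\<Sum>i<m. v' t) < N k + (\<Sum>i<k. v' t)) \<longrightarrow>
          sigma_eval \<iota> \<sigma>' H (x + t * z) - sigma_eval \<iota> \<sigma>' H x \<noteq> 0 \<and>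
          v' (sigma_eval \<iota> \<sigma>' H (x + t * z) - sigma_eval \<iota> \<sigma>' H x) = N m + (\<Sum>i<m. v' t))))"
proof -
  have inf: "infinite (UNIV :: 'b set)"
    using finite_imp_CHAR_pos[where 'a = 'b] ext.char_0 by auto
  obtain M Q where M: "finite M" "M \<noteq> {}" "0 \<notin> M" "\<And>m. m \<in> M \<Longrightarrow> Q m \<noteq> 0"
    and expand: "\<And>t y. eval_mpoly \<iota> (\<lambda>i. (\<sigma>' ^^ i) x + t * ghost p y i) H =
      eval_mpoly \<iota> (\<lambda>i. (\<sigma>' ^^ i) x) H + (\<Sum>m\<in>M. t ^ m * eval_id y (Q m))"
    using ghost_expansion[of \<iota> p H "\<lambda>i. (\<sigma>' ^^ i) x", OF iota_zero iota_add iota_nonzero inf ext.P_nonzero H]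
    by blast
  define good where "good Q u \<longleftrightarrow> u \<noteq> 0 \<and> (\<exists>l\<in>Poly_Mapping.keys Q. \<pi>' (Poly_Mapping.lookup Q l / u) \<noteq> 0) \<and>
    (\<forall>y. (\<forall>i. y i \<in> val_ring v') \<longrightarrow> eval_id y Q / u \<in> val_ring v' \<and>
       \<pi>' (eval_id y Q / u) = eval_mpoly (\<lambda>c. \<pi>' (c / u)) (\<lambda>i. \<pi>' (y i)) Q)" for Q u
  have "\<forall>m\<in>M. \<exists>u. good (Q m) u"
    unfolding good_def using ext.eval_mpoly_normalize M(4) by blast
  then obtain u where u: "\<And>m. m \<in> M \<Longrightarrow> good (Q m) (u m)" by metis
  define F where "F = (\<lambda>m. (\<lambda>c. \<pi>' (c / u m), Q m)) ` M"
  define N where "N m = v' (u m)" for m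
  let ?D = "\<lambda>t z. sigma_eval \<iota> \<sigma>' H (x + t * z) - sigma_eval \<iota> \<sigma>' H x"
  have bounds: "(\<forall>\<delta>. (\<forall>m\<in>M. \<delta> \<le> N m + (\<Sum>i<m. v' t)) \<longrightarrow> ext.vge \<delta> (?D t z)) \<and>
      ((\<forall>(h, Q)\<in>F. eval_mpoly h (\<lambda>k. \<pi>' (ext.dwork z k)) Q \<noteq> 0) \<longrightarrow>
        (\<forall>m\<in>M. (\<forall>k\<in>M. k \<noteq> m \<longrightarrow> N m + (\<Sum>i<m. v' t) < N k + (\<Sum>i<k. v' t)) \<longrightarrow>
          ?D t z \<noteq> 0 \<and> v' (?D t z) = N m + (\<Sum>i<m. v' t)))"
    if t: "t \<noteq> 0" "\<sigma>' t = t" and z: "z \<in> val_ring v'" for t z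
  proof -
    let ?y = "ext.dwork z"
    define T where "T m = t ^ m * eval_id ?y (Q m)" for m
    \<comment> \<open>Since \<open>\<sigma>'\<close> fixes \<open>t\<close>, its \<open>i\<close>-th
      iterate sends \<open>x + t z\<close> to \<open>\<sigma>'^i(x) + t \<sigma>'^i(z)\<close>, and
      \<open>\<sigma>'^i(z)\<close> is the ghost component of the Dwork coordinates of
      \<open>z\<close>.\<close>
    have D: "?D t z = sum T M"
      using expand[of t ?y]
      by (simp add: sigma_eval_def ext.sigma_pow_add ext.sigma_pow_mult ext.sigma_pow_fixed[OF t(2)]
          ext.ghost_dwork T_def)
    have y: "\<forall>i. ?y i \<in> val_ring v'" using ext.dwork_closed[OF z] by blast
    \<comment> \<open>The integral factor of a term: its value is the excess of
      \<open>v' (T m)\<close> over \<open>N m + m v'(t)\<close>, and is \<open>0\<close> when the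
      residue of \<open>w m\<close> is nonzero.\<close>
    define w where "w m = eval_id ?y (Q m) / u m" for m
    have w: "w m \<in> val_ring v'" "\<pi>' (w m) = eval_mpoly (\<lambda>c. \<pi>' (c / u m)) (\<lambda>i. \<pi>' (?y i)) (Q m)"
      and u0: "u m \<noteq> 0" if "m \<in> M" for m
      using u[OF that] y unfolding good_def w_def by blast+
    have T: "T m = t ^ m * u m * w m" if "m \<in> M" for m
      using u0[OF that] by (simp add: T_def w_def)
    have vT: "v' (T m) = N m + (\<Sum>i<m. v' t) + v' (w m)" if "m \<in> M" "w m \<noteq> 0" for m
      using that u0[OF that(1)] t(1) by (simp add: T ext.v_mult ext.v_power N_def add_ac)
    have ge: "ext.vge (N m + (\<Sum>i<m. v' t)) (T m)" if "m \<in> M" for m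
      using w(1)[OF that] vT[OF that] T[OF that] by (cases "w m = 0") (auto simp: ext.vge_def val_ring_def)
    show ?thesis
    proof (intro conjI allI impI ballI)
      fix \<delta> assume "\<forall>m\<in>M. \<delta> \<le> N m + (\<Sum>i<m. v' t)"
      then show "ext.vge \<delta> (?D t z)"
        unfolding D using ge ext.vge_mono by (intro ext.vge_sum) blast
    next
      fix m
      assume F: "\<forall>(h, Q)\<in>F. eval_mpoly h (\<lambda>k. \<pi>' (?y k)) Q \<noteq> 0" and m: "m \<in> M"
        and min: "\<forall>k\<in>M. k \<noteq> m \<longrightarrow> N m + (\<Sum>i<m. v' t) < N k + (\<Sum>i<k. v' t)"
      have "\<pi>' (w m) \<noteq> 0"
        using F m by (auto simp: w(2)[OF m] F_def)
      then have "w m \<noteq> 0" "v' (w m) = 0"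
        using ext.pi_nonzero[OF w(1)[OF m]] by auto
      then have Tm: "T m \<noteq> 0" "v' (T m) = N m + (\<Sum>i<m. v' t)"
        using vT[OF m] T[OF m] u0[OF m] t(1) by auto
      have "ext.vgt (v' (T m)) (sum T (M - {m}))"
        using ge min by (intro ext.vgt_sum) (fastforce simp: ext.vge_def ext.vgt_def Tm)
      then have "sum T (M - {m}) + T m \<noteq> 0 \<and> v' (sum T (M - {m}) + T m) = v' (T m)"
        by (rule ext.v_add_eq[OF Tm(1)])
      moreover have "sum T M = sum T (M - {m}) + T m"
        using M(1) m by (simp add: sum.remove add.commute)
      ultimately show "?D t z \<noteq> 0" "v' (?D t z) = N m + (\<Sum>i<m. v' t)"
        unfolding D using Tm(2) by simp_all
    qed
  qed
  have F_good: "finite F" "\<forall>(h, Q)\<in>F. \<exists>l\<in>Poly_Mapping.keys Q. h (Poly_Mapping.lookup Q l) \<noteq> 0"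
    using M(1) u by (auto simp: F_def good_def)
  have all: "\<forall>t z. t \<noteq> 0 \<and> \<sigma>' t = t \<and> z \<in> val_ring v' \<longrightarrow>
      (\<forall>\<delta>. (\<forall>m\<in>M. \<delta> \<le> N m + (\<Sum>i<m. v' t)) \<longrightarrow> ext.vge \<delta> (?D t z)) \<and>
      ((\<forall>(h, Q)\<in>F. eval_mpoly h (\<lambda>k. \<pi>' (ext.dwork z k)) Q \<noteq> 0) \<longrightarrow>
        (\<forall>m\<in>M. (\<forall>k\<in>M. k \<noteq> m \<longrightarrow> N m + (\<Sum>i<m. v' t) < N k + (\<Sum>i<k. v' t)) \<longrightarrow>
          ?D t z \<noteq> 0 \<and> v' (?D t z) = N m + (\<Sum>i<m. v' t)))"
    by (intro allI impI, elim conjE, rule bounds)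
  show ?thesis
    by (rule exI[of _ F], rule exI[of _ M], rule exI[of _ N]) (intro conjI F_good M(1-3) all)
qed

end

section \<open>Pseudoconvergence\<close>

lemma sum_const_add:
  fixes g :: "'g::comm_monoid_add" and m d :: nat
  shows "(\<Sum>i<m + d. g) = (\<Sum>i<m. g) + (\<Sum>i<d. g)"
  by (induction d) (simp_all add: add_ac)

text \<open>With \<open>d = k - m\<close>, the difference \<open>L k - L m\<close> is
  \<open>N k - N m + d g\<close>, strictly increasing. Once nonnegative it is positive from then on;
  otherwise it is negative throughout.\<close>

lemma eventually_compare_affine:
  fixes g :: "'i::{linorder,no_top} \<Rightarrow> 'g::linordered_ab_group_add" and N :: "nat \<Rightarrow> 'g"
  assumes g: "\<And>\<rho> \<rho>'. \<rho>\<^sub>0 \<le> \<rho> \<Longrightarrow> \<rho> < \<rho>' \<Longrightarrow> g \<rho> < g \<rho>'" and "m < k"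
  defines "L \<equiv> \<lambda>m \<rho>. N m + (\<Sum>i<m. g \<rho>)"
  shows "(\<exists>\<rho>\<^sub>1\<ge>\<rho>\<^sub>0. \<forall>\<rho>\<ge>\<rho>\<^sub>1. L m \<rho> < L k \<rho>) \<or> (\<forall>\<rho>\<ge>\<rho>\<^sub>0. L k \<rho> < L m \<rho>)"
proof (cases "\<forall>\<rho>\<ge>\<rho>\<^sub>0. L k \<rho> < L m \<rho>")
  case False
  then obtain \<rho> where \<rho>: "\<rho>\<^sub>0 \<le> \<rho>" "L m \<rho> \<le> L k \<rho>" by (auto simp: not_less)
  obtain d where d: "k = m + d" "0 < d" using \<open>m < k\<close> less_imp_add_positive by blast
  have L: "L k \<rho> = (N k + (\<Sum>i<d. g \<rho>)) + (\<Sum>i<m. g \<rho>)" for \<rho>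
    by (simp only: L_def d sum_const_add) (simp add: add_ac)
  obtain \<rho>\<^sub>1 where \<rho>1: "\<rho> < \<rho>\<^sub>1" using gt_ex by blast
  have "L m \<rho>' < L k \<rho>'" if "\<rho>\<^sub>1 \<le> \<rho>'" for \<rho>'
  proof -
    have "N m \<le> N k + (\<Sum>i<d. g \<rho>)"
      using \<rho>(2) by (simp add: L) (simp add: L_def)
    also have "\<dots> < N k + (\<Sum>i<d. g \<rho>')"
      using g[OF \<rho>(1), of \<rho>'] \<rho>1 that d(2) by (intro add_strict_left_mono sum_strict_mono) auto
    finally show ?thesis by (simp add: L) (simp add: L_def)
  qed
  moreover have "\<rho>\<^sub>0 \<le> \<rho>\<^sub>1" using \<rho> \<rho>1 by simp
  ultimately show ?thesis by blast
qed blast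

text \<open>Any two indices are eventually compared strictly and in a fixed sense; a finite
  \<open>M\<close> therefore has an eventual least element.\<close>

lemma eventually_unique_min_affine:
  fixes g :: "'i::{linorder,no_top} \<Rightarrow> 'g::linordered_ab_group_add" and N :: "nat \<Rightarrow> 'g"
  assumes g: "\<And>\<rho> \<rho>'. \<rho>\<^sub>0 \<le> \<rho> \<Longrightarrow> \<rho> < \<rho>' \<Longrightarrow> g \<rho> < g \<rho>'"
    and M: "finite M" "M \<noteq> {}"
  shows "\<exists>m\<in>M. \<exists>\<rho>\<^sub>1\<ge>\<rho>\<^sub>0. \<forall>\<rho>\<ge>\<rho>\<^sub>1. \<forall>k\<in>M. k \<noteq> m \<longrightarrow>
    N m + (\<Sum>i<m. g \<rho>) < N k + (\<Sum>i<k. g \<rho>)"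
proof -
  define L where "L = (\<lambda>m \<rho>. N m + (\<Sum>i<m. g \<rho>))"
  have cmp: "(\<exists>\<rho>\<^sub>1\<ge>\<rho>\<^sub>0. \<forall>\<rho>\<ge>\<rho>\<^sub>1. L m \<rho> < L k \<rho>) \<or> (\<exists>\<rho>\<^sub>1\<ge>\<rho>\<^sub>0. \<forall>\<rho>\<ge>\<rho>\<^sub>1. L k \<rho> < L m \<rho>)"
    if "m \<noteq> k" for m k
    using that eventually_compare_affine[of \<rho>\<^sub>0 g m k N, OF g] eventually_compare_affine[of \<rho>\<^sub>0 g k m N, OF g]
    unfolding L_def by (meson linorder_neqE_nat order_refl)
  have "\<exists>m\<in>M. \<exists>\<rho>\<^sub>1\<ge>\<rho>\<^sub>0. \<forall>\<rho>\<ge>\<rho>\<^sub>1. \<forall>k\<in>M. k \<noteq> m \<longrightarrow> L m \<rho> < L k \<rho>"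
    using M
  proof (induction M rule: finite_ne_induct)
    case (insert k M)
    then obtain m \<rho>\<^sub>1 where m: "m \<in> M" "\<rho>\<^sub>0 \<le> \<rho>\<^sub>1"
      "\<And>\<rho> k. \<rho>\<^sub>1 \<le> \<rho> \<Longrightarrow> k \<in> M \<Longrightarrow> k \<noteq> m \<Longrightarrow> L m \<rho> < L k \<rho>" by blast
    have "k \<noteq> m" using m(1) insert by blast
    then consider \<rho>\<^sub>2 where "\<And>\<rho>. \<rho>\<^sub>2 \<le> \<rho> \<Longrightarrow> L m \<rho> < L k \<rho>"
      | \<rho>\<^sub>2 where "\<And>\<rho>. \<rho>\<^sub>2 \<le> \<rho> \<Longrightarrow> L k \<rho> < L m \<rho>"
      using cmp by blast
    then show ?case
    proof cases
      case 1
      then show ?thesis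
        using m by (intro bexI[of _ m] exI[of _ "max \<rho>\<^sub>1 \<rho>\<^sub>2"]) (auto simp: max.coboundedI1)
    next
      case 2
      have "L k \<rho> < L j \<rho>" if "max \<rho>\<^sub>1 \<rho>\<^sub>2 \<le> \<rho>" "j \<in> M" for \<rho> j
        using m(3)[of \<rho> j] 2[of \<rho>] that by (cases "j = m") auto
      then show ?thesis
        using m(2) by (intro bexI[of _ k] exI[of _ "max \<rho>\<^sub>1 \<rho>\<^sub>2"]) (auto simp: max.coboundedI1)
    qed
  qed auto
  then show ?thesis by (simp add: L_def)
qed

section \<open>Pseudolimits in an arbitrary valued field extension\<close>

context valued_field_extension
begin

lemma iota_add: "\<iota> (x + y) = \<iota> x \<oplus>\<^bsub>L\<^esub> \<iota> y"
  using ring_hom_add[OF iota_hom, of x y] by (simp add: ring_of_type_algebra_def)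

lemma iota_mult: "\<iota> (x * y) = \<iota> x \<otimes>\<^bsub>L\<^esub> \<iota> y"
  using ring_hom_mult[OF iota_hom, of x y] by (simp add: ring_of_type_algebra_def)

lemma iota_one: "\<iota> 1 = \<one>\<^bsub>L\<^esub>"
  using ring_hom_one[OF iota_hom] by (simp add: ring_of_type_algebra_def)

lemma iota_diff: "\<iota> (x - y) = \<iota> x \<ominus>\<^bsub>L\<^esub> \<iota> y"
  using iota_add[of "x - y" y] L.add_eq_iff_eq_minus[of "\<iota> x" "\<iota> y" "\<iota> (x - y)"] iota_closed by simp

lemma epsilon_zero: "\<epsilon> 0 = \<one>\<^bsub>\<Delta>\<^esub>"
  using epsilon_add[of 0 0] D.l_cancel_one'[of "\<epsilon> 0" "\<epsilon> 0"] epsilon_closed by simp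

lemma w_closed: "s \<in> carrier L - {\<zero>\<^bsub>L\<^esub>} \<Longrightarrow> w s \<in> carrier \<Delta>"
  using w_surj by blast

text \<open>\<open>-s\<close> is \<open>\<iota> (-1)\<close> times \<open>s\<close>, and
  \<open>-1\<close> has value \<open>0\<close> in the base.\<close>

lemma w_uminus:
  assumes s: "s \<in> carrier L - {\<zero>\<^bsub>L\<^esub>}"
  shows "w (\<ominus>\<^bsub>L\<^esub> s) = w s"
proof -
  have "\<iota> (-1) = \<ominus>\<^bsub>L\<^esub> \<one>\<^bsub>L\<^esub>"
  proof -
    have "\<iota> (-1) \<oplus>\<^bsub>L\<^esub> \<one>\<^bsub>L\<^esub> = \<iota> 0"
      using iota_add[of "-1" 1] by (simp add: iota_one)
    moreover have "\<iota> 0 = \<zero>\<^bsub>L\<^esub>"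
      using iota_diff[of 0 0] L.r_neg[OF iota_closed[of 0]] by (simp add: a_minus_def)
    ultimately show ?thesis
      using iota_closed[of "-1"] by (metis L.minus_equality L.one_closed)
  qed
  then have eq: "\<ominus>\<^bsub>L\<^esub> s = \<iota> (-1) \<otimes>\<^bsub>L\<^esub> s"
    using s by (simp add: L.l_minus)
  have "w (\<iota> (-1)) = \<one>\<^bsub>\<Delta>\<^esub>"
    using epsilon_w[of "-1"] v_minus[of 1] by (simp add: v_one epsilon_zero)
  then show ?thesis
    using w_mult[of "\<iota> (-1)" s] s iota_closed iota_nonzero[of "-1"] w_closed[OF s] by (simp add: eq)
qed

lemma w_add_eq:
  assumes s: "s \<in> carrier L - {\<zero>\<^bsub>L\<^esub>}" and t: "t \<in> carrier L - {\<zero>\<^bsub>L\<^esub>}"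
    and less: "w t \<preceq>\<^bsub>\<Delta>\<^esub> w s" "w t \<noteq> w s"
  shows "s \<oplus>\<^bsub>L\<^esub> t \<noteq> \<zero>\<^bsub>L\<^esub> \<and> w (s \<oplus>\<^bsub>L\<^esub> t) = w t"
proof -
  have ms: "\<ominus>\<^bsub>L\<^esub> s \<in> carrier L - {\<zero>\<^bsub>L\<^esub>}"
    using s by (metis DiffD1 DiffD2 DiffI L.a_inv_closed L.minus_minus L.minus_zero singletonD singletonI)
  have nz: "s \<oplus>\<^bsub>L\<^esub> t \<noteq> \<zero>\<^bsub>L\<^esub>"
  proof
    assume "s \<oplus>\<^bsub>L\<^esub> t = \<zero>\<^bsub>L\<^esub>"
    then have "s = \<ominus>\<^bsub>L\<^esub> t" using s t by (metis DiffD1 L.minus_equality)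
    then show False using w_uminus[OF t] less(2) by simp
  qed
  then have st: "s \<oplus>\<^bsub>L\<^esub> t \<in> carrier L - {\<zero>\<^bsub>L\<^esub>}" using s t by simp
  have 1: "w t \<preceq>\<^bsub>\<Delta>\<^esub> w (s \<oplus>\<^bsub>L\<^esub> t)"
    using w_add[OF s t nz] less(1) D.gle_trans[OF w_closed[OF t] w_closed[OF s] w_closed[OF st]] by blast
  have t_eq: "(s \<oplus>\<^bsub>L\<^esub> t) \<oplus>\<^bsub>L\<^esub> \<ominus>\<^bsub>L\<^esub> s = t"
    using s t by (simp add: L.a_comm[of s t] L.a_assoc L.r_neg)
  have "w (s \<oplus>\<^bsub>L\<^esub> t) \<preceq>\<^bsub>\<Delta>\<^esub> w t \<or> w s \<preceq>\<^bsub>\<Delta>\<^esub> w t"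
    using w_add[OF st ms] t by (simp add: t_eq w_uminus[OF s])
  moreover have "\<not> w s \<preceq>\<^bsub>\<Delta>\<^esub> w t"
    using less D.gle_antisym[OF w_closed[OF s] w_closed[OF t]] by auto
  ultimately have "w (s \<oplus>\<^bsub>L\<^esub> t) = w t"
    using 1 D.gle_antisym[OF w_closed[OF st] w_closed[OF t]] by blast
  with nz show ?thesis ..
qed

text \<open>Write \<open>x - b \<rho>\<close> as
  \<open>(x - a \<rho>') + (a \<rho>' - b \<rho>)\<close> with \<open>\<rho>'\<close> later than
  \<open>\<rho>\<close>. The first summand has value above \<open>\<epsilon> (g \<rho>)\<close>, the
  second exactly this value, hence so has the sum.\<close>

lemma pc_lim_in_transfer:
  fixes a b :: "'i::{wellorder,no_top} \<Rightarrow> 'a" and g :: "'i \<Rightarrow> 'g"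
  assumes x: "x \<in> carrier L" and lim: "pc_lim_in L \<Delta> w (\<iota> \<circ> a) x"
    and g: "\<And>\<rho> \<rho>'. \<rho>\<^sub>0 \<le> \<rho> \<Longrightarrow> \<rho> < \<rho>' \<Longrightarrow> g \<rho> < g \<rho>'"
    and aa: "\<And>\<rho> \<rho>'. \<rho>\<^sub>0 \<le> \<rho> \<Longrightarrow> \<rho> < \<rho>' \<Longrightarrow> a \<rho>' \<noteq> a \<rho> \<and> v (a \<rho>' - a \<rho>) = g \<rho>"
    and ab: "\<And>\<rho> \<rho>'. \<rho>\<^sub>0 \<le> \<rho> \<Longrightarrow> \<rho> < \<rho>' \<Longrightarrow> a \<rho>' \<noteq> b \<rho> \<and> v (a \<rho>' - b \<rho>) = g \<rho>"
  shows "pc_lim_in L \<Delta> w (\<iota> \<circ> b) x"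
proof -
  obtain \<rho>\<^sub>1 where ne: "\<And>\<rho>. \<rho>\<^sub>1 \<le> \<rho> \<Longrightarrow> \<iota> (a \<rho>) \<noteq> x"
    and mono: "\<And>\<rho> \<rho>'. \<rho>\<^sub>1 \<le> \<rho> \<Longrightarrow> \<rho> < \<rho>' \<Longrightarrow> w (x \<ominus>\<^bsub>L\<^esub> \<iota> (a \<rho>)) \<preceq>\<^bsub>\<Delta>\<^esub> w (x \<ominus>\<^bsub>L\<^esub> \<iota> (a \<rho>')) \<and>
        w (x \<ominus>\<^bsub>L\<^esub> \<iota> (a \<rho>)) \<noteq> w (x \<ominus>\<^bsub>L\<^esub> \<iota> (a \<rho>'))"
    using lim unfolding pc_lim_in_def comp_apply by blast
  define r where "r = max \<rho>\<^sub>0 \<rho>\<^sub>1"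
  have diff_closed: "x \<ominus>\<^bsub>L\<^esub> \<iota> c \<in> carrier L - {\<zero>\<^bsub>L\<^esub>} \<longleftrightarrow> \<iota> c \<noteq> x" for c
    using x iota_closed[of c] by (auto simp: L.r_right_minus_eq)
  have split: "x \<ominus>\<^bsub>L\<^esub> \<iota> c = (x \<ominus>\<^bsub>L\<^esub> \<iota> d) \<oplus>\<^bsub>L\<^esub> \<iota> (d - c)" for c d
    unfolding iota_diff a_minus_def using x iota_closed[of c] iota_closed[of d]
    by (simp add: L.a_assoc L.r_neg1)
  have io: "\<iota> (d - c) \<in> carrier L - {\<zero>\<^bsub>L\<^esub>}" if "d \<noteq> c" for c d
    using that iota_closed iota_nonzero[of "d - c"] by simp
  \<comment> \<open>\<open>x - a \<rho>\<close> is the sum of \<open>x - a \<rho>'\<close> and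
    \<open>a \<rho>' - a \<rho>\<close>. Its value lies below that of the first summand, so it is at
    least \<open>\<epsilon> (g \<rho>)\<close>, and the value of \<open>x - a \<rho>'\<close> is
    larger still.\<close>
  have ge: "\<epsilon> (g \<rho>) \<preceq>\<^bsub>\<Delta>\<^esub> w (x \<ominus>\<^bsub>L\<^esub> \<iota> (a \<rho>')) \<and> \<epsilon> (g \<rho>) \<noteq> w (x \<ominus>\<^bsub>L\<^esub> \<iota> (a \<rho>'))"
    if "r \<le> \<rho>" "\<rho> < \<rho>'" for \<rho> \<rho>'
  proof -
    have le: "\<rho>\<^sub>0 \<le> \<rho>" "\<rho>\<^sub>1 \<le> \<rho>" "\<rho>\<^sub>1 \<le> \<rho>'" using that by (auto simp: r_def)
    let ?s = "x \<ominus>\<^bsub>L\<^esub> \<iota> (a \<rho>)" and ?s' = "x \<ominus>\<^bsub>L\<^esub> \<iota> (a \<rho>')"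
    have s: "?s \<in> carrier L - {\<zero>\<^bsub>L\<^esub>}" "?s' \<in> carrier L - {\<zero>\<^bsub>L\<^esub>}"
      using ne le by (simp_all only: diff_closed not_False_eq_True)
    have "w ?s' \<preceq>\<^bsub>\<Delta>\<^esub> w ?s \<or> w (\<iota> (a \<rho>' - a \<rho>)) \<preceq>\<^bsub>\<Delta>\<^esub> w ?s"
      using w_add[OF s(2) io[of "a \<rho>'" "a \<rho>"]] aa[OF le(1) that(2)] s(1)
      by (simp add: split[of "a \<rho>" "a \<rho>'", symmetric])
    moreover have "\<not> w ?s' \<preceq>\<^bsub>\<Delta>\<^esub> w ?s"
      using mono[OF le(2) that(2)] D.gle_antisym[OF w_closed[OF s(1)] w_closed[OF s(2)]] by blast
    moreover have "w (\<iota> (a \<rho>' - a \<rho>)) = \<epsilon> (g \<rho>)"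
      using aa[OF le(1) that(2)] epsilon_w[of "a \<rho>' - a \<rho>"] by simp
    ultimately have e: "\<epsilon> (g \<rho>) \<preceq>\<^bsub>\<Delta>\<^esub> w ?s" by simp
    have "\<epsilon> (g \<rho>) \<preceq>\<^bsub>\<Delta>\<^esub> w ?s'"
      using D.gle_trans[OF epsilon_closed w_closed[OF s(1)] w_closed[OF s(2)] e] mono[OF le(2) that(2)] by blast
    moreover have "\<epsilon> (g \<rho>) \<noteq> w ?s'"
      using e mono[OF le(2) that(2)] D.gle_antisym[OF w_closed[OF s(1)] w_closed[OF s(2)]] by auto
    ultimately show ?thesis by blast
  qed
  have b: "\<iota> (b \<rho>) \<noteq> x \<and> w (x \<ominus>\<^bsub>L\<^esub> \<iota> (b \<rho>)) = \<epsilon> (g \<rho>)" if "r \<le> \<rho>" for \<rho>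
  proof -
    obtain \<rho>' where \<rho>': "\<rho> < \<rho>'" using gt_ex by blast
    have le: "\<rho>\<^sub>0 \<le> \<rho>" "\<rho>\<^sub>1 \<le> \<rho>'" using that \<rho>' by (auto simp: r_def)
    have ab': "a \<rho>' \<noteq> b \<rho>" "w (\<iota> (a \<rho>' - b \<rho>)) = \<epsilon> (g \<rho>)"
      using ab[OF le(1) \<rho>'] epsilon_w[of "a \<rho>' - b \<rho>"] by simp_all
    have s: "x \<ominus>\<^bsub>L\<^esub> \<iota> (a \<rho>') \<in> carrier L - {\<zero>\<^bsub>L\<^esub>}"
      using ne[OF le(2)] by (simp only: diff_closed not_False_eq_True)
    have "x \<ominus>\<^bsub>L\<^esub> \<iota> (b \<rho>) \<noteq> \<zero>\<^bsub>L\<^esub> \<and> w (x \<ominus>\<^bsub>L\<^esub> \<iota> (b \<rho>)) = w (\<iota> (a \<rho>' - b \<rho>))"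
      unfolding split[of "b \<rho>" "a \<rho>'"]
      using w_add_eq[OF s io[OF ab'(1)]] ge[OF that \<rho>'] by (simp only: ab'(2)) simp
    then show ?thesis
      using diff_closed[of "b \<rho>"] x iota_closed[of "b \<rho>"] ab'(2) by auto
  qed
  have "w (x \<ominus>\<^bsub>L\<^esub> \<iota> (b \<rho>)) \<preceq>\<^bsub>\<Delta>\<^esub> w (x \<ominus>\<^bsub>L\<^esub> \<iota> (b \<rho>')) \<and>
        w (x \<ominus>\<^bsub>L\<^esub> \<iota> (b \<rho>)) \<noteq> w (x \<ominus>\<^bsub>L\<^esub> \<iota> (b \<rho>'))" if "r \<le> \<rho>" "\<rho> < \<rho>'" for \<rho> \<rho>'
  proof -
    have "g \<rho> < g \<rho>'" using that by (intro g) (auto simp: r_def)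
    moreover have "w (x \<ominus>\<^bsub>L\<^esub> \<iota> (b \<rho>)) = \<epsilon> (g \<rho>)" "w (x \<ominus>\<^bsub>L\<^esub> \<iota> (b \<rho>')) = \<epsilon> (g \<rho>')"
      using b that by auto
    ultimately show ?thesis
      using epsilon_le by (metis less_le_not_le)
  qed
  then show ?thesis
    unfolding pc_lim_in_def comp_apply using b by (intro exI[of _ r]) blast
qed

end

text \<open>The second hypothesis ranges over all pairs from \<open>{a, b}\<close>, so that
  \<open>pc_lim_in_transfer\<close> applies in both directions.\<close>

lemma pc_equivI:
  fixes a b :: "'i::{wellorder,no_top} \<Rightarrow> 'a::field" and g :: "'i \<Rightarrow> 'g::linordered_ab_group_add"
  assumes g: "\<And>\<rho> \<rho>'. \<rho>\<^sub>0 \<le> \<rho> \<Longrightarrow> \<rho> < \<rho>' \<Longrightarrow> g \<rho> < g \<rho>'"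
    and d: "\<And>c d \<rho> \<rho>'. c \<in> {a, b} \<Longrightarrow> d \<in> {a, b} \<Longrightarrow> \<rho>\<^sub>0 \<le> \<rho> \<Longrightarrow> \<rho> < \<rho>' \<Longrightarrow>
      c \<rho>' \<noteq> d \<rho> \<and> v (c \<rho>' - d \<rho>) = g \<rho>"
  shows "pc_equiv v a b"
  unfolding pc_equiv_def
proof (intro allI impI ballI)
  fix L :: "('a list \<times> 'a list) ring" and \<Delta> :: "('a list \<times> 'a list) ordered_group" and w \<iota> \<epsilon> x
  assume ext: "valued_field_extension v L \<Delta> w \<iota> \<epsilon>" and x: "x \<in> carrier L"
  have "pc_lim_in L \<Delta> w (\<iota> \<circ> d) x" if "pc_lim_in L \<Delta> w (\<iota> \<circ> c) x" "c \<in> {a, b}" "d \<in> {a, b}" for c d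
    using valued_field_extension.pc_lim_in_transfer[of v L \<Delta> w \<iota> \<epsilon> x c \<rho>\<^sub>0 g d, OF ext x that(1) g]
      assms(2)[OF that(2,2)] assms(2)[OF that(2,3)] by blast
  then show "pc_lim_in L \<Delta> w (\<iota> \<circ> a) x \<longleftrightarrow> pc_lim_in L \<Delta> w (\<iota> \<circ> b) x" by blast
qed

section \<open>The modified sequence\<close>

context witt_extension
begin

lemma iota_pc_lim:
  fixes b :: "'i::{wellorder,no_top} \<Rightarrow> 'a"
  assumes "pc_lim v' (\<lambda>\<rho>. \<iota> (b \<rho>)) (\<iota> c)"
  shows "pc_lim v b c"
proof -
  obtain r where r: "\<And>\<rho>. r \<le> \<rho> \<Longrightarrow> \<iota> (b \<rho>) \<noteq> \<iota> c"
    and mono: "strict_mono_on {r..} (\<lambda>\<rho>. v' (\<iota> c - \<iota> (b \<rho>)))"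
    using assms by (auto simp: pc_lim_def)
  have ne: "b \<rho> \<noteq> c" if "r \<le> \<rho>" for \<rho>
    using r[OF that] by auto
  then have "v' (\<iota> c - \<iota> (b \<rho>)) = \<epsilon> (v (c - b \<rho>))" if "r \<le> \<rho>" for \<rho>
    using ne[OF that, symmetric] epsilon_v[of "c - b \<rho>"] by (simp add: iota_diff)
  with mono have "strict_mono_on {r..} (\<lambda>\<rho>. v (c - b \<rho>))"
    using strict_mono_less[OF epsilon_mono] by (auto simp: strict_mono_on_def)
  with ne show ?thesis by (auto simp: pc_lim_def)
qed

text \<open>In \<open>c \<rho>' - d \<rho> = (c \<rho>' - x) + (x - d \<rho>)\<close> the first
  summand has the larger value. For \<open>c = d\<close> this also shows that
  \<open>\<gamma> \<rho>\<close> comes from the value group of the base.\<close>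

lemma diff_of_pseudolimit_approximants:
  fixes c d :: "'i::linorder \<Rightarrow> 'a" and \<gamma> :: "'i \<Rightarrow> 'h"
  assumes c: "\<And>\<rho>. r \<le> \<rho> \<Longrightarrow> \<iota> (c \<rho>) \<noteq> x \<and> v' (x - \<iota> (c \<rho>)) = \<gamma> \<rho>"
    and d: "\<And>\<rho>. r \<le> \<rho> \<Longrightarrow> \<iota> (d \<rho>) \<noteq> x \<and> v' (x - \<iota> (d \<rho>)) = \<gamma> \<rho>"
    and \<gamma>: "\<gamma> \<rho> < \<gamma> \<rho>'" and \<rho>: "r \<le> \<rho>" "r \<le> \<rho>'"
  shows "c \<rho>' \<noteq> d \<rho> \<and> \<epsilon> (v (c \<rho>' - d \<rho>)) = \<gamma> \<rho>"
proof -
  let ?s = "\<iota> (c \<rho>') - x" and ?t = "x - \<iota> (d \<rho>)"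
  have "v' ?s = \<gamma> \<rho>'" using c[OF \<rho>(2)] ext.v_diff_commute by metis
  then have "ext.vgt (v' ?t) ?s" using d[OF \<rho>(1)] \<gamma> by (simp add: ext.vgt_def)
  then have "?s + ?t \<noteq> 0 \<and> v' (?s + ?t) = v' ?t"
    using d[OF \<rho>(1)] by (intro ext.v_add_eq) auto
  then have "\<iota> (c \<rho>' - d \<rho>) \<noteq> 0" "v' (\<iota> (c \<rho>' - d \<rho>)) = \<gamma> \<rho>"
    using d[OF \<rho>(1)] by (simp_all add: iota_diff)
  moreover from this(1) have "c \<rho>' - d \<rho> \<noteq> 0" using iota_zero by metis
  ultimately show ?thesis
    using epsilon_v[of "c \<rho>' - d \<rho>"] by simp
qed

text \<open>
  If \<open>v'(y) \<le> \<nu>\<^sub>\<rho>\<close> for some \<open>\<rho>\<close>, then \<open>v'(s\<^sub>\<rho>) = v'(y)\<close> eventually, contradicting \<open>s \<leadsto> 0\<close>.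
\<close>

lemma pc_lim_zero_transfer:
  fixes s t :: "'i::{wellorder,no_top} \<Rightarrow> 'b" and \<nu> :: "'i \<Rightarrow> 'h"
  assumes s: "pc_lim v' s 0"
    and mono: "\<And>\<rho> \<rho>'. r \<le> \<rho> \<Longrightarrow> \<rho> < \<rho>' \<Longrightarrow> \<nu> \<rho> < \<nu> \<rho>'"
    and t: "\<And>\<rho>. r \<le> \<rho> \<Longrightarrow> t \<rho> - y \<noteq> 0 \<and> v' (t \<rho> - y) = \<nu> \<rho>"
    and ge: "\<And>\<rho>. r \<le> \<rho> \<Longrightarrow> ext.vge (\<nu> \<rho>) (s \<rho> - y)"
  shows "pc_lim v' t 0"
proof -
  have gt: "y = 0 \<or> \<nu> \<rho> < v' y" if \<rho>: "r \<le> \<rho>" for \<rho>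
  proof (rule ccontr)
    assume "\<not> (y = 0 \<or> \<nu> \<rho> < v' y)"
    then have y: "y \<noteq> 0" "v' y \<le> \<nu> \<rho>" by auto
    have const: "v' (s \<rho>') = v' y" if "\<rho> < \<rho>'" for \<rho>'
    proof -
      have "v' y < \<nu> \<rho>'" using y(2) mono[OF \<rho> that] by simp
      then have "ext.vgt (v' y) (s \<rho>' - y)"
        using \<rho> that by (intro ext.vgt_if_vge[OF ge]) auto
      then show ?thesis using ext.v_add_eq[OF y(1)] by fastforce
    qed
    obtain q where q: "\<And>\<rho>. q \<le> \<rho> \<Longrightarrow> s \<rho> \<noteq> 0" "strict_mono_on {q..} (\<lambda>\<rho>. v' (0 - s \<rho>))"
      using s by (auto simp: pc_lim_def)
    obtain \<rho>1 where 1: "max \<rho> q < \<rho>1" using gt_ex by blast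
    obtain \<rho>2 where 2: "\<rho>1 < \<rho>2" using gt_ex by blast
    have "v' (0 - s \<rho>1) < v' (0 - s \<rho>2)"
      using 1 2 by (intro strict_mono_onD[OF q(2)]) auto
    moreover have "v' (0 - s \<rho>1) = v' (s \<rho>1)" "v' (0 - s \<rho>2) = v' (s \<rho>2)"
      using q(1)[of \<rho>1] q(1)[of \<rho>2] 1 2 ext.v_minus by auto
    ultimately show False using const[of \<rho>1] const[of \<rho>2] 1 2 by auto
  qed
  \<comment> \<open>Now \<open>y\<close> has larger value than \<open>t \<rho> - y\<close>, so
    \<open>t \<rho>\<close> inherits the value \<open>\<nu> \<rho>\<close>.\<close>
  have "t \<rho> \<noteq> 0 \<and> v' (0 - t \<rho>) = \<nu> \<rho>" if "r \<le> \<rho>" for \<rho>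
  proof -
    have "y + (t \<rho> - y) \<noteq> 0 \<and> v' (y + (t \<rho> - y)) = v' (t \<rho> - y)"
      using t[OF that] gt[OF that] by (intro ext.v_add_eq) (auto simp: ext.vgt_def)
    then show ?thesis using t[OF that] ext.v_minus by simp
  qed
  then show ?thesis
    unfolding pc_lim_def using mono
    by (intro exI[of _ r]) (auto simp: strict_mono_on_def)
qed

text \<open>Besides the pseudoconvergence of \<open>H(b)\<close> to \<open>H(x)\<close>, the last
  clause bounds the error at \<open>a\<close> by the same \<open>\<nu>\<close>; for
  \<open>H = G\<close> this is the comparison that \<open>pc_lim_zero_transfer\<close>
  needs.\<close>

definition increasing_approximation ::
  "'b \<Rightarrow> ('i::{wellorder,no_top} \<Rightarrow> 'a) \<Rightarrow> ('i \<Rightarrow> 'a) \<Rightarrow> 'a mpoly \<Rightarrow> 'i \<Rightarrow> ('i \<Rightarrow> 'h) \<Rightarrow> bool" where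
  "increasing_approximation x a b H r \<nu> \<longleftrightarrow>
    (\<forall>\<rho> \<rho>'. r \<le> \<rho> \<longrightarrow> \<rho> < \<rho>' \<longrightarrow> \<nu> \<rho> < \<nu> \<rho>') \<and>
    (\<forall>\<rho>\<ge>r. sigma_eval \<iota> \<sigma>' H (\<iota> (b \<rho>)) - sigma_eval \<iota> \<sigma>' H x \<noteq> 0 \<and>
      v' (sigma_eval \<iota> \<sigma>' H (\<iota> (b \<rho>)) - sigma_eval \<iota> \<sigma>' H x) = \<nu> \<rho> \<and>
      ext.vge (\<nu> \<rho>) (sigma_eval \<iota> \<sigma>' H (\<iota> (a \<rho>)) - sigma_eval \<iota> \<sigma>' H x))"

text \<open>The conditions from all \<open>H\<close> in \<open>HH\<close> form one finite set
  \<open>E\<close> of residue polynomials, met by a single choice of \<open>\<mu>\<close> at each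
  index; so one sequence serves all of \<open>HH\<close>.\<close>

lemma exists_generic_sequence:
  fixes a :: "'i::{wellorder,no_top} \<Rightarrow> 'a"
  assumes axiom2: "\<And>\<gamma>. \<exists>t. t \<noteq> 0 \<and> \<sigma> t = t \<and> v t = \<gamma>"
    and lim: "pc_lim v' (\<lambda>\<rho>. \<iota> (a \<rho>)) x"
    and HH: "finite HH" "\<And>H. H \<in> HH \<Longrightarrow> \<nexists>c. H = Const c"
  shows "\<exists>b. pc_seq v b \<and> pc_equiv v a b \<and>
    (\<forall>H\<in>HH. \<exists>r \<nu>. increasing_approximation x a b H r \<nu>)"
proof -
  define \<gamma> where "\<gamma> \<rho> = v' (x - \<iota> (a \<rho>))" for \<rho>
  obtain r where a: "\<And>\<rho>. r \<le> \<rho> \<Longrightarrow> \<iota> (a \<rho>) \<noteq> x"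
    and \<gamma>_mono: "strict_mono_on {r..} \<gamma>"
    using lim by (auto simp: pc_lim_def \<gamma>_def[abs_def])
  have \<gamma>: "\<gamma> \<rho> < \<gamma> \<rho>'" if "r \<le> \<rho>" "\<rho> < \<rho>'" for \<rho> \<rho>'
    using that by (intro strict_mono_onD[OF \<gamma>_mono]) auto
  have a': "\<iota> (a \<rho>) \<noteq> x \<and> v' (x - \<iota> (a \<rho>)) = \<gamma> \<rho>" if "r \<le> \<rho>" for \<rho>
    using a[OF that] by (simp add: \<gamma>_def)
  \<comment> \<open>The values \<open>\<gamma> \<rho>\<close> are pulled back to the base group,
    where Axiom 2 supplies fixed elements of that value.\<close>
  have "\<exists>g. r \<le> \<rho> \<longrightarrow> \<epsilon> g = \<gamma> \<rho>" for \<rho>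
  proof (cases "r \<le> \<rho>")
    case True
    obtain \<rho>' where \<rho>': "\<rho> < \<rho>'" using gt_ex by blast
    then have "r \<le> \<rho>'" using True by simp
    then show ?thesis
      using diff_of_pseudolimit_approximants[of r a x \<gamma> a \<rho> \<rho>', OF a' a' \<gamma>[OF True \<rho>'] True]
      by blast
  qed simp
  then obtain g where g: "\<And>\<rho>. r \<le> \<rho> \<Longrightarrow> \<epsilon> (g \<rho>) = \<gamma> \<rho>" by metis
  have g_mono: "g \<rho> < g \<rho>'" if "r \<le> \<rho>" "\<rho> < \<rho>'" for \<rho> \<rho>'
  proof -
    have "r \<le> \<rho>'" using that by simp
    then show ?thesis
      using \<gamma>[OF that] g[OF that(1)] g[of \<rho>'] strict_mono_less[OF epsilon_mono] by metis
  qed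

  define nonzero where "nonzero F \<longleftrightarrow> (\<forall>(h, Q)\<in>F. \<exists>l\<in>Poly_Mapping.keys Q. h (Poly_Mapping.lookup Q l) \<noteq> 0)"
    for F :: "(('b \<Rightarrow> 'l) \<times> 'b mpoly) set"
  define bounds where "bounds H F M N \<longleftrightarrow> (\<forall>t z. t \<noteq> 0 \<and> \<sigma>' t = t \<and> z \<in> val_ring v' \<longrightarrow>
      (\<forall>\<delta>. (\<forall>m\<in>M. \<delta> \<le> N m + (\<Sum>i<m. v' t)) \<longrightarrow>
        ext.vge \<delta> (sigma_eval \<iota> \<sigma>' H (x + t * z) - sigma_eval \<iota> \<sigma>' H x)) \<and>
      ((\<forall>(h, Q)\<in>F. eval_mpoly h (\<lambda>k. \<pi>' (ext.dwork z k)) Q \<noteq> 0) \<longrightarrow>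
        (\<forall>m\<in>M. (\<forall>k\<in>M. k \<noteq> m \<longrightarrow> N m + (\<Sum>i<m. v' t) < N k + (\<Sum>i<k. v' t)) \<longrightarrow>
          sigma_eval \<iota> \<sigma>' H (x + t * z) - sigma_eval \<iota> \<sigma>' H x \<noteq> 0 \<and>
          v' (sigma_eval \<iota> \<sigma>' H (x + t * z) - sigma_eval \<iota> \<sigma>' H x) = N m + (\<Sum>i<m. v' t))))"
    for H and F :: "(('b \<Rightarrow> 'l) \<times> 'b mpoly) set" and M :: "nat set" and N
  have "\<forall>H\<in>HH. \<exists>F M N. finite F \<and> finite M \<and> M \<noteq> {} \<and> 0 \<notin> M \<and> nonzero F \<and> bounds H F M N"
    unfolding nonzero_def bounds_def
    by (intro ballI value_of_difference HH(2))
  then obtain F M N where "\<forall>H\<in>HH. finite (F H) \<and> finite (M H) \<and> M H \<noteq> {} \<and> 0 \<notin> M H \<and>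
      nonzero (F H) \<and> bounds H (F H) (M H) (N H)"
    unfolding bchoice_iff by blast
  then have FMN: "finite (F H)" "finite (M H)" "M H \<noteq> {}" "0 \<notin> M H" "nonzero (F H)"
    "bounds H (F H) (M H) (N H)" if "H \<in> HH" for H
    using that by blast+
  \<comment> \<open>The extra pair \<open>(\<pi>', Var 0)\<close> demands that the residue of
    \<open>dwork z 0 = z\<close> be nonzero; so \<open>z\<close> is a unit and
    \<open>b \<rho>\<close> is exactly as far from \<open>x\<close> as
    \<open>a \<rho>\<close>.\<close>
  define E where "E = insert (\<pi>', Var 0) (\<Union>H\<in>HH. F H)"
  have E: "finite E" "\<And>h Q. (h, Q) \<in> E \<Longrightarrow> \<exists>l\<in>Poly_Mapping.keys Q. h (Poly_Mapping.lookup Q l) \<noteq> 0"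
  proof -
    show "finite E" unfolding E_def using HH(1) FMN(1) by blast
    show "\<exists>l\<in>Poly_Mapping.keys Q. h (Poly_Mapping.lookup Q l) \<noteq> 0" if "(h, Q) \<in> E" for h Q
    proof (cases "(h, Q) = (\<pi>', Var 0)")
      case True
      then show ?thesis by (simp add: Var_def ext.pi_one)
    next
      case False
      then obtain H where "H \<in> HH" "(h, Q) \<in> F H" using \<open>(h, Q) \<in> E\<close> unfolding E_def by blast
      then show ?thesis using FMN(5) unfolding nonzero_def by blast
    qed
  qed
  define gen where "gen z \<longleftrightarrow> (\<forall>(h, Q)\<in>E. eval_mpoly h (\<lambda>k. \<pi>' (ext.dwork z k)) Q \<noteq> 0)" for z
  \<comment> \<open>\<open>a \<rho>\<close> and \<open>\<beta>\<close> are both \<open>x\<close>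
    plus an integral multiple of the same \<open>t\<close>, so that one set of bounds applies to
    both.\<close>
  have "\<exists>\<beta>. r \<le> \<rho> \<longrightarrow> (\<exists>t z d. t \<noteq> 0 \<and> \<sigma>' t = t \<and> v' t = \<gamma> \<rho> \<and> z \<in> val_ring v' \<and> d \<in> val_ring v' \<and>
      gen z \<and> \<iota> \<beta> = x + t * z \<and> \<iota> (a \<rho>) = x + t * d)" for \<rho>
  proof (cases "r \<le> \<rho>")
    case True
    obtain \<theta> where \<theta>: "\<theta> \<noteq> 0" "\<sigma> \<theta> = \<theta>" "v \<theta> = g \<rho>" using axiom2 by blast
    define t where "t = \<iota> \<theta>"
    have t: "t \<noteq> 0" "\<sigma>' t = t" "v' t = \<gamma> \<rho>"
      using \<theta> g[OF True] iota_nonzero[OF \<theta>(1)] epsilon_v[OF \<theta>(1)] iota_sigma[of \<theta>]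
      by (simp_all add: t_def)
    \<comment> \<open>\<open>t\<close> has the value of \<open>x - a \<rho>\<close>, so
      \<open>d\<close> is integral; with \<open>\<beta> = a \<rho> + \<theta> * \<mu>\<close> the
      factor \<open>z\<close> becomes \<open>\<iota> \<mu> - d\<close>.\<close>
    define d where "d = (x - \<iota> (a \<rho>)) / t"
    have d: "d \<in> val_ring v'" "\<iota> (a \<rho>) = x - t * d"
      using a'[OF True] t unfolding d_def by (auto intro!: ext.val_ring_divide simp: ext.vge_def)
    have "finite E \<Longrightarrow> \<exists>\<mu>\<in>val_ring v. \<forall>(h, Q)\<in>E. eval_mpoly h (\<lambda>k. \<pi>' (ext.dwork (\<iota> \<mu> - d) k)) Q \<noteq> 0"
      using d(1) E(2) by (intro generic_translate) auto
    then obtain \<mu> where \<mu>: "\<mu> \<in> val_ring v" "gen (\<iota> \<mu> - d)"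
      using E(1) by (auto simp: gen_def)
    have "\<iota> (a \<rho> + \<theta> * \<mu>) = x + t * (\<iota> \<mu> - d)"
      using d(2) by (simp add: iota_add iota_mult t_def algebra_simps)
    moreover have "\<iota> \<mu> - d \<in> val_ring v'" "- d \<in> val_ring v'"
      using d(1) \<mu>(1) ext.val_ring_diff[OF ext.val_ring_0 d(1)] by (simp_all add: ext.val_ring_diff iota_closed)
    moreover have "\<iota> (a \<rho>) = x + t * (- d)" using d(2) by simp
    ultimately show ?thesis using t \<mu>(2) by blast
  qed simp
  then obtain b where b: "\<And>\<rho>. r \<le> \<rho> \<Longrightarrow> \<exists>t z d. t \<noteq> 0 \<and> \<sigma>' t = t \<and> v' t = \<gamma> \<rho> \<and> z \<in> val_ring v' \<and>
      d \<in> val_ring v' \<and> gen z \<and> \<iota> (b \<rho>) = x + t * z \<and> \<iota> (a \<rho>) = x + t * d"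
    by metis
  have b': "\<iota> (b \<rho>) \<noteq> x \<and> v' (x - \<iota> (b \<rho>)) = \<gamma> \<rho>" if "r \<le> \<rho>" for \<rho>
  proof -
    obtain t z where tz: "t \<noteq> 0" "v' t = \<gamma> \<rho>" "z \<in> val_ring v'" "gen z" "\<iota> (b \<rho>) = x + t * z"
      using b[OF \<open>r \<le> \<rho>\<close>] by blast
    have "eval_mpoly \<pi>' (\<lambda>k. \<pi>' (ext.dwork z k)) (Var 0) \<noteq> 0"
      using tz(4) by (simp add: gen_def E_def)
    then have "\<pi>' z \<noteq> 0"
      by (simp add: eval_mpoly_Var ext.pi_zero ext.pi_one ext.dwork_0)
    then have z: "z \<noteq> 0" "v' z = 0" using ext.pi_nonzero[OF tz(3)] by auto
    have "x - \<iota> (b \<rho>) = - (t * z)" using tz(5) by simp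
    then show ?thesis
      using tz z ext.v_minus[of "t * z"] ext.v_mult[OF tz(1) z(1)] by auto
  qed
  have cd: "c \<rho>' \<noteq> d \<rho> \<and> v (c \<rho>' - d \<rho>) = g \<rho>"
    if cd: "c \<in> {a, b}" "d \<in> {a, b}" and \<rho>: "r \<le> \<rho>" "\<rho> < \<rho>'" for c d \<rho> \<rho>'
  proof -
    have "c \<rho>' \<noteq> d \<rho> \<and> \<epsilon> (v (c \<rho>' - d \<rho>)) = \<gamma> \<rho>"
      using cd a' b' \<gamma>[OF \<rho>] \<rho> by (intro diff_of_pseudolimit_approximants[of r c x \<gamma> d]) auto
    then show ?thesis using g[OF \<rho>(1)] strict_mono_eq[OF epsilon_mono] by metis
  qed
  have "pc_seq v b"
    unfolding pc_seq_def
  proof (intro exI[of _ r] allI impI)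
    fix \<rho> \<rho>' \<rho>'' :: 'i assume \<rho>: "r \<le> \<rho>" "\<rho> < \<rho>'" "\<rho>' < \<rho>''"
    then show "b \<rho>' \<noteq> b \<rho> \<and> b \<rho>'' \<noteq> b \<rho>' \<and> v (b \<rho>' - b \<rho>) < v (b \<rho>'' - b \<rho>')"
      using cd[of b b \<rho> \<rho>'] cd[of b b \<rho>' \<rho>''] g_mono[of \<rho> \<rho>'] by auto
  qed
  moreover have "pc_equiv v a b"
    using g_mono cd by (rule pc_equivI)
  moreover have "\<exists>q \<nu>. increasing_approximation x a b H q \<nu>" if H: "H \<in> HH" for H
  proof -
    have M: "finite (M H)" "M H \<noteq> {}" "0 \<notin> M H"
      using FMN(2-4)[OF H] by simp_all
    have "\<exists>m\<in>M H. \<exists>q\<ge>r. \<forall>\<rho>\<ge>q. \<forall>k\<in>M H. k \<noteq> m \<longrightarrow>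
        N H m + (\<Sum>i<m. \<gamma> \<rho>) < N H k + (\<Sum>i<k. \<gamma> \<rho>)"
      by (rule eventually_unique_min_affine[OF \<gamma> M(1,2)])
    then obtain m q where m: "m \<in> M H" "r \<le> q"
      and min: "\<And>\<rho> k. q \<le> \<rho> \<Longrightarrow> k \<in> M H \<Longrightarrow> k \<noteq> m \<Longrightarrow>
        N H m + (\<Sum>i<m. \<gamma> \<rho>) < N H k + (\<Sum>i<k. \<gamma> \<rho>)" by blast
    \<comment> \<open>The eventually smallest bound; it is strictly increasing because
      \<open>m\<close>, taken from \<open>M H\<close>, is positive.\<close>
    define \<nu> where "\<nu> \<rho> = N H m + (\<Sum>i<m. \<gamma> \<rho>)" for \<rho>
    have "\<nu> \<rho> < \<nu> \<rho>'" if "q \<le> \<rho>" "\<rho> < \<rho>'" for \<rho> \<rho>'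
    proof -
      have "0 < m" using m(1) M(3) by (cases m) auto
      moreover have "\<gamma> \<rho> < \<gamma> \<rho>'" using that m(2) by (intro \<gamma>) auto
      ultimately show ?thesis
        unfolding \<nu>_def by (intro add_strict_left_mono sum_strict_mono) auto
    qed
    moreover have "sigma_eval \<iota> \<sigma>' H (\<iota> (b \<rho>)) - sigma_eval \<iota> \<sigma>' H x \<noteq> 0 \<and>
        v' (sigma_eval \<iota> \<sigma>' H (\<iota> (b \<rho>)) - sigma_eval \<iota> \<sigma>' H x) = \<nu> \<rho> \<and>
        ext.vge (\<nu> \<rho>) (sigma_eval \<iota> \<sigma>' H (\<iota> (a \<rho>)) - sigma_eval \<iota> \<sigma>' H x)" if \<rho>: "q \<le> \<rho>" for \<rho>
    proof -
      obtain t z d where t: "t \<noteq> 0" "\<sigma>' t = t" "v' t = \<gamma> \<rho>"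
        and zd: "z \<in> val_ring v'" "d \<in> val_ring v'" "gen z"
        and eq: "\<iota> (b \<rho>) = x + t * z" "\<iota> (a \<rho>) = x + t * d"
        using b[OF order_trans[OF m(2) \<rho>]] by blast
      have gz: "\<forall>(h, Q)\<in>F H. eval_mpoly h (\<lambda>k. \<pi>' (ext.dwork z k)) Q \<noteq> 0"
        using zd(3) H unfolding gen_def E_def by blast
      have min': "\<forall>k\<in>M H. k \<noteq> m \<longrightarrow> N H m + (\<Sum>i<m. v' t) < N H k + (\<Sum>i<k. v' t)"
        unfolding t(3) using min[OF \<rho>] by blast
      then have min'': "\<forall>k\<in>M H. \<nu> \<rho> \<le> N H k + (\<Sum>i<k. v' t)"
        unfolding \<nu>_def t(3) by (metis less_imp_le order_refl)
      \<comment> \<open>The lower bound is used at \<open>d\<close>, for \<open>a \<rho>\<close>,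
        and the exact value at the generic \<open>z\<close>, for \<open>b \<rho>\<close>.\<close>
      note B = FMN(6)[OF H, unfolded bounds_def, THEN spec, THEN spec, THEN mp, OF conjI, OF t(1) conjI, OF t(2)]
      note 1 = B[OF zd(2), THEN conjunct1, THEN spec, THEN mp, OF min'']
      note 2 = B[OF zd(1), THEN conjunct2, THEN mp, OF gz, THEN bspec, OF m(1), THEN mp, OF min']
      show ?thesis
        using 1 2 by (simp add: eq \<nu>_def t(3))
    qed
    ultimately have "increasing_approximation x a b H q \<nu>"
      unfolding increasing_approximation_def by simp
    then show ?thesis by blast
  qed
  ultimately show ?thesis by blast
qed

end

theorem theorem4p5:
  fixes v :: "'a::field \<Rightarrow> 'g::linordered_ab_group_add" and \<pi> :: "'a \<Rightarrow> 'k::field"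
    and \<sigma> :: "'a \<Rightarrow> 'a" and p :: nat
    and v' :: "'b::field \<Rightarrow> 'h::linordered_ab_group_add" and \<pi>' :: "'b \<Rightarrow> 'l::field"
    and \<sigma>' :: "'b \<Rightarrow> 'b"
    and \<iota> :: "'a \<Rightarrow> 'b" and \<epsilon> :: "'g \<Rightarrow> 'h" and \<eta> :: "'k \<Rightarrow> 'l"
    and a :: "'i::{wellorder,no_top} \<Rightarrow> 'a" and x :: 'b
    and G :: "'a mpoly" and n :: nat and S :: "'a mpoly set"
  assumes "valued_difference_field_axiom2 v \<pi> \<sigma>"
    and "witt_case v \<pi> \<sigma> p"
    and "infinite (UNIV :: 'k set)"
    and "valued_difference_field_extension v \<pi> \<sigma> v' \<pi>' \<sigma>' \<iota> \<epsilon> \<eta>"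
    and "witt_case v' \<pi>' \<sigma>' p"
    and "pc_seq v a"
    and "pc_lim v' (\<lambda>\<rho>. \<iota> (a \<rho>)) x"
    and "order_le n G"
    and "pc_lim v (\<lambda>\<rho>. sigma_eval id \<sigma> G (a \<rho>)) 0"
    and "\<And>m j (b :: 'i \<Rightarrow> 'a).
      1 \<le> m \<Longrightarrow> m \<le> total_degree G \<Longrightarrow>
      Poly_Mapping.keys j \<subseteq> {..n} \<Longrightarrow> 1 \<le> wt j \<Longrightarrow> wt j \<le> m * p ^ n \<Longrightarrow>
      pc_seq v b \<Longrightarrow> pc_equiv v a b \<Longrightarrow>
      \<not> pc_lim v (\<lambda>\<rho>. Lambda p n j m (sigma_taylor \<sigma> G (b \<rho>))) 0"
    and "finite S"
  shows "\<exists>b :: 'i \<Rightarrow> 'a. pc_seq v b \<and> pc_equiv v a b \<and>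
    pc_lim v (\<lambda>\<rho>. sigma_eval id \<sigma> G (b \<rho>)) 0 \<and>
    (\<forall>H\<in>S. (\<nexists>c. H = Const c) \<longrightarrow>
       pc_lim v' (\<lambda>\<rho>. \<iota> (sigma_eval id \<sigma> H (b \<rho>))) (sigma_eval \<iota> \<sigma>' H x))"
proof -
  interpret witt_extension v \<pi> \<sigma> v' \<pi>' \<sigma>' \<iota> \<epsilon> \<eta> p
    using assms(2-5) by (intro witt_extension.intro witt_extension_axioms.intro)
  interpret A: valued_difference_field_axiom2 v \<pi> \<sigma> by (rule assms(1))
  obtain r where r: "strict_mono_on {r..} (\<lambda>\<rho>. v (0 - sigma_eval id \<sigma> G (a \<rho>)))"
    "\<And>\<rho>. r \<le> \<rho> \<Longrightarrow> sigma_eval id \<sigma> G (a \<rho>) \<noteq> 0"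
    using assms(9) by (auto simp: pc_lim_def)
  \<comment> \<open>Constant terms cannot have strictly increasing values; so \<open>G\<close> can
    be treated like the nonconstant members of \<open>S\<close>.\<close>
  have G: "\<nexists>c. G = Const c"
  proof
    assume "\<exists>c. G = Const c"
    then obtain c where "G = Const c" ..
    then have c: "sigma_eval id \<sigma> G (a \<rho>) = c" for \<rho>
      by (simp add: sigma_eval_def eval_mpoly_Const)
    obtain \<rho> where \<rho>: "r < \<rho>" using gt_ex by blast
    have "v (0 - sigma_eval id \<sigma> G (a r)) < v (0 - sigma_eval id \<sigma> G (a \<rho>))"
      using \<rho> by (intro strict_mono_onD[OF r(1)]) auto
    then show False by (simp add: c)
  qed
  \<comment> \<open>The hypothesis is moved to the extension, because the comparison of
    \<open>G(a)\<close> with \<open>G(b)\<close> passes through \<open>G(x)\<close>.\<close>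
  have lim0: "pc_lim v' (\<lambda>\<rho>. \<iota> (sigma_eval id \<sigma> G (a \<rho>))) 0"
  proof -
    have "v' (0 - \<iota> (sigma_eval id \<sigma> G (a \<rho>))) = \<epsilon> (v (0 - sigma_eval id \<sigma> G (a \<rho>)))" if "r \<le> \<rho>" for \<rho>
      using epsilon_v[of "0 - sigma_eval id \<sigma> G (a \<rho>)"] r(2)[OF that]
      by (simp only: iota_diff iota_zero) simp
    then have "strict_mono_on {r..} (\<lambda>\<rho>. v' (0 - \<iota> (sigma_eval id \<sigma> G (a \<rho>))))"
      using r(1) strict_mono_less[OF epsilon_mono] unfolding strict_mono_on_def by auto
    then show ?thesis
      using r(2) iota_nonzero unfolding pc_lim_def by blast
  qed
  let ?HH = "{H \<in> insert G S. \<nexists>c. H = Const c}"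
  obtain b where b: "pc_seq v b" "pc_equiv v a b"
    and vals: "\<And>H. H \<in> ?HH \<Longrightarrow> \<exists>r \<nu>. increasing_approximation x a b H r \<nu>"
  proof -
    have "finite ?HH" using assms(11) by simp
    then show thesis
      using exists_generic_sequence[OF A.axiom2 assms(7), of ?HH] that by blast
  qed
  have "pc_lim v' (\<lambda>\<rho>. \<iota> (sigma_eval id \<sigma> H (b \<rho>))) (sigma_eval \<iota> \<sigma>' H x)"
    if H: "H \<in> S" "\<nexists>c. H = Const c" for H
  proof -
    obtain q \<nu> where "increasing_approximation x a b H q \<nu>"
      using vals[of H] H by blast
    then show ?thesis
      unfolding increasing_approximation_def pc_lim_def iota_sigma_eval strict_mono_on_def ext.v_diff_commute[of "sigma_eval \<iota> \<sigma>' H x"]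
      by (intro exI[of _ q]) auto
  qed
  \<comment> \<open>\<open>pc_lim_zero_transfer\<close> is used with \<open>G(a)\<close>,
    \<open>G(b)\<close> and \<open>G(x)\<close> as \<open>s\<close>, \<open>t\<close> and
    \<open>y\<close>; the result is then brought back to \<open>K\<close>.\<close>
  moreover have "pc_lim v (\<lambda>\<rho>. sigma_eval id \<sigma> G (b \<rho>)) 0"
  proof -
    obtain q \<nu> where q: "increasing_approximation x a b G q \<nu>"
      using vals[of G] G by blast
    have "pc_lim v' (\<lambda>\<rho>. sigma_eval \<iota> \<sigma>' G (\<iota> (b \<rho>))) 0"
      using q unfolding increasing_approximation_def
      by (intro pc_lim_zero_transfer[OF lim0[unfolded iota_sigma_eval], of q \<nu>]) auto
    then show ?thesis
      by (intro iota_pc_lim) (simp add: iota_sigma_eval iota_zero)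
  qed
  ultimately show ?thesis using b by blast
qed

end
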